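(* Suppose $\Gamma$ is not a Dynkin diagram of the type $A$, $D$, or $E$, and let $S\in\mathfrak S$. (a) The word $w(S)\in\mathcal W$ is reduced. (b) There exists a preprojective $k(\Gamma,\Lambda)$-module $M$ satisfying $S\sim S_M$.
   Context: $k$ is an arbitrary field and $\Gamma=(\Gamma_0,\Gamma_1)$ is a finite connected graph (multiple edges allowed) without loops and with more than one vertex. An orientation $\Lambda$ on $\Gamma$ chooses for each edge a starting point and an endpoint among its incident vertices, giving a quiver $(\Gamma,\Lambda)$; all orientations are assumed to have no oriented cycles. A sink is a vertex at which no arrow starts. $\sigma_x\Lambda$ is the orientation obtained by reversing all arrows incident with $x$. A finite sequence $S=x_1,\dots,x_s$ of vertices ($s\ge 0$) is (+)-admissible on $(\Gamma,\Lambda)$ if $x_1$ is a sink for $\Lambda$, $x_2$ is a sink for $\sigma_{x_1}\Lambda$, and so on; put $\Lambda^S=\sigma_{x_s}\cdots\sigma_{x_1}\Lambda$. $\mathfrak S$ is the set of (+)-admissible sequences on $(\Gamma,\Lambda)$. $\sim$ is the equivalence relation on $\mathfrak S$ generated by interchanging two consecutive terms $x_i,x_{i+1}$ that are not connected by an edge of $\Gamma$. For $S,T\in\mathfrak S$, $S\preccurlyeq T$ ($S$ is a subsequence of $T$) means $T\sim SU$ (concatenation) for some (+)-admissible sequence $U$ on $(\Gamma,\Lambda^S)$. $k(\Gamma,\Lambda)$-modules are finite-dimensional left modules over the path algebra, identified with finite-dimensional representations $(V,f)$ of $(\Gamma,\Lambda)$ over $k$. For a sink $x$ of $(\Gamma,\Lambda)$,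 the positive reflection functor $F_x^+$ from $k(\Gamma,\Lambda)$-modules to $k(\Gamma,\sigma_x\Lambda)$-modules sends $(V,f)$ to $(W,g)$ with $W(z)=V(z)$ for $z\ne x$ and $W(x)=\ker\big(h:\bigoplus_i V(y_i)\to V(x)\big)$, where $a_i:y_i\to x$ are all the arrows ending at $x$ and $h$ is induced by the $f_{a_i}$; $g$ agrees with $f$ on arrows not incident with $x$, and for the reversed arrows $x\to y_i$ the maps $W(x)\to V(y_i)$ are induced by the inclusion $W(x)\subset\bigoplus_i V(y_i)$; on morphisms $F_x^+$ is defined naturally. For $S=x_1,\dots,x_s$ in $\mathfrak S$, $F(S)=F^+_{x_s}\cdots F^+_{x_1}$ (the identity if $S=\emptyset$); $S$ annihilates $M$ if $F(S)M=0$. $M$ is preprojective if some $S\in\mathfrak S$ annihilates it. A shortest sequence annihilating $M$ is an $S\in\mathfrak S$ that annihilates $M$ while no proper subsequence of $S$ (no $S'\preccurlyeq S$ with $S'\not\sim S$) annihilates $M$; for each preprojective $M$ such a sequence exists and is unique up to $\sim$, and it is denoted $S_M$. Weyl group: $\Gamma_0=\{1,\dots,n\}$; put $a_{ii}=2$ and, for $i\ne j$, $-a_{ij}=$ the number of edges connecting $i$ and $j$. With $e_1,\dots,e_n$ the standard basis of $\mathbb Z^n$, let $\sigma_i$ be the automorphism of $\mathbb Z^n$ with $\sigma_i(e_j)=e_j-a_{ij}e_i$ for all $j$; $\mathcal W\subset GL(\mathbb Z^n)$ is the group generated by the simple reflections $\sigma_1,\dots,\sigma_n$. The length $\ell(w)$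 of $w\in\mathcal W$ is the least $l\ge0$ such that $w$ is a product of $l$ simple reflections; a word $\sigma_{y_t}\cdots\sigma_{y_1}$ is reduced if its length as an element is $t$. For $S=x_1,\dots,x_s$ in $\mathfrak S$, $w(S)=\sigma_{x_s}\cdots\sigma_{x_1}$. *)

theory Defs
  imports "HOL-Library.Function_Algebras" "HOL-Library.FuncSet" "HOL-Analysis.Finite_Cartesian_Product"
begin

text \<open>The vertex set and the edge set are the finite types \<open>'v\<close> and \<open>'e\<close>; a graph, possibly with
  multiple edges, is given by the map sending each edge to its set of incident vertices.\<close>

definition loopless :: "('e \<Rightarrow> 'v set) \<Rightarrow> bool" where
  "loopless ends \<longleftrightarrow> (\<forall>e. card (ends e) = 2)"

definition adj :: "('e \<Rightarrow> 'v set) \<Rightarrow> 'v \<Rightarrow> 'v \<Rightarrow> bool" where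
  "adj ends x y \<longleftrightarrow> (\<exists>e. ends e = {x, y})"

definition connected_graph :: "('e \<Rightarrow> 'v set) \<Rightarrow> bool" where
  "connected_graph ends \<longleftrightarrow> (\<forall>x y. (adj ends)\<^sup>*\<^sup>* x y)"

text \<open>An orientation sends an edge to the pair (starting point, endpoint), so \<open>range \<Lambda>\<close> is the
  arrow relation of the quiver.\<close>

type_synonym ('v, 'e) orient = "'e \<Rightarrow> 'v \<times> 'v"

definition orientation :: "('e \<Rightarrow> 'v set) \<Rightarrow> ('v, 'e) orient \<Rightarrow> bool" where
  "orientation ends \<Lambda> \<longleftrightarrow> (\<forall>e. {fst (\<Lambda> e), snd (\<Lambda> e)} = ends e)"

definition no_oriented_cycles :: "('v, 'e) orient \<Rightarrow> bool" where
  "no_oriented_cycles \<Lambda> \<longleftrightarrow> acyclic (range \<Lambda>)"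

definition sink :: "('v, 'e) orient \<Rightarrow> 'v \<Rightarrow> bool" where
  "sink \<Lambda> x \<longleftrightarrow> (\<forall>e. fst (\<Lambda> e) \<noteq> x)"

definition reverse_at :: "'v \<Rightarrow> ('v, 'e) orient \<Rightarrow> ('v, 'e) orient" where
  "reverse_at x \<Lambda> = (\<lambda>e. if x \<in> {fst (\<Lambda> e), snd (\<Lambda> e)} then prod.swap (\<Lambda> e) else \<Lambda> e)"

primrec plus_admissible :: "('v, 'e) orient \<Rightarrow> 'v list \<Rightarrow> bool" where
  "plus_admissible \<Lambda> [] \<longleftrightarrow> True"
| "plus_admissible \<Lambda> (x # S) \<longleftrightarrow> sink \<Lambda> x \<and> plus_admissible (reverse_at x \<Lambda>) S"

definition reverse_along :: "'v list \<Rightarrow> ('v, 'e) orient \<Rightarrow> ('v, 'e) orient" where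
  "reverse_along S \<Lambda> = fold reverse_at S \<Lambda>"

inductive interchange :: "('e \<Rightarrow> 'v set) \<Rightarrow> ('v, 'e) orient \<Rightarrow> 'v list \<Rightarrow> 'v list \<Rightarrow> bool"
  for ends \<Lambda> where
  "\<lbrakk> \<not> adj ends x y; plus_admissible \<Lambda> (A @ [x, y] @ B); plus_admissible \<Lambda> (A @ [y, x] @ B) \<rbrakk>
    \<Longrightarrow> interchange ends \<Lambda> (A @ [x, y] @ B) (A @ [y, x] @ B)"

definition seq_equiv :: "('e \<Rightarrow> 'v set) \<Rightarrow> ('v, 'e) orient \<Rightarrow> 'v list \<Rightarrow> 'v list \<Rightarrow> bool" where
  "seq_equiv ends \<Lambda> S T \<longleftrightarrow>
     plus_admissible \<Lambda> S \<and> plus_admissible \<Lambda> T \<and> equivclp (interchange ends \<Lambda>) S T"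

definition subsequence :: "('e \<Rightarrow> 'v set) \<Rightarrow> ('v, 'e) orient \<Rightarrow> 'v list \<Rightarrow> 'v list \<Rightarrow> bool" where
  "subsequence ends \<Lambda> S T \<longleftrightarrow>
     plus_admissible \<Lambda> S \<and> plus_admissible \<Lambda> T \<and>
     (\<exists>U. plus_admissible (reverse_along S \<Lambda>) U \<and> seq_equiv ends \<Lambda> T (S @ U))"

text \<open>All vector spaces of a representation over the field \<open>'k\<close> are subspaces of the space of
  functions \<open>'e list \<Rightarrow> 'k\<close>. It has infinite dimension, so every finite-dimensional space is
  isomorphic to one of its subspaces. A family indexed by edges is again an element of it: the
  component at \<open>e\<close> is read off at the lists that start with \<open>e\<close>. This lets the direct sum in a
  reflection functor be formed, repeatedly, without changing the type.\<close>

type_synonym ('e, 'k) ambient = "'e list \<Rightarrow> 'k"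

definition scl :: "'k::field \<Rightarrow> ('e, 'k) ambient \<Rightarrow> ('e, 'k) ambient" where
  "scl c v = (\<lambda>l. c * v l)"

lemma vector_space_scl: "vector_space (scl :: 'k::field \<Rightarrow> ('e, 'k) ambient \<Rightarrow> _)"
  by unfold_locales (auto simp: scl_def fun_eq_iff algebra_simps)

definition coord :: "'e \<Rightarrow> ('e, 'k) ambient \<Rightarrow> ('e, 'k) ambient" where
  "coord e w = (\<lambda>l. w (e # l))"

definition direct_sum ::
  "'e set \<Rightarrow> ('e \<Rightarrow> ('e, 'k::field) ambient set) \<Rightarrow> ('e, 'k) ambient set" where
  "direct_sum I W = {w. w [] = 0 \<and> (\<forall>e\<in>I. coord e w \<in> W e) \<and> (\<forall>e. e \<notin> I \<longrightarrow> coord e w = 0)}"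

lemma direct_sum_bij: "bij_betw (\<lambda>w. \<lambda>e\<in>I. coord e w) (direct_sum I W) (\<Pi>\<^sub>E e\<in>I. W e)"
proof (rule bij_betwI[where g = "\<lambda>u l. case l of [] \<Rightarrow> 0 | e # l' \<Rightarrow> if e \<in> I then u e l' else 0"])
  show "(\<lambda>w. \<lambda>e\<in>I. coord e w) \<in> direct_sum I W \<rightarrow> (\<Pi>\<^sub>E e\<in>I. W e)"
    by (auto simp: direct_sum_def)
qed (auto simp: direct_sum_def coord_def fun_eq_iff PiE_def extensional_def split: list.splits)

record ('v, 'e, 'k) rep =
  vspace :: "'v \<Rightarrow> ('e, 'k) ambient set"
  arrow_map :: "'e \<Rightarrow> ('e, 'k) ambient \<Rightarrow> ('e, 'k) ambient"

text \<open>The values of \<open>arrow_map M e\<close> outside the space at the starting point of \<open>e\<close> are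
  irrelevant.\<close>

definition linear_between ::
  "('e, 'k::field) ambient set \<Rightarrow> ('e, 'k) ambient set
    \<Rightarrow> (('e, 'k) ambient \<Rightarrow> ('e, 'k) ambient) \<Rightarrow> bool" where
  "linear_between A B f \<longleftrightarrow>
     f ` A \<subseteq> B \<and> (\<forall>u\<in>A. \<forall>v\<in>A. f (u + v) = f u + f v) \<and> (\<forall>c. \<forall>u\<in>A. f (scl c u) = scl c (f u))"

definition quiver_rep :: "('v, 'e) orient \<Rightarrow> ('v, 'e, 'k::field) rep \<Rightarrow> bool" where
  "quiver_rep \<Lambda> M \<longleftrightarrow>
     (\<forall>x. module.subspace scl (vspace M x) \<and>
          (\<exists>B. finite B \<and> module.span scl B = vspace M x)) \<and>
     (\<forall>e. linear_between (vspace M (fst (\<Lambda> e))) (vspace M (snd (\<Lambda> e))) (arrow_map M e))"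

text \<open>Object part of the positive reflection functor at a sink \<open>x\<close>.\<close>

definition reflect ::
  "('v, 'e) orient \<Rightarrow> 'v \<Rightarrow> ('v, 'e, 'k::field) rep \<Rightarrow> ('v, 'e, 'k) rep" where
  "reflect \<Lambda> x M =
     (let I = {e. snd (\<Lambda> e) = x} in
      \<lparr> vspace = (vspace M)(x := {w \<in> direct_sum I (\<lambda>e. vspace M (fst (\<Lambda> e))).
                                 (\<Sum>e\<in>I. arrow_map M e (coord e w)) = 0}),
        arrow_map = (\<lambda>e. if e \<in> I then coord e else arrow_map M e) \<rparr>)"

primrec reflect_along ::
  "('v, 'e) orient \<Rightarrow> 'v list \<Rightarrow> ('v, 'e, 'k::field) rep \<Rightarrow> ('v, 'e, 'k) rep" where
  "reflect_along \<Lambda> [] M = M"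
| "reflect_along \<Lambda> (x # S) M = reflect_along (reverse_at x \<Lambda>) S (reflect \<Lambda> x M)"

definition annihilates ::
  "('v, 'e) orient \<Rightarrow> 'v list \<Rightarrow> ('v, 'e, 'k::field) rep \<Rightarrow> bool" where
  "annihilates \<Lambda> S M \<longleftrightarrow> (\<forall>x. vspace (reflect_along \<Lambda> S M) x = {0})"

definition preprojective :: "('v, 'e) orient \<Rightarrow> ('v, 'e, 'k::field) rep \<Rightarrow> bool" where
  "preprojective \<Lambda> M \<longleftrightarrow> (\<exists>S. plus_admissible \<Lambda> S \<and> annihilates \<Lambda> S M)"

definition is_shortest_annihilating ::
  "('e \<Rightarrow> 'v set) \<Rightarrow> ('v, 'e) orient \<Rightarrow> ('v, 'e, 'k::field) rep \<Rightarrow> 'v list \<Rightarrow> bool" where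
  "is_shortest_annihilating ends \<Lambda> M S \<longleftrightarrow>
     plus_admissible \<Lambda> S \<and> annihilates \<Lambda> S M \<and>
     (\<forall>S'. subsequence ends \<Lambda> S' S \<and> \<not> seq_equiv ends \<Lambda> S' S \<longrightarrow> \<not> annihilates \<Lambda> S' M)"

text \<open>For a preprojective representation such a sequence exists and is unique up to equivalence;
  a representative is chosen.\<close>

definition shortest_seq ::
  "('e \<Rightarrow> 'v set) \<Rightarrow> ('v, 'e) orient \<Rightarrow> ('v, 'e, 'k::field) rep \<Rightarrow> 'v list" where
  "shortest_seq ends \<Lambda> M = (SOME S. is_shortest_annihilating ends \<Lambda> M S)"

definition cartan :: "('e::finite \<Rightarrow> 'v set) \<Rightarrow> 'v \<Rightarrow> 'v \<Rightarrow> int" where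
  "cartan ends i j = (if i = j then 2 else - int (card {e. ends e = {i, j}}))"

definition simple_reflection ::
  "('e::finite \<Rightarrow> 'v::finite set) \<Rightarrow> 'v \<Rightarrow> int ^ 'v \<Rightarrow> int ^ 'v" where
  "simple_reflection ends i v = v - axis i (\<Sum>j\<in>UNIV. cartan ends i j * v $ j)"

lemma simple_reflection_basis:
  "simple_reflection ends i (axis j 1) = axis j 1 - cartan ends i j *s axis i 1"
  by (simp add: simple_reflection_def axis_def vec_eq_iff if_distrib cong: if_cong)

text \<open>\<open>weyl_word ends [x\<^sub>1, \<dots>, x\<^sub>s] = \<sigma>\<^bsub>x\<^sub>s\<^esub> \<circ> \<dots> \<circ> \<sigma>\<^bsub>x\<^sub>1\<^esub>\<close>. Simple reflections are involutions, so the Weyl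
  group is the set of all such words.\<close>

definition weyl_word :: "('e::finite \<Rightarrow> 'v::finite set) \<Rightarrow> 'v list \<Rightarrow> int ^ 'v \<Rightarrow> int ^ 'v" where
  "weyl_word ends S = fold (\<lambda>x w. simple_reflection ends x \<circ> w) S id"

definition weyl_length ::
  "('e::finite \<Rightarrow> 'v::finite set) \<Rightarrow> (int ^ 'v \<Rightarrow> int ^ 'v) \<Rightarrow> nat" where
  "weyl_length ends w = (LEAST l. \<exists>ys. length ys = l \<and> w = weyl_word ends ys)"

definition reduced_word :: "('e::finite \<Rightarrow> 'v::finite set) \<Rightarrow> 'v list \<Rightarrow> bool" where
  "reduced_word ends ys \<longleftrightarrow> weyl_length ends (weyl_word ends ys) = length ys"

text \<open>Edge sets of simple graphs on the vertices \<open>{1..n}\<close>.\<close>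

definition edges_A :: "nat \<Rightarrow> nat set set" where
  "edges_A n = {{i, i + 1} | i. 1 \<le> i \<and> i < n}"

definition edges_D :: "nat \<Rightarrow> nat set set" where
  "edges_D n = edges_A (n - 1) \<union> {{n - 2, n}}"

definition edges_E :: "nat \<Rightarrow> nat set set" where
  "edges_E n = edges_A (n - 1) \<union> {{3, n}}"

definition iso_simple_graph :: "('e \<Rightarrow> 'v set) \<Rightarrow> nat \<Rightarrow> nat set set \<Rightarrow> bool" where
  "iso_simple_graph ends n F \<longleftrightarrow>
     (\<exists>\<phi> \<psi>. bij_betw \<phi> UNIV {1..n} \<and> bij_betw \<psi> UNIV F \<and> (\<forall>e. \<psi> e = \<phi> ` ends e))"

definition dynkin_ADE :: "('e \<Rightarrow> 'v set) \<Rightarrow> bool" where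
  "dynkin_ADE ends \<longleftrightarrow>
     (\<exists>n\<ge>1. iso_simple_graph ends n (edges_A n)) \<or>
     (\<exists>n\<ge>4. iso_simple_graph ends n (edges_D n)) \<or>
     (\<exists>n\<in>{6, 7, 8}. iso_simple_graph ends n (edges_E n))"

end

theory Submission
  imports Defs
begin

text \<open>Outside types A, D, E there is a strictly positive integral function \<open>d\<close> on the vertices with
  \<open>2 d i \<le> \<Sum> d j\<close>, the sum over the neighbours of \<open>i\<close> with multiplicity (a null root of a Euclidean subgraph,
  enlarged to full support). Its Euler pairing with a dimension vector, the defect, does not decrease
  under a positive reflection functor, and it is positive on the simple representation at a source.
  So no admissible sequence annihilates the simple representation at a source.

  For (b), let \<open>S = x # S'\<close> and let \<open>N\<close> belong to \<open>S'\<close> by induction. Since \<open>S'\<close> annihilates \<open>N\<close>, no simple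
  representation at the source \<open>x\<close> embeds into \<open>N\<close>; hence \<open>N\<close> is the reflection of some \<open>M\<close>, which can be chosen
  nonzero at \<open>x\<close>. Any admissible \<open>T\<close> annihilating \<open>M\<close> must contain \<open>x\<close>, and its first \<open>x\<close> can be moved
  to the front, so by induction \<open>S\<close> is a subsequence of \<open>T\<close>.

  For (a), let \<open>r\<close> be one of the roots \<open>\<sigma> \<dots> \<sigma> e\<close> belonging to \<open>S'\<close>, positive and of negative defect by induction.
  It differs from the simple root at the source \<open>x\<close>, whose defect is positive, so its reflection at \<open>x\<close>
  is positive by sign coherence of real roots, and again of negative defect. Hence all roots belonging
  to \<open>S\<close> are positive, and \<open>w(S)\<close> has as many inversions as letters.\<close>


section \<open>Subharmonic functions on graphs\<close>

text \<open>On a Euclidean graph the null root is fixed by all simple reflections, and the defect is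
  invariant when quiver and vector are reflected at a sink. A general graph need not carry such a
  vector, so only the inequality of \<open>subharmonic\<close> is kept: the defect becomes monotone,
  in exactly the direction that both (a) and (b) need. Strict positivity of \<open>d\<close> then
  separates the two kinds of simple roots: at a source \<open>x\<close> the defect is
  \<open>d x\<close>, at a sink it is at most \<open>- d x\<close>. The function \<open>d\<close> is
  found indirectly. If zero were the only subharmonic function, no Euclidean diagram could occur as
  a subgraph; a longest path with at most one further vertex would then be the whole graph.
  Isomorphisms of representations are avoided. A reflection functor is left exact, so it preserves
  embeddings, and whatever embeds into an annihilated representation is annihilated. Hence
  embeddings in both directions transport annihilation. In (b) the induction proves more than asked:
  \<open>S\<close> is least, not just minimal, among all sequences annihilating
  \<open>M\<close>.\<close>

definition neighbour_sum :: "('e::finite \<Rightarrow> 'v::finite set) \<Rightarrow> ('v \<Rightarrow> int) \<Rightarrow> 'v \<Rightarrow> int" where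
  "neighbour_sum ends d i = (\<Sum>j\<in>UNIV - {i}. int (card {e. ends e = {i, j}}) * d j)"

text \<open>Equivalently, \<open>d\<close> is nonnegative and pairs nonpositively with every simple
  root in the Cartan form. Null roots are the case of equality.\<close>

definition subharmonic :: "('e::finite \<Rightarrow> 'v::finite set) \<Rightarrow> ('v \<Rightarrow> int) \<Rightarrow> bool" where
  "subharmonic ends d \<longleftrightarrow> (\<forall>i. 0 \<le> d i \<and> 2 * d i \<le> neighbour_sum ends d i)"

lemma adj_commute: "adj ends x y \<longleftrightarrow> adj ends y x"
  by (simp add: adj_def insert_commute)

lemma adj_irrefl: "loopless ends \<Longrightarrow> \<not> adj ends x x"
  unfolding adj_def loopless_def
proof
  assume c: "\<forall>e. card (ends e) = 2" and "\<exists>e. ends e = {x, x}"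
  then obtain e where "ends e = {x}" by auto
  with c[rule_format, of e] show False by simp
qed

lemma adj_iff_card: "adj (ends :: 'e::finite \<Rightarrow> 'v set) x y \<longleftrightarrow> 1 \<le> card {e. ends e = {x, y}}"
  by (auto simp: adj_def Suc_le_eq card_gt_0_iff)

lemma neighbour_sum_ge:
  assumes "loopless ends" "\<And>j. 0 \<le> d j" "\<And>j. j \<in> N \<Longrightarrow> adj ends i j"
  shows "sum d N \<le> neighbour_sum ends d i"
proof -
  have "sum d N \<le> (\<Sum>j\<in>N. int (card {e. ends e = {i, j}}) * d j)"
  proof (rule sum_mono)
    fix j assume "j \<in> N"
    then have "1 \<le> int (card {e. ends e = {i, j}})" using assms(3) adj_iff_card by fastforce
    from mult_right_mono[OF this assms(2)] show "d j \<le> int (card {e. ends e = {i, j}}) * d j" by simp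
  qed
  also have "\<dots> \<le> neighbour_sum ends d i"
    unfolding neighbour_sum_def
  proof (rule sum_mono2)
    show "N \<subseteq> UNIV - {i}" using assms(3) adj_irrefl[OF assms(1), of i] by blast
  qed (simp_all add: assms(2))
  finally show ?thesis .
qed

lemma neighbour_sum_nonneg: "(\<And>j. 0 \<le> d j) \<Longrightarrow> 0 \<le> neighbour_sum ends d i"
  unfolding neighbour_sum_def by (intro sum_nonneg) auto

text \<open>Where \<open>d\<close> vanishes the inequality is free, since neighbour sums of
  nonnegative functions are nonnegative. Each vertex of \<open>N\<close> is counted once, a lower
  bound that multiple edges can only exceed.\<close>

lemma subharmonicI:
  assumes "loopless ends" "\<And>j. 0 \<le> d j"
    "\<And>i. d i \<noteq> 0 \<Longrightarrow> \<exists>N. (\<forall>j\<in>N. adj ends i j) \<and> 2 * d i \<le> sum d N"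
  shows "subharmonic ends d"
  unfolding subharmonic_def
proof (intro allI conjI)
  fix i
  show "2 * d i \<le> neighbour_sum ends d i"
  proof (cases "d i = 0")
    case True
    then show ?thesis using neighbour_sum_nonneg[of d ends i, OF assms(2)] by simp
  next
    case False
    then obtain N where "\<forall>j\<in>N. adj ends i j" "2 * d i \<le> sum d N" using assms(3) by blast
    then show ?thesis using neighbour_sum_ge[of ends d N i, OF assms(1,2)] by fastforce
  qed
qed (use assms in auto)

lemma connected_crossing_edge:
  assumes "connected_graph ends" "x \<in> X" "y \<notin> X"
  shows "\<exists>a b. a \<in> X \<and> b \<notin> X \<and> adj ends a b"
proof -
  have "(adj ends)\<^sup>*\<^sup>* x y" using assms(1) by (simp add: connected_graph_def)
  then show ?thesis using assms(2,3)
    by (induction rule: rtranclp_induct) blast+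
qed

lemma neighbour_sum_add:
  "neighbour_sum ends (\<lambda>v. d v + d' v) i = neighbour_sum ends d i + neighbour_sum ends d' i"
  by (simp add: neighbour_sum_def sum.distrib algebra_simps)

lemma neighbour_sum_scale: "neighbour_sum ends (\<lambda>v. c * d v) i = c * neighbour_sum ends d i"
  by (simp add: neighbour_sum_def sum_distrib_left algebra_simps)

text \<open>The support is enlarged one adjacent vertex at a time, by induction on the number of
  zeros.\<close>

lemma subharmonic_pos:
  assumes "loopless ends" "connected_graph ends" "subharmonic ends d" "d z \<noteq> 0"
  shows "\<exists>d. subharmonic ends d \<and> (\<forall>v. 0 < d v)"
  using assms(3,4)
proof (induction "card {v. d v = 0}" arbitrary: d z rule: less_induct)
  case less
  have d0: "0 \<le> d v" "2 * d v \<le> neighbour_sum ends d v" for v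
    using less.prems(1) by (auto simp: subharmonic_def)
  show ?case
  proof (cases "\<forall>v. d v \<noteq> 0")
    case True
    then show ?thesis using d0 less.prems(1) by (metis order_le_less)
  next
    case False
    then obtain b where b: "d b = 0" by auto
    then obtain a b where ab: "d a \<noteq> 0" "d b = 0" "adj ends a b"
      using connected_crossing_edge[OF assms(2), of z "{v. d v \<noteq> 0}" b] less.prems(2) b by auto
    define u :: "'b \<Rightarrow> int" where "u v = (if v = b then 1 else 0)" for v
    \<comment> \<open>Doubling makes the neighbour sum at \<open>b\<close> at least 2, which pays
      for the new value 1 there. At other vertices the inequality for \<open>d\<close> is doubled
      and the added term can only help.\<close>
    define d' where "d' v = 2 * d v + u v" for v
    have u0: "0 \<le> u v" for v by (simp add: u_def)
    have ns: "neighbour_sum ends d' v = 2 * neighbour_sum ends d v + neighbour_sum ends u v" for v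
      unfolding d'_def neighbour_sum_add neighbour_sum_scale ..
    have "d a \<le> neighbour_sum ends d b"
      using neighbour_sum_ge[of ends d "{a}" b, OF assms(1) d0(1)] ab(3) adj_commute[of ends] by simp
    then have "1 \<le> neighbour_sum ends d b" using d0(1)[of a] ab(1) by linarith
    then have "2 * d' v \<le> neighbour_sum ends d' v" for v
      using d0(2)[of v] neighbour_sum_nonneg[of u ends v, OF u0] ab(2)
      by (cases "v = b") (auto simp: ns d'_def u_def)
    then have sh: "subharmonic ends d'" using d0(1) u0 by (auto simp: subharmonic_def d'_def)
    have z': "d' z \<noteq> 0"
      using less.prems(2) d0(1)[of z] u0[of z] by (auto simp: d'_def)
    have z0: "d v \<noteq> 0 \<Longrightarrow> d' v \<noteq> 0" for v using d0(1)[of v] u0[of v] by (auto simp: d'_def)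
    have "d' b \<noteq> 0" using ab(2) by (simp add: d'_def u_def)
    then have "{v. d' v = 0} \<subset> {v. d v = 0}" using ab(2) z0 by auto
    then have "card {v. d' v = 0} < card {v. d v = 0}" by (simp add: psubset_card_mono)
    then show ?thesis using less.hyps sh z' by blast
  qed
qed

section \<open>Paths and isomorphisms with labelled graphs\<close>

text \<open>Positions run from 1 to \<open>m\<close> to match the vertex numbering
  \<open>{1..n}\<close> of the Dynkin edge sets; the values of \<open>p\<close> elsewhere are
  arbitrary.\<close>

definition trail :: "('e \<Rightarrow> 'v set) \<Rightarrow> nat \<Rightarrow> (nat \<Rightarrow> 'v) \<Rightarrow> bool" where
  "trail ends m p \<longleftrightarrow> inj_on p {1..m} \<and> (\<forall>i. 1 \<le> i \<and> i < m \<longrightarrow> adj ends (p i) (p (Suc i)))"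

lemma trail_rev:
  assumes "trail ends m p"
  shows "trail ends m (\<lambda>i. p (m + 1 - i))"
  unfolding trail_def
proof (intro conjI allI impI)
  show "inj_on (\<lambda>i. p (m + 1 - i)) {1..m}"
  proof (rule inj_onI)
    fix i j assume ij: "i \<in> {1..m}" "j \<in> {1..m}" "p (m + 1 - i) = p (m + 1 - j)"
    have "m + 1 - i \<in> {1..m}" "m + 1 - j \<in> {1..m}" using ij by auto
    then have "m + 1 - i = m + 1 - j" using ij(3) assms unfolding trail_def inj_on_def by blast
    then show "i = j" using ij by auto
  qed
  fix i assume i: "1 \<le> i \<and> i < m"
  then have "adj ends (p (m - i)) (p (Suc (m - i)))" using assms by (auto simp: trail_def)
  moreover have "m + 1 - i = Suc (m - i)" "m + 1 - Suc i = m - i" using i by auto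
  ultimately show "adj ends (p (m + 1 - i)) (p (m + 1 - Suc i))" by (metis adj_commute)
qed

text \<open>Edges with the same ends coincide, so the map on edges is forced by the map on vertices,
  and only adjacency has to be compared.\<close>

lemma iso_simple_graphI:
  assumes "loopless ends" "inj ends" "bij_betw q {1..n} UNIV"
    "\<And>f. f \<in> F \<Longrightarrow> \<exists>i\<in>{1..n}. \<exists>j\<in>{1..n}. f = {i, j}"
    "\<And>i j. i \<in> {1..n} \<Longrightarrow> j \<in> {1..n} \<Longrightarrow> adj ends (q i) (q j) \<longleftrightarrow> {i, j} \<in> F"
  shows "iso_simple_graph ends n F"
proof -
  define \<phi> where "\<phi> = the_inv_into {1..n} q"
  have inj: "inj_on q {1..n}" using assms(3) bij_betw_def by blast
  have \<phi>: "bij_betw \<phi> UNIV {1..n}" unfolding \<phi>_def by (rule bij_betw_the_inv_into[OF assms(3)])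
  have \<phi>q: "\<phi> (q i) = i" if "i \<in> {1..n}" for i
    unfolding \<phi>_def using inj that by (rule the_inv_into_f_f)
  have q\<phi>: "q (\<phi> v) = v" for v
    unfolding \<phi>_def using assms(3) by (intro f_the_inv_into_f_bij_betw) auto
  have inj\<phi>: "inj \<phi>" using \<phi> bij_betw_def by blast
  have "bij_betw (\<lambda>e. \<phi> ` ends e) UNIV F"
  proof (rule bij_betw_imageI)
    show "inj (\<lambda>e. \<phi> ` ends e)"
      using inj\<phi> assms(2) by (auto simp: inj_def inj_image_eq_iff)
    show "range (\<lambda>e. \<phi> ` ends e) = F"
    proof (intro equalityI subsetI)
      fix f assume "f \<in> range (\<lambda>e. \<phi> ` ends e)"
      then obtain e where e: "f = \<phi> ` ends e" by auto
      obtain x y where xy: "ends e = {x, y}" using assms(1) unfolding loopless_def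
        by (meson card_2_iff)
      then have "adj ends (q (\<phi> x)) (q (\<phi> y))" by (auto simp: q\<phi> adj_def)
      then show "f \<in> F" using assms(5)[of "\<phi> x" "\<phi> y"] e xy bij_betwE[OF \<phi>] by simp
    next
      fix f assume f: "f \<in> F"
      then obtain i j where ij: "i \<in> {1..n}" "j \<in> {1..n}" "f = {i, j}" using assms(4) by blast
      then have "adj ends (q i) (q j)" using assms(5) f by blast
      then obtain e where "ends e = {q i, q j}" by (auto simp: adj_def)
      then have "\<phi> ` ends e = f" using ij \<phi>q by auto
      then show "f \<in> range (\<lambda>e. \<phi> ` ends e)" by auto
    qed
  qed
  then show ?thesis unfolding iso_simple_graph_def using \<phi> by blast
qed

section \<open>Graphs whose only subharmonic function is zero\<close>

locale no_subharmonic =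
  fixes ends :: "'e::finite \<Rightarrow> 'v::finite set"
  assumes loopless: "loopless ends"
    and connected: "connected_graph ends"
    and none: "subharmonic ends d \<Longrightarrow> d v = 0"
begin

abbreviation A :: "'v \<Rightarrow> 'v \<Rightarrow> bool" where "A \<equiv> adj ends"

lemma A_sym: "A x y \<Longrightarrow> A y x" by (subst adj_commute)

lemma weighting_False:
  fixes d :: "'v \<Rightarrow> int"
  assumes "\<And>j. 0 \<le> d j" "d z \<noteq> 0"
    "\<And>i. d i \<noteq> 0 \<Longrightarrow> \<exists>N. (\<forall>j\<in>N. A i j) \<and> 2 * d i \<le> sum d N"
  shows False
  using subharmonicI[OF loopless assms(1,3)] none assms(2) by blast

text \<open>A double edge carries the weight 1 at both ends, the null root of the Euclidean diagram
  with two vertices. The neighbour sum is computed directly because \<open>subharmonicI\<close>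
  counts each neighbour only once.\<close>

lemma inj_ends: "inj ends"
proof (rule ccontr)
  assume "\<not> inj ends"
  then obtain e f where ef: "e \<noteq> f" "ends e = ends f" by (auto simp: inj_def)
  obtain x y where xy: "ends e = {x, y}" "x \<noteq> y" using loopless unfolding loopless_def
    by (meson card_2_iff)
  define d :: "'v \<Rightarrow> int" where "d v = (if v \<in> {x, y} then 1 else 0)" for v
  have c: "2 \<le> card {e. ends e = {x, y}}"
    using card_mono[of "{e. ends e = {x, y}}" "{e, f}"] ef xy by simp
  have d0: "0 \<le> d v" for v by (simp add: d_def)
  have *: "2 \<le> neighbour_sum ends d a" if "{a, b} = {x, y}" "a \<noteq> b" for a b
  proof -
    have "(2::int) \<le> (\<Sum>j\<in>{b}. int (card {e. ends e = {a, j}}) * d j)"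
      using c that by (auto simp: d_def)
    also have "\<dots> \<le> neighbour_sum ends d a"
      unfolding neighbour_sum_def using that d0 by (intro sum_mono2) auto
    finally show ?thesis .
  qed
  have "subharmonic ends d"
    unfolding subharmonic_def
  proof (intro allI conjI)
    fix i
    show "2 * d i \<le> neighbour_sum ends d i"
      using *[of x y] *[of y x] xy(2) neighbour_sum_nonneg[of d ends i, OF d0] by (auto simp: d_def)
  qed (rule d0)
  from none[OF this, of x] show False by (simp add: d_def)
qed

lemma two_neighboursI:
  "\<lbrakk>x \<in> C; y \<in> C; x \<noteq> y; A v x; A v y\<rbrakk> \<Longrightarrow> \<exists>x\<in>C. \<exists>y\<in>C. x \<noteq> y \<and> A v x \<and> A v y"
  by blast

lemma no_cycle:
  assumes "C \<noteq> {}" "\<And>v. v \<in> C \<Longrightarrow> \<exists>x\<in>C. \<exists>y\<in>C. x \<noteq> y \<and> A v x \<and> A v y"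
  shows False
proof -
  obtain z where z: "z \<in> C" using assms(1) by auto
  show False
  proof (rule weighting_False[of "\<lambda>v. if v \<in> C then 1 else 0" z])
    fix i assume "(if i \<in> C then 1 else 0::int) \<noteq> 0"
    then have "i \<in> C" by (auto split: if_splits)
    then obtain x y where "x \<in> C" "y \<in> C" "x \<noteq> y" "A i x" "A i y" using assms(2) by blast
    then show "\<exists>N. (\<forall>j\<in>N. A i j) \<and> 2 * (if i \<in> C then 1 else 0) \<le> (\<Sum>v\<in>N. if v \<in> C then 1 else 0::int)"
      by (intro exI[of _ "{x, y}"]) auto
  qed (use z in auto)
qed

lemma trail_inj: "trail ends m p \<Longrightarrow> 1 \<le> i \<Longrightarrow> i \<le> m \<Longrightarrow> 1 \<le> j \<Longrightarrow> j \<le> m \<Longrightarrow> p i = p j \<longleftrightarrow> i = j"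
  unfolding trail_def by (intro inj_on_eq_iff[of p "{1..m}"]) simp_all

lemma trail_step: "trail ends m p \<Longrightarrow> 1 \<le> k \<Longrightarrow> k < m \<Longrightarrow> A (p k) (p (Suc k))"
  unfolding trail_def by blast

lemma trail_step_back:
  assumes "trail ends m p" "1 < k" "k \<le> m"
  shows "A (p k) (p (k - 1))"
proof -
  have "A (p (k - 1)) (p (Suc (k - 1)))" using assms by (intro trail_step[of m]) auto
  from A_sym[OF this] show ?thesis using assms(2) by simp
qed

text \<open>A chord from \<open>p i\<close> to \<open>p j\<close> closes the segment between them to
  a cycle.\<close>

lemma trail_induced_less:
  assumes "trail ends m p" "1 \<le> i" "i < j" "j \<le> m" "A (p i) (p j)"
  shows "j = Suc i"
proof (rule ccontr)
  assume nj: "j \<noteq> Suc i"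
  note inj = trail_inj[OF assms(1)]
  have mem: "p l \<in> p ` {i..j}" if "i \<le> l" "l \<le> j" for l using that by auto
  have A: "A (p j) (p i)" using assms(5) by (rule A_sym)
  show False
  proof (rule no_cycle[of "p ` {i..j}"])
    fix v assume "v \<in> p ` {i..j}"
    then obtain k where k: "v = p k" "i \<le> k" "k \<le> j" by auto
    consider "k = i" | "k = j" | "i < k" "k < j" using k by linarith
    then show "\<exists>x\<in>p ` {i..j}. \<exists>y\<in>p ` {i..j}. x \<noteq> y \<and> A v x \<and> A v y"
    proof cases
      case 1
      have "p j \<noteq> p (Suc i)" using inj[of j "Suc i"] nj assms by simp
      moreover have "A (p i) (p (Suc i))" using assms by (intro trail_step[of m]) auto
      ultimately show ?thesis using assms 1 k
        by (intro two_neighboursI[of "p j" _ "p (Suc i)"]) auto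
    next
      case 2
      have "p i \<noteq> p (j - 1)" using inj[of i "j - 1"] nj assms by simp
      moreover have "A (p j) (p (j - 1))" using assms by (intro trail_step_back[of m]) auto
      ultimately show ?thesis using assms(3) A 2 k mem[of "j - 1"] mem[of i]
        by (intro two_neighboursI[of "p i" _ "p (j - 1)"]) (simp_all del: One_nat_def)
    next
      case 3
      have "p (k - 1) \<noteq> p (Suc k)" using inj[of "k - 1" "Suc k"] 3 assms by simp
      moreover have "A (p k) (p (k - 1))" using assms 3 by (intro trail_step_back[of m]) auto
      moreover have "A (p k) (p (Suc k))" using assms 3 by (intro trail_step[of m]) auto
      moreover have "p (k - 1) \<in> p ` {i..j}" "p (Suc k) \<in> p ` {i..j}"
        using 3 by (auto intro!: mem simp del: One_nat_def)
      ultimately show ?thesis unfolding k(1) by (rule two_neighboursI[rotated 2])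
    qed
  qed (use assms in auto)
qed

lemma trail_induced:
  assumes "trail ends m p" "1 \<le> i" "i \<le> m" "1 \<le> j" "j \<le> m"
  shows "A (p i) (p j) \<longleftrightarrow> j = Suc i \<or> i = Suc j"
proof
  assume a: "A (p i) (p j)"
  then have "i \<noteq> j" using adj_irrefl[OF loopless] by auto
  then show "j = Suc i \<or> i = Suc j"
    using trail_induced_less[OF assms(1), of i j] trail_induced_less[OF assms(1), of j i] a A_sym[OF a] assms
    by linarith
next
  assume "j = Suc i \<or> i = Suc j"
  then show "A (p i) (p j)"
    using trail_step[OF assms(1), of i] trail_step_back[OF assms(1), of i] assms by auto
qed

text \<open>A vertex off the path with two neighbours on it closes the segment between these to a
  cycle.\<close>

lemma attached_once_less:
  assumes "trail ends m p" "u \<notin> p ` {1..m}" "1 \<le> a" "a < b" "b \<le> m" "A u (p a)" "A u (p b)"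
  shows False
proof -
  have un: "p k \<noteq> u" if "1 \<le> k" "k \<le> m" for k using assms(2) that by auto
  have A: "A (p a) u" "A (p b) u" using A_sym[OF assms(6)] A_sym[OF assms(7)] .
  let ?C = "insert u (p ` {a..b})"
  have mem: "p l \<in> p ` {a..b}" if "a \<le> l" "l \<le> b" for l using that by auto
  show False
  proof (rule no_cycle[of ?C])
    fix v assume "v \<in> ?C"
    then consider "v = u" | k where "v = p k" "a \<le> k" "k \<le> b" by auto
    then show "\<exists>x\<in>?C. \<exists>y\<in>?C. x \<noteq> y \<and> A v x \<and> A v y"
    proof cases
      case 1
      have "p a \<noteq> p b" using trail_inj[OF assms(1), of a b] assms by simp
      with 1 show ?thesis using assms(4,6,7)
        by (intro two_neighboursI[of "p a" _ "p b"]) auto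
    next
      case (2 k)
      have step: "k < b \<Longrightarrow> A (p k) (p (Suc k))" using assms 2 by (intro trail_step[of m]) auto
      have pred: "a < k \<Longrightarrow> A (p k) (p (k - 1))" using assms 2 by (intro trail_step_back[of m]) auto
      consider "k = a" | "k = b" | (inside) "a < k" "k < b" using 2 by linarith
      then show ?thesis
      proof cases
        assume "k = a"
        then show ?thesis using un[of "Suc a"] assms(3,4,5) A step 2
          by (intro two_neighboursI[of u _ "p (Suc a)"]) auto
      next
        assume "k = b"
        moreover have "p (b - 1) \<noteq> u" using assms(3-5) by (intro un) auto
        ultimately show ?thesis using assms(3,4,5) A pred 2 mem[of "b - 1"]
          by (intro two_neighboursI[of u _ "p (b - 1)"]) (simp_all del: One_nat_def add: eq_commute[of u])
      next
        case inside
        have "p (k - 1) \<noteq> p (Suc k)"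
          using trail_inj[OF assms(1), of "k - 1" "Suc k"] inside assms(3,5) by simp
        moreover have "A (p k) (p (k - 1))" "A (p k) (p (Suc k))" using inside step pred by auto
        moreover have "p (k - 1) \<in> ?C" "p (Suc k) \<in> ?C"
          using inside by (auto intro!: mem simp del: One_nat_def)
        ultimately show ?thesis unfolding 2(1) by (rule two_neighboursI[rotated 2])
      qed
    qed
  qed auto
qed

lemma attached_once:
  assumes "trail ends m p" "u \<notin> p ` {1..m}" "a \<in> {1..m}" "b \<in> {1..m}" "A u (p a)" "A u (p b)"
  shows "a = b"
  using attached_once_less[OF assms(1,2), of a b] attached_once_less[OF assms(1,2), of b a] assms(3-6)
  by (cases a b rule: linorder_cases) auto

lemma trail_adj: "trail ends m p \<Longrightarrow> 1 \<le> i \<Longrightarrow> j = Suc i \<Longrightarrow> j \<le> m \<Longrightarrow> A (p i) (p j) \<and> A (p j) (p i)"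
  using trail_step[of m p i] A_sym[of "p i" "p j"] by (simp add: Suc_le_eq)

text \<open>The weights in the next lemmas are the null roots of the Euclidean diagrams.\<close>

lemma two_branches_False:
  assumes "trail ends m p" "2 \<le> a" "a \<le> b" "b < m"
    "u \<notin> p ` {1..m}" "u' \<notin> p ` {1..m}" "u \<noteq> u'" "A u (p a)" "A u' (p b)"
  shows False
proof -
  \<comment> \<open>Affine type D: weight 2 on the segment from \<open>a\<close> to \<open>b\<close>
    and 1 on its four outer neighbours. For \<open>a = b\<close> this is the star with four
    leaves.\<close>
  define d :: "'v \<Rightarrow> int" where
    "d v = (if v \<in> {u, u', p (a - 1), p (Suc b)} then 1 else if v \<in> p ` {a..b} then 2 else 0)" for v
  note inj = trail_inj[OF assms(1)]
  have ne: "p i \<noteq> u" "p i \<noteq> u'" if "1 \<le> i" "i \<le> m" for i using assms(5,6) that by auto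
  have d_end: "d u = 1" "d u' = 1" "d (p (a - 1)) = 1" "d (p (Suc b)) = 1" by (simp_all add: d_def)
  have d_mid: "d (p i) = 2" if "a \<le> i" "i \<le> b" for i
  proof -
    have "p i \<noteq> p (a - 1)" "p i \<noteq> p (Suc b)"
      using inj[of i "a - 1"] inj[of i "Suc b"] that assms(2-4) by auto
    then show ?thesis using ne[of i] that assms(2-4) by (auto simp: d_def)
  qed
  have d1: "1 \<le> d (p i)" if "a - 1 \<le> i" "i \<le> Suc b" for i
    using d_mid[of i] d_end that by (cases "i = a - 1 \<or> i = Suc b") force+
  show False
  proof (rule weighting_False[of d u])
    fix i assume "d i \<noteq> 0"
    then consider "i = u" | "i = u'" | "i = p (a - 1)" | "i = p (Suc b)" | k where "i = p k" "a \<le> k" "k \<le> b"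
      by (auto simp: d_def split: if_splits)
    then show "\<exists>N. (\<forall>j\<in>N. A i j) \<and> 2 * d i \<le> sum d N"
    proof cases
      case 1
      then show ?thesis using assms(3,8) d_mid[of a] d_end by (intro exI[of _ "{p a}"]) simp
    next
      case 2
      then show ?thesis using assms(3,9) d_mid[of b] d_end by (intro exI[of _ "{p b}"]) simp
    next
      case 3
      then show ?thesis using d_mid[of a] d_end trail_adj[OF assms(1), of "a - 1" a] assms(2-4)
        by (intro exI[of _ "{p a}"]) simp
    next
      case 4
      then show ?thesis using d_mid[of b] d_end trail_adj[OF assms(1), of b "Suc b"] assms(2-4)
        by (intro exI[of _ "{p b}"]) simp
    next
      case (5 k)
      have nb: "A (p k) (p (k - 1))" "A (p k) (p (Suc k))"
        using trail_adj[OF assms(1), of "k - 1" k] trail_adj[OF assms(1), of k "Suc k"] assms(2-4) 5 by simp_all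
      have kb: "1 \<le> k - 1" "k - 1 \<le> m" "k - 1 \<noteq> Suc k" "Suc k \<le> m" "1 \<le> Suc k" using assms(2-4) 5 by auto
      have ne'[simp]: "p (k - 1) \<noteq> p (Suc k)" "p (k - 1) \<noteq> u" "p (k - 1) \<noteq> u'" "p (Suc k) \<noteq> u" "p (Suc k) \<noteq> u'"
          "u \<noteq> p (k - 1)" "u' \<noteq> p (k - 1)" "u \<noteq> p (Suc k)" "u' \<noteq> p (Suc k)"
        using inj[of "k - 1" "Suc k"] ne[of "k - 1"] ne[of "Suc k"] kb by (simp_all del: One_nat_def add: eq_commute[of u] eq_commute[of u'])
      have dk: "d i = 2" using 5 d_mid by simp
      have ge: "1 \<le> d (p (k - 1))" "1 \<le> d (p (Suc k))" using d1[of "k - 1"] d1[of "Suc k"] 5 by simp_all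
      have au: "A (p a) u" "A (p b) u'" using A_sym[OF assms(8)] A_sym[OF assms(9)] .
      \<comment> \<open>The required sum is 4. Where a neighbour on the path has only weight 1, the
        vertex \<open>u\<close> or \<open>u'\<close> attached at that end of the segment supplies
        the missing 1.\<close>
      consider "a = k" "b = k" | "a = k" "k < b" | "a < k" "b = k" | "a < k" "k < b" using 5 by linarith
      then show ?thesis
      proof cases
        case 1
        then show ?thesis using dk d_end ge nb ne' 5(1) au assms(7)
          by (intro exI[of _ "{u, u', p (k - 1), p (Suc k)}"]) auto
      next
        case 2
        then show ?thesis using dk d_end ge nb ne' 5(1) au d_mid[of "Suc k"]
          by (intro exI[of _ "{u, p (k - 1), p (Suc k)}"]) auto
      next
        case 3
        then have "d (p (k - 1)) = 2" using d_mid[of "k - 1"] by simp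
        then show ?thesis using dk d_end ge nb ne' 5(1) au 3
          by (intro exI[of _ "{u', p (k - 1), p (Suc k)}"]) auto
      next
        case 4
        then have "d (p (k - 1)) = 2" "d (p (Suc k)) = 2" using d_mid[of "k - 1"] d_mid[of "Suc k"] by simp_all
        then show ?thesis using dk nb ne' 5(1)
          by (intro exI[of _ "{p (k - 1), p (Suc k)}"]) auto
      qed
    qed
  qed (auto simp: d_def)
qed

lemma E6_False:
  assumes "distinct [c, x1, x2, y1, y2, z1, z2]"
    "A c x1" "A x1 x2" "A c y1" "A y1 y2" "A c z1" "A z1 z2"
  shows False
proof -
  define d :: "'v \<Rightarrow> int" where "d v = (if v = c then 3 else if v \<in> {x1, y1, z1} then 2
    else if v \<in> {x2, y2, z2} then 1 else 0)" for v
  note sym = assms(2-)[THEN A_sym]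
  have d: "d c = 3" "d x1 = 2" "d y1 = 2" "d z1 = 2" "d x2 = 1" "d y2 = 1" "d z2 = 1"
    using assms(1) by (auto simp: d_def)
  show False
  proof (rule weighting_False[of d c])
    fix i assume "d i \<noteq> 0"
    then have "i \<in> {c, x1, x2, y1, y2, z1, z2}"
      by (rule contrapos_np) (simp add: d_def)
    then consider "i = c" | "i = x1" | "i = x2" | "i = y1" | "i = y2" | "i = z1" | "i = z2"
      by auto
    then show "\<exists>N. (\<forall>j\<in>N. A i j) \<and> 2 * d i \<le> sum d N"
    proof cases
      case 1 then show ?thesis using assms sym d by (intro exI[of _ "{x1, y1, z1}"]) simp
    next
      case 2 then show ?thesis using assms sym d by (intro exI[of _ "{c, x2}"]) simp
    next
      case 3 then show ?thesis using assms sym d by (intro exI[of _ "{x1}"]) simp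
    next
      case 4 then show ?thesis using assms sym d by (intro exI[of _ "{c, y2}"]) simp
    next
      case 5 then show ?thesis using assms sym d by (intro exI[of _ "{y1}"]) simp
    next
      case 6 then show ?thesis using assms sym d by (intro exI[of _ "{c, z2}"]) simp
    next
      case 7 then show ?thesis using assms sym d by (intro exI[of _ "{z1}"]) simp
    qed
  qed (auto simp: d_def)
qed

lemma E7_False:
  assumes "distinct [c, x1, x2, x3, y1, y2, y3, z]"
    "A c x1" "A x1 x2" "A x2 x3" "A c y1" "A y1 y2" "A y2 y3" "A c z"
  shows False
proof -
  define d :: "'v \<Rightarrow> int" where "d v = (if v = c then 4 else if v \<in> {x1, y1} then 3
    else if v \<in> {x2, y2, z} then 2 else if v \<in> {x3, y3} then 1 else 0)" for v
  note sym = assms(2-)[THEN A_sym]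
  have d: "d c = 4" "d x1 = 3" "d y1 = 3" "d z = 2" "d x2 = 2" "d y2 = 2" "d x3 = 1" "d y3 = 1"
    using assms(1) by (auto simp: d_def)
  show False
  proof (rule weighting_False[of d c])
    fix i assume "d i \<noteq> 0"
    then have "i \<in> {c, x1, x2, x3, y1, y2, y3, z}"
      by (rule contrapos_np) (simp add: d_def)
    then consider "i = c" | "i = x1" | "i = x2" | "i = x3" | "i = y1" | "i = y2" | "i = y3" | "i = z"
      by auto
    then show "\<exists>N. (\<forall>j\<in>N. A i j) \<and> 2 * d i \<le> sum d N"
    proof cases
      case 1 then show ?thesis using assms sym d by (intro exI[of _ "{x1, y1, z}"]) simp
    next
      case 2 then show ?thesis using assms sym d by (intro exI[of _ "{c, x2}"]) simp
    next
      case 3 then show ?thesis using assms sym d by (intro exI[of _ "{x1, x3}"]) simp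
    next
      case 4 then show ?thesis using assms sym d by (intro exI[of _ "{x2}"]) simp
    next
      case 5 then show ?thesis using assms sym d by (intro exI[of _ "{c, y2}"]) simp
    next
      case 6 then show ?thesis using assms sym d by (intro exI[of _ "{y1, y3}"]) simp
    next
      case 7 then show ?thesis using assms sym d by (intro exI[of _ "{y2}"]) simp
    next
      case 8 then show ?thesis using assms sym d by (intro exI[of _ "{c}"]) simp
    qed
  qed (auto simp: d_def)
qed

lemma E8_False:
  assumes "distinct [c, x1, x2, x3, x4, x5, y1, y2, z]"
    "A c x1" "A x1 x2" "A x2 x3" "A x3 x4" "A x4 x5" "A c y1" "A y1 y2" "A c z"
  shows False
proof -
  define d :: "'v \<Rightarrow> int" where "d v = (if v = c then 6 else if v = x1 then 5 else if v \<in> {x2, y1} then 4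
    else if v \<in> {x3, z} then 3 else if v \<in> {x4, y2} then 2 else if v = x5 then 1 else 0)" for v
  note sym = assms(2-)[THEN A_sym]
  have d: "d c = 6" "d x1 = 5" "d x2 = 4" "d x3 = 3" "d x4 = 2" "d x5 = 1" "d y1 = 4" "d y2 = 2" "d z = 3"
    using assms(1) by (auto simp: d_def)
  show False
  proof (rule weighting_False[of d c])
    fix i assume "d i \<noteq> 0"
    then have "i \<in> {c, x1, x2, x3, x4, x5, y1, y2, z}"
      by (rule contrapos_np) (simp add: d_def)
    then consider "i = c" | "i = x1" | "i = x2" | "i = x3" | "i = x4" | "i = x5" | "i = y1" | "i = y2" | "i = z"
      by auto
    then show "\<exists>N. (\<forall>j\<in>N. A i j) \<and> 2 * d i \<le> sum d N"
    proof cases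
      case 1 then show ?thesis using assms sym d by (intro exI[of _ "{x1, y1, z}"]) simp
    next
      case 2 then show ?thesis using assms sym d by (intro exI[of _ "{c, x2}"]) simp
    next
      case 3 then show ?thesis using assms sym d by (intro exI[of _ "{x1, x3}"]) simp
    next
      case 4 then show ?thesis using assms sym d by (intro exI[of _ "{x2, x4}"]) simp
    next
      case 5 then show ?thesis using assms sym d by (intro exI[of _ "{x3, x5}"]) simp
    next
      case 6 then show ?thesis using assms sym d by (intro exI[of _ "{x4}"]) simp
    next
      case 7 then show ?thesis using assms sym d by (intro exI[of _ "{c, y2}"]) simp
    next
      case 8 then show ?thesis using assms sym d by (intro exI[of _ "{y1}"]) simp
    next
      case 9 then show ?thesis using assms sym d by (intro exI[of _ "{c}"]) simp
    qed
  qed (auto simp: d_def)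
qed

lemma trail_extend:
  assumes "trail ends m p" "w \<notin> p ` {1..m}" "A w (p 1)" "1 \<le> m"
  shows "trail ends (Suc m) (\<lambda>i. if i = 1 then w else p (i - 1))"
  unfolding trail_def
proof (intro conjI allI impI)
  show "inj_on (\<lambda>i. if i = 1 then w else p (i - 1)) {1..Suc m}"
  proof (rule inj_onI)
    fix i j assume ij: "i \<in> {1..Suc m}" "j \<in> {1..Suc m}"
      "(if i = 1 then w else p (i - 1)) = (if j = 1 then w else p (j - 1))"
    have "p (k - 1) \<noteq> w" if "k \<in> {1..Suc m}" "k \<noteq> 1" for k
    proof -
      have "k - 1 \<in> {1..m}" using that by auto
      then show ?thesis using assms(2) by (metis image_eqI)
    qed
    from this[of i] this[of j] trail_inj[OF assms(1), of "i - 1" "j - 1"] ij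
    show "i = j" by (auto split: if_splits)
  qed
  fix i assume "1 \<le> i \<and> i < Suc m"
  then show "A (if i = 1 then w else p (i - 1)) (if Suc i = 1 then w else p (Suc i - 1))"
    using assms(3) trail_adj[OF assms(1), of "i - 1" i] by auto
qed

lemma trail_distinct:
  assumes "trail ends m p" "distinct is" "set is \<subseteq> {1..m}"
  shows "distinct (map p is)"
  using assms unfolding trail_def distinct_map by (blast intro: inj_on_subset)

section \<open>Longest paths\<close>

definition longest_trail :: "nat \<Rightarrow> (nat \<Rightarrow> 'v) \<Rightarrow> bool" where
  "longest_trail m p \<longleftrightarrow> trail ends m p \<and> 1 \<le> m \<and> (\<forall>m' p'. trail ends m' p' \<longrightarrow> m' \<le> m)"

lemma longest_trail_rev: "longest_trail m p \<Longrightarrow> longest_trail m (\<lambda>i. p (m + 1 - i))"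
  unfolding longest_trail_def using trail_rev by blast

lemma longest_trail_exists: "\<exists>m p. longest_trail m p"
proof -
  let ?P = "\<lambda>m. \<exists>p. trail ends m p"
  have one: "?P 1" by (simp add: trail_def)
  have bound: "m \<le> CARD('v)" if ex: "?P m" for m
  proof -
    obtain p where "trail ends m p" using ex by blast
    then have "card (p ` {1..m}) = m" by (simp add: trail_def card_image)
    then show ?thesis using card_mono[of UNIV "p ` {1..m}"] by simp
  qed
  obtain p where "trail ends (Greatest ?P) p" using GreatestI_nat[of ?P, OF one bound] by blast
  moreover have "1 \<le> Greatest ?P" by (rule Greatest_le_nat[of ?P, OF one bound])
  moreover have "m' \<le> Greatest ?P" if "trail ends m' p'" for m' p'
    by (rule Greatest_le_nat[of ?P, OF _ bound]) (use that in blast)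
  ultimately show ?thesis unfolding longest_trail_def by blast
qed

lemma longest_trail_start:
  assumes "longest_trail m p" "w \<notin> p ` {1..m}"
  shows "\<not> A w (p 1)"
proof
  assume "A w (p 1)"
  then have "trail ends (Suc m) (\<lambda>i. if i = 1 then w else p (i - 1))"
    using assms by (intro trail_extend) (auto simp: longest_trail_def)
  then have "Suc m \<le> m" using assms(1) unfolding longest_trail_def by blast
  then show False by simp
qed

lemma image_rev: "(\<lambda>i. p (m + 1 - i)) ` {1..m::nat} = p ` {1..m}"
proof -
  have "(\<lambda>i. m + 1 - i) ` {1..m} = {1..m}"
  proof (intro equalityI subsetI)
    fix x assume "x \<in> {1..m}"
    then show "x \<in> (\<lambda>i. m + 1 - i) ` {1..m}" by (intro image_eqI[of _ _ "m + 1 - x"]) auto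
  qed auto
  moreover have "(\<lambda>i. p (m + 1 - i)) ` {1..m} = p ` (\<lambda>i. m + 1 - i) ` {1..m}"
    unfolding image_image ..
  ultimately show ?thesis by (simp only:)
qed

text \<open>A vertex attached at either end would prolong the path; the far end is treated by
  reversing it.\<close>

lemma longest_trail_attach:
  assumes "longest_trail m p" "w \<notin> p ` {1..m}" "A w (p b)" "b \<in> {1..m}"
  shows "2 \<le> b" "b < m"
proof -
  show "2 \<le> b" using longest_trail_start[OF assms(1,2)] assms(3,4) by (cases "b = 1") auto
  show "b < m"
    using longest_trail_start[OF longest_trail_rev[OF assms(1)], unfolded image_rev, OF assms(2)]
      assms(3,4) by (cases "b = m") auto
qed

text \<open>A branch of length two cannot sit next to the first vertex, since walking along the
  branch instead would give a longer path.\<close>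

lemma longest_trail_attach2:
  assumes "longest_trail m p" "u \<notin> p ` {1..m}" "A u (p b)" "b \<in> {1..m}"
    "w \<notin> p ` {1..m}" "w \<noteq> u" "A w u"
  shows "3 \<le> b"
proof (rule ccontr)
  assume "\<not> 3 \<le> b"
  then have b: "b = 2" "2 < m" using longest_trail_attach[OF assms(1-4)] by auto
  have tr: "trail ends m p" using assms(1) by (simp add: longest_trail_def)
  \<comment> \<open>With \<open>u\<close> attached at position 2, exchanging \<open>p 1\<close> for
    \<open>u\<close> keeps the length; \<open>w\<close> can then be put in front.\<close>
  define q where "q i = (if i = 1 then u else p i)" for i
  have inj: "inj_on q {1..m}"
  proof (rule inj_onI)
    fix i j assume ij: "i \<in> {1..m}" "j \<in> {1..m}" "q i = q j"
    have "p k \<noteq> u" if "1 \<le> k" "k \<le> m" for k using assms(2) that by auto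
    from this[of i] this[of j] trail_inj[OF tr, of i j] ij
    show "i = j" by (auto simp: q_def split: if_splits)
  qed
  have "A (q i) (q (Suc i))" if "1 \<le> i" "i < m" for i
    using that trail_step[OF tr, of i] assms(3) b by (auto simp: q_def numeral_2_eq_2)
  then have "trail ends m q" using inj by (simp add: trail_def)
  moreover have "w \<notin> q ` {1..m}" using assms(5,6) by (auto simp: q_def)
  moreover have "A w (q 1)" using assms(7) by (simp add: q_def)
  ultimately have "trail ends (Suc m) (\<lambda>i. if i = 1 then w else q (i - 1))"
    using b by (intro trail_extend) simp_all
  then have "Suc m \<le> m" using assms(1) unfolding longest_trail_def by blast
  then show False by simp
qed

text \<open>By connectedness a missing vertex yields an edge leaving the path together with
  \<open>u\<close>. If it starts on the path, there are two branches and affine type D appears; if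
  it starts at \<open>u\<close>, the branch has length two and affine type E6 appears.\<close>

lemma longest_trail_cover:
  assumes lt: "longest_trail m p" and u: "u \<notin> p ` {1..m}" "A u (p a)" "a \<in> {1..m}"
  shows "insert u (p ` {1..m}) = UNIV"
proof (rule ccontr)
  assume "insert u (p ` {1..m}) \<noteq> UNIV"
  then obtain y where "y \<notin> insert u (p ` {1..m})" by blast
  from connected_crossing_edge[OF connected insertI1 this]
  obtain x w where xw: "x \<in> insert u (p ` {1..m})" "w \<notin> insert u (p ` {1..m})" "A x w" by blast
  have tr: "trail ends m p" using lt by (simp add: longest_trail_def)
  note a = longest_trail_attach[OF lt u]
  show False
  proof (cases "x = u")
    case False
    then obtain b where b: "x = p b" "b \<in> {1..m}" using xw(1) by auto
    have w: "w \<notin> p ` {1..m}" "A w (p b)" using xw(2) A_sym[OF xw(3)] b(1) by auto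
    note b' = longest_trail_attach[OF lt w b(2)]
    have "w \<noteq> u" using xw(2) by blast
    show False
    proof (cases "a \<le> b")
      case True
      show False
        by (rule two_branches_False[OF tr a(1) True b'(2) u(1) w(1) _ u(2) w(2)]) (use \<open>w \<noteq> u\<close> in blast)
    next
      case False
      then have "b \<le> a" by simp
      from two_branches_False[OF tr b'(1) this a(2) w(1) u(1) \<open>w \<noteq> u\<close> w(2) u(2)] show False .
    qed
  next
    case True
    have wu: "w \<notin> p ` {1..m}" "w \<noteq> u" "A w u" "A u w" using xw(2,3) A_sym[OF xw(3)] True by auto
    \<comment> \<open>Used for the path and for its reversal, this leaves two vertices on each side
      of \<open>p a\<close>. With \<open>u\<close> and \<open>w\<close> they form three legs of
      length two.\<close>
    have a3: "3 \<le> a" by (rule longest_trail_attach2[OF lt u wu(1-3)])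
    have "3 \<le> m + 1 - a"
      by (rule longest_trail_attach2[OF longest_trail_rev[OF lt], unfolded image_rev, OF u(1) _ _ wu(1-3)])
        (use u in auto)
    then have am: "a + 2 \<le> m" by simp
    obtain k where k: "a = k + 2" "1 \<le> k" using a3 by (intro that[of "a - 2"]) auto
    have ne: "p i \<noteq> u \<and> p i \<noteq> w \<and> u \<noteq> w" if "1 \<le> i" "i \<le> m" for i using u(1) wu(1,2) that by auto
    have "distinct (map p [k + 2, k + 1, k, k + 3, k + 4])"
      using am k by (intro trail_distinct[OF tr]) auto
    then have "distinct [p (k + 2), p (k + 1), p k, p (k + 3), p (k + 4), u, w]"
      using ne[of k] ne[of "k + 1"] ne[of "k + 2"] ne[of "k + 3"] ne[of "k + 4"] wu(2) am k by simp
    then show False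
      using trail_adj[OF tr, of k "k + 1"] trail_adj[OF tr, of "k + 1" "k + 2"] am k u(2) wu
        trail_adj[OF tr, of "k + 2" "k + 3"] trail_adj[OF tr, of "k + 3" "k + 4"] A_sym[OF u(2)]
      by (intro E6_False[of "p (k + 2)" "p (k + 1)" "p k" "p (k + 3)" "p (k + 4)" u w]) simp_all
  qed
qed

end

section \<open>Recognition of types A, D and E\<close>

lemma edges_A_iff:
  "{i, j} \<in> edges_A m \<longleftrightarrow> j = Suc i \<and> 1 \<le> i \<and> i < m \<or> i = Suc j \<and> 1 \<le> j \<and> j < m"
  unfolding edges_A_def by (auto simp: doubleton_eq_iff)

lemma edges_A_pair: "f \<in> edges_A m \<Longrightarrow> \<exists>i\<in>{1..m}. \<exists>j\<in>{1..m}. f = {i, j}"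
  unfolding edges_A_def by force

context no_subharmonic begin

lemma trail_iso_A:
  assumes "trail ends m p" "p ` {1..m} = UNIV"
  shows "iso_simple_graph ends m (edges_A m)"
proof (rule iso_simple_graphI[OF loopless inj_ends, of p])
  show "bij_betw p {1..m} UNIV" using assms by (simp add: bij_betw_def trail_def)
  show "\<exists>i\<in>{1..m}. \<exists>j\<in>{1..m}. f = {i, j}" if "f \<in> edges_A m" for f
    using that by (rule edges_A_pair)
  show "A (p i) (p j) \<longleftrightarrow> {i, j} \<in> edges_A m" if "i \<in> {1..m}" "j \<in> {1..m}" for i j
    using that trail_induced[OF assms(1), of i j] edges_A_iff[of i j m] by auto
qed

text \<open>There are no chords and \<open>u\<close> has a single neighbour on the path, so all
  adjacencies are known. The edge sets of types D and E both have this form, with the extra vertex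
  numbered last.\<close>

lemma trail_iso_branch:
  assumes tr: "trail ends m p" and cov: "insert u (p ` {1..m}) = UNIV" and u: "u \<notin> p ` {1..m}"
    and a: "A u (p a)" "a \<in> {1..m}"
  shows "iso_simple_graph ends (Suc m) (edges_A m \<union> {{a, Suc m}})"
proof -
  define q where "q i = (if i = Suc m then u else p i)" for i
  have qp: "q i = p i" if "i \<in> {1..m}" for i using that by (auto simp: q_def)
  have img: "q ` {1..m} = p ` {1..m}" using qp by (intro image_cong) auto
  have I: "{1..Suc m} = insert (Suc m) {1..m}" by auto
  have trq: "trail ends m q"
    unfolding trail_def
  proof (intro conjI allI impI)
    have "inj_on p {1..m}" using tr by (simp add: trail_def)
    then show "inj_on q {1..m}" using inj_on_cong[of "{1..m}" q p, OF qp] by blast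
    show "A (q i) (q (Suc i))" if "1 \<le> i \<and> i < m" for i
      using that trail_step[OF tr, of i] by (simp add: q_def)
  qed
  have qu: "q (Suc m) = u" by (simp add: q_def)
  have att: "A (q (Suc m)) (q i) \<longleftrightarrow> i = a" if "i \<in> {1..m}" for i
    using attached_once[OF tr u a(2) that a(1)] a that qp[OF that] qu by auto
  have att': "A (q i) (q (Suc m)) \<longleftrightarrow> i = a" if "i \<in> {1..m}" for i
    using att[OF that] adj_commute[of ends "q i" "q (Suc m)"] by simp
  show ?thesis
  proof (rule iso_simple_graphI[OF loopless inj_ends, of q])
    have "inj_on q {1..Suc m}"
      unfolding I using trq u img qu by (simp add: trail_def)
    moreover have "q ` {1..Suc m} = UNIV" unfolding I image_insert img qu by (rule cov)
    ultimately show "bij_betw q {1..Suc m} UNIV" by (simp add: bij_betw_def)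
    show "\<exists>i\<in>{1..Suc m}. \<exists>j\<in>{1..Suc m}. f = {i, j}" if "f \<in> edges_A m \<union> {{a, Suc m}}" for f
    proof (cases "f = {a, Suc m}")
      case True
      then show ?thesis using a(2) by (force intro: bexI[of _ a] bexI[of _ "Suc m"])
    next
      case False
      then have "f \<in> edges_A m" using that by simp
      then obtain i j where "i \<in> {1..m}" "j \<in> {1..m}" "f = {i, j}" using edges_A_pair by blast
      then show ?thesis by force
    qed
    show "A (q i) (q j) \<longleftrightarrow> {i, j} \<in> edges_A m \<union> {{a, Suc m}}"
      if ij: "i \<in> {1..Suc m}" "j \<in> {1..Suc m}" for i j
    proof -
      consider "i \<in> {1..m}" "j \<in> {1..m}" | "i \<in> {1..m}" "j = Suc m" | "i = Suc m" "j \<in> {1..m}"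
        | "i = Suc m" "j = Suc m" using ij by fastforce
      then show ?thesis
      proof cases
        case 1
        then show ?thesis using trail_induced[OF trq, of i j] edges_A_iff[of i j m]
          by (auto simp: doubleton_eq_iff)
      next
        case 2
        then show ?thesis unfolding 2(2) att'[OF 2(1)] using edges_A_iff[of i "Suc m" m]
          by (auto simp: doubleton_eq_iff)
      next
        case 3
        then show ?thesis unfolding 3(1) att[OF 3(2)] using edges_A_iff[of "Suc m" j m]
          by (auto simp: doubleton_eq_iff)
      next
        case 4
        then show ?thesis unfolding 4 qu using adj_irrefl[OF loopless, of u] a(2)
            edges_A_iff[of "Suc m" "Suc m" m]
          by (auto simp: doubleton_eq_iff)
      qed
    qed
  qed
qed

text \<open>The three legs at \<open>p a\<close> have \<open>a - 1\<close>, \<open>m - a\<close> and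
  1 vertices; the last inequality says that the first is not longer than the second. The length of
  this shorter leg decides the type.\<close>

lemma branch_dynkin:
  assumes tr: "trail ends m p" and cov: "insert u (p ` {1..m}) = UNIV" and u: "u \<notin> p ` {1..m}"
    and a: "A u (p a)" "2 \<le> a" "a < m" "2 * a \<le> m + 1"
  shows "dynkin_ADE ends"
proof -
  have A: "A (p a) u" using A_sym[OF a(1)] .
  have ne: "p i \<noteq> u" if "1 \<le> i" "i \<le> m" for i using u that by auto
  consider "a = 2" | "a = 3" | "4 \<le> a" using a by linarith
  then show ?thesis
  proof cases
    case 1
    \<comment> \<open>\<open>edges_D\<close> attaches its extra vertex next to the end with the
      larger number, hence the reversal of the path.\<close>
    have r: "A u (p (m + 1 - (m - 1)))" "m - 1 \<in> {1..m}" using a 1 by auto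
    have "iso_simple_graph ends (Suc m) (edges_A m \<union> {{m - 1, Suc m}})"
      by (rule trail_iso_branch[OF trail_rev[OF tr], unfolded image_rev, OF cov u r])
    moreover have "edges_D (Suc m) = edges_A m \<union> {{m - 1, Suc m}}"
      by (simp add: edges_D_def numeral_2_eq_2)
    moreover have "Suc m \<ge> 4" using a 1 by simp
    ultimately show ?thesis unfolding dynkin_ADE_def by metis
  next
    case 2
    \<comment> \<open>Eight vertices on the path would give legs of lengths 5, 2 and 1, which is
      affine type E8. Together with \<open>2 * a \<le> m + 1\<close> exactly E6, E7 and E8
      remain.\<close>
    have "m < 8"
    proof (rule ccontr)
      assume m: "\<not> m < 8"
      have "distinct (map p [3, 4, 5, 6, 7, 8, 2, 1])" using m by (intro trail_distinct[OF tr]) auto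
      then have "distinct [p 3, p 4, p 5, p 6, p 7, p 8, p 2, p 1, u]"
        using ne[of 1] ne[of 2] ne[of 3] ne[of 4] ne[of 5] ne[of 6] ne[of 7] ne[of 8] m by simp
      then show False
        using trail_adj[OF tr, of 1 2] trail_adj[OF tr, of 2 3] trail_adj[OF tr, of 3 4]
          trail_adj[OF tr, of 4 5] trail_adj[OF tr, of 5 6] trail_adj[OF tr, of 6 7]
          trail_adj[OF tr, of 7 8] A m 2
        by (intro E8_False[of "p 3" "p 4" "p 5" "p 6" "p 7" "p 8" "p 2" "p 1" u]) simp_all
    qed
    then have "Suc m \<in> {6, 7, 8}" using a 2 by auto
    moreover have "iso_simple_graph ends (Suc m) (edges_E (Suc m))"
      using trail_iso_branch[OF tr cov u a(1)] a 2 by (simp add: edges_E_def)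
    ultimately show ?thesis unfolding dynkin_ADE_def by blast
  next
    case 3
    \<comment> \<open>Both legs along the path have at least three vertices now; with
      \<open>u\<close> this contains affine type E7.\<close>
    define k where "k = a - 3"
    have k: "a = k + 3" "1 \<le> k" "k + 6 \<le> m" using 3 a by (auto simp: k_def)
    have "distinct (map p [k + 3, k + 2, k + 1, k, k + 4, k + 5, k + 6])"
      using k by (intro trail_distinct[OF tr]) auto
    then have "distinct [p (k + 3), p (k + 2), p (k + 1), p k, p (k + 4), p (k + 5), p (k + 6), u]"
      using ne[of k] ne[of "k + 1"] ne[of "k + 2"] ne[of "k + 3"] ne[of "k + 4"] ne[of "k + 5"]
        ne[of "k + 6"] k by simp
    then have False
      using trail_adj[OF tr, of k "k + 1"] trail_adj[OF tr, of "k + 1" "k + 2"]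
        trail_adj[OF tr, of "k + 2" "k + 3"] trail_adj[OF tr, of "k + 3" "k + 4"]
        trail_adj[OF tr, of "k + 4" "k + 5"] trail_adj[OF tr, of "k + 5" "k + 6"] A k
      by (intro E7_False[of "p (k + 3)" "p (k + 2)" "p (k + 1)" "p k" "p (k + 4)" "p (k + 5)" "p (k + 6)" u])
        simp_all
    then show ?thesis ..
  qed
qed

theorem dynkin: "dynkin_ADE ends"
proof -
  obtain m p where lt: "longest_trail m p" using longest_trail_exists by blast
  then have tr: "trail ends m p" and m: "1 \<le> m" by (auto simp: longest_trail_def)
  show ?thesis
  proof (cases "p ` {1..m} = UNIV")
    case True
    then show ?thesis using trail_iso_A[OF tr] m unfolding dynkin_ADE_def by blast
  next
    case False
    then obtain y where y: "y \<notin> p ` {1..m}" by blast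
    have "p 1 \<in> p ` {1..m}" using m by auto
    from connected_crossing_edge[OF connected this y]
    obtain x u where xu: "x \<in> p ` {1..m}" "u \<notin> p ` {1..m}" "A x u" by blast
    then obtain a where a: "x = p a" "a \<in> {1..m}" by auto
    have u: "A u (p a)" using A_sym[OF xu(3)] a by simp
    note cov = longest_trail_cover[OF lt xu(2) u a(2)]
    note b = longest_trail_attach[OF lt xu(2) u a(2)]
    show ?thesis
    proof (cases "2 * a \<le> m + 1")
      case True
      then show ?thesis by (rule branch_dynkin[OF tr cov xu(2) u b])
    next
      case False
      \<comment> \<open>On the reversed path the branch is at position \<open>m + 1 - a\<close>,
        which lies in the first half.\<close>
      have "A u (p (m + 1 - (m + 1 - a)))" using u b by simp
      then show ?thesis
        by (rule branch_dynkin[OF trail_rev[OF tr], unfolded image_rev, OF cov xu(2)])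
          (use b False in auto)
    qed
  qed
qed

end

lemma subharmonic_if_not_dynkin:
  fixes ends :: "'e::finite \<Rightarrow> 'v::finite set"
  assumes "loopless ends" "connected_graph ends" "\<not> dynkin_ADE ends"
  shows "\<exists>d. subharmonic ends d \<and> (\<forall>v. 0 < d v)"
proof -
  have "\<not> no_subharmonic ends" using assms(3) no_subharmonic.dynkin by blast
  then obtain d v where "subharmonic ends d" "d v \<noteq> 0"
    using assms by (auto simp: no_subharmonic_def)
  then show ?thesis using subharmonic_pos[OF assms(1,2)] by blast
qed

section \<open>The defect\<close>

text \<open>The Euler form of the quiver with \<open>d\<close> as first argument: an arrow from
  \<open>a\<close> to \<open>b\<close> contributes \<open>- d a * v b\<close>.\<close>

definition defect :: "('v, 'e::finite) orient \<Rightarrow> ('v::finite \<Rightarrow> int) \<Rightarrow> ('v \<Rightarrow> int) \<Rightarrow> int" where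
  "defect \<Lambda> d v = (\<Sum>i\<in>UNIV. d i * v i) - (\<Sum>e\<in>UNIV. d (fst (\<Lambda> e)) * v (snd (\<Lambda> e)))"

definition unit_at :: "'v \<Rightarrow> 'v \<Rightarrow> int" where
  "unit_at x = (\<lambda>y. if y = x then 1 else 0)"

lemma orientation_reverse_at: "orientation ends \<Lambda> \<Longrightarrow> orientation ends (reverse_at x \<Lambda>)"
  unfolding orientation_def reverse_at_def by (simp add: insert_commute)

lemma reverse_at_sink:
  assumes "loopless ends" "orientation ends \<Lambda>" "sink \<Lambda> y"
  shows "reverse_at y \<Lambda> e = (if snd (\<Lambda> e) = y then (y, fst (\<Lambda> e)) else \<Lambda> e)"
  using assms(3) by (cases "\<Lambda> e") (auto simp: reverse_at_def sink_def dest!: spec[of _ e])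

lemma neighbour_sum_sink:
  assumes "loopless ends" "orientation ends \<Lambda>" "sink \<Lambda> y"
  shows "(\<Sum>e | snd (\<Lambda> e) = y. d (fst (\<Lambda> e))) = neighbour_sum ends d y"
proof -
  let ?I = "{e. snd (\<Lambda> e) = y}"
  have "(\<Sum>e\<in>?I. d (fst (\<Lambda> e))) = (\<Sum>j\<in>UNIV - {y}. \<Sum>e\<in>{e \<in> ?I. fst (\<Lambda> e) = j}. d (fst (\<Lambda> e)))"
    using assms(3) by (intro sum.group[symmetric]) (auto simp: sink_def)
  also have "\<dots> = neighbour_sum ends d y"
    unfolding neighbour_sum_def
  proof (rule sum.cong[OF refl])
    fix j assume j: "j \<in> UNIV - {y}"
    have "e \<in> ?I \<and> fst (\<Lambda> e) = j \<longleftrightarrow> ends e = {y, j}" for e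
    proof -
      have "ends e = {fst (\<Lambda> e), snd (\<Lambda> e)}" "fst (\<Lambda> e) \<noteq> y"
        using assms(2,3) by (auto simp: orientation_def sink_def)
      then show ?thesis using j by (auto simp: doubleton_eq_iff)
    qed
    then have "{e \<in> ?I. fst (\<Lambda> e) = j} = {e. ends e = {y, j}}" by auto
    moreover have "(\<Sum>e\<in>{e \<in> ?I. fst (\<Lambda> e) = j}. d (fst (\<Lambda> e))) = int (card {e \<in> ?I. fst (\<Lambda> e) = j}) * d j"
      by (simp add: sum.cong[of _ _ "\<lambda>e. d (fst (\<Lambda> e))" "\<lambda>e. d j"])
    ultimately show "(\<Sum>e\<in>{e \<in> ?I. fst (\<Lambda> e) = j}. d (fst (\<Lambda> e))) = int (card {e. ends e = {y, j}}) * d j"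
      by simp
  qed
  finally show ?thesis .
qed

lemma sum_split_at: "(\<Sum>i\<in>UNIV. f i) = f (y :: 'v::finite) + (\<Sum>i\<in>UNIV - {y}. f i :: int)"
  by (simp add: sum.remove[of UNIV y])

lemma sum_split_edges:
  "(\<Sum>e\<in>UNIV. f e) = (\<Sum>e | P e. f e) + (\<Sum>e | \<not> P (e :: 'e::finite). f e :: int)"
proof -
  have "UNIV = {e. P e} \<union> {e. \<not> P e}" by auto
  then show ?thesis by (metis (no_types, lifting) finite sum.union_disjoint disjoint_iff mem_Collect_eq)
qed

text \<open>In the application \<open>v\<close> is a dimension vector and \<open>c\<close> the dimension of the kernel at the sink \<open>y\<close>;
  equality \<open>c = neighbour_sum ends v y - v y\<close> is the simple reflection of \<open>v\<close>.\<close>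

lemma defect_reverse_mono:
  assumes lo: "loopless ends" "orientation ends \<Lambda>" and y: "sink \<Lambda> y" and d: "subharmonic ends d"
    and v: "0 \<le> v y" "neighbour_sum ends v y - v y \<le> c"
  shows "defect \<Lambda> d v \<le> defect (reverse_at y \<Lambda>) d (v(y := c))"
proof -
  let ?v = "v(y := c)" and ?L = "reverse_at y \<Lambda>"
  note rev = reverse_at_sink[OF lo y]
  have y': "fst (\<Lambda> e) \<noteq> y" for e using y by (auto simp: sink_def)
  let ?V = "\<Sum>i\<in>UNIV - {y}. d i * v i" and ?E = "\<Sum>e | snd (\<Lambda> e) \<noteq> y. d (fst (\<Lambda> e)) * v (snd (\<Lambda> e))"
  have "defect \<Lambda> d v = d y * v y + ?V - ((\<Sum>e | snd (\<Lambda> e) = y. d (fst (\<Lambda> e)) * v (snd (\<Lambda> e))) + ?E)"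
    unfolding defect_def sum_split_at[of _ y] sum_split_edges[of _ "\<lambda>e. snd (\<Lambda> e) = y"] ..
  also have "(\<Sum>e | snd (\<Lambda> e) = y. d (fst (\<Lambda> e)) * v (snd (\<Lambda> e))) = neighbour_sum ends d y * v y"
    unfolding neighbour_sum_sink[OF lo y, symmetric] sum_distrib_right by (intro sum.cong) auto
  finally have 1: "defect \<Lambda> d v = d y * v y + ?V - (neighbour_sum ends d y * v y + ?E)" .
  have "defect ?L d ?v = d y * ?v y + (\<Sum>i\<in>UNIV - {y}. d i * ?v i)
      - ((\<Sum>e | snd (\<Lambda> e) = y. d (fst (?L e)) * ?v (snd (?L e))) + (\<Sum>e | snd (\<Lambda> e) \<noteq> y. d (fst (?L e)) * ?v (snd (?L e))))"
    unfolding defect_def sum_split_at[of _ y] sum_split_edges[of _ "\<lambda>e. snd (\<Lambda> e) = y"] ..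
  also have "(\<Sum>i\<in>UNIV - {y}. d i * ?v i) = ?V" by (intro sum.cong) auto
  also have "(\<Sum>e | snd (\<Lambda> e) \<noteq> y. d (fst (?L e)) * ?v (snd (?L e))) = ?E"
    by (intro sum.cong) (auto simp: rev)
  also have "(\<Sum>e | snd (\<Lambda> e) = y. d (fst (?L e)) * ?v (snd (?L e))) = d y * neighbour_sum ends v y"
    unfolding neighbour_sum_sink[OF lo y, symmetric] sum_distrib_left
    by (intro sum.cong) (auto simp: rev y')
  finally have 2: "defect ?L d ?v = d y * c + ?V - (d y * neighbour_sum ends v y + ?E)" by (simp only: fun_upd_same)
  have dy: "0 \<le> d y" "2 * d y \<le> neighbour_sum ends d y" using d by (auto simp: subharmonic_def)
  \<comment> \<open>The growth of the defect is \<open>d y * (c - (neighbour_sum ends v y - v y)) +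
    (neighbour_sum ends d y - 2 * d y) * v y\<close>; both summands are nonnegative.\<close>
  have "d y * (neighbour_sum ends v y - v y) \<le> d y * c" using v(2) dy(1) by (rule mult_left_mono)
  moreover have "2 * d y * v y \<le> neighbour_sum ends d y * v y" using dy(2) v(1) by (rule mult_right_mono)
  ultimately show ?thesis unfolding 1 2 by (simp add: algebra_simps)
qed

text \<open>For positive subharmonic \<open>d\<close> this value is at most \<open>- d y\<close>,
  hence negative, while at a source the unit vector has the positive defect
  \<open>d y\<close>.\<close>

lemma defect_unit_sink:
  assumes "loopless ends" "orientation ends \<Lambda>" "sink \<Lambda> y"
  shows "defect \<Lambda> d (unit_at y) = d y - neighbour_sum ends d y"
proof -
  have "(\<Sum>e\<in>UNIV. d (fst (\<Lambda> e)) * unit_at y (snd (\<Lambda> e))) = (\<Sum>e | snd (\<Lambda> e) = y. d (fst (\<Lambda> e)))"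
    by (rule sum.mono_neutral_cong_right) (auto simp: unit_at_def)
  moreover have "(\<Sum>i\<in>UNIV. d i * unit_at y i) = d y" by (simp add: unit_at_def if_distrib cong: if_cong)
  ultimately show ?thesis unfolding defect_def neighbour_sum_sink[OF assms, symmetric] by simp
qed

lemma defect_unit_source:
  assumes "loopless ends" "orientation ends \<Lambda>" "sink \<Lambda> y"
  shows "defect (reverse_at y \<Lambda>) d (unit_at y) = d y"
proof -
  have "snd (reverse_at y \<Lambda> e) \<noteq> y" for e
    using assms(3) by (auto simp: reverse_at_sink[OF assms] sink_def)
  then have "(\<Sum>e\<in>UNIV. d (fst (reverse_at y \<Lambda> e)) * unit_at y (snd (reverse_at y \<Lambda> e))) = 0"
    by (intro sum.neutral) (simp add: unit_at_def)
  moreover have "(\<Sum>i\<in>UNIV. d i * unit_at y i) = d y" by (simp add: unit_at_def if_distrib cong: if_cong)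
  ultimately show ?thesis unfolding defect_def by simp
qed

section \<open>Real roots and reduced words\<close>

abbreviation nonneg_vec :: "int ^ 'v::finite \<Rightarrow> bool" where
  "nonneg_vec v \<equiv> \<forall>j. 0 \<le> v $ j"

definition coroot_pairing :: "('e::finite \<Rightarrow> 'v::finite set) \<Rightarrow> 'v \<Rightarrow> int ^ 'v \<Rightarrow> int" where
  "coroot_pairing ends i v = (\<Sum>j\<in>UNIV. cartan ends i j * v $ j)"

lemma coroot_pairing_eq: "coroot_pairing ends i v = 2 * v $ i - neighbour_sum ends (($) v) i"
proof -
  have "coroot_pairing ends i v = 2 * v $ i + (\<Sum>j\<in>UNIV - {i}. cartan ends i j * v $ j)"
    unfolding coroot_pairing_def sum_split_at[of _ i] by (simp add: cartan_def)
  also have "(\<Sum>j\<in>UNIV - {i}. cartan ends i j * v $ j) = - neighbour_sum ends (($) v) i"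
    unfolding neighbour_sum_def sum_negf[symmetric] by (intro sum.cong) (auto simp: cartan_def)
  finally show ?thesis by simp
qed

lemma coroot_pairing_add: "coroot_pairing ends i (v + w) = coroot_pairing ends i v + coroot_pairing ends i w"
  by (simp add: coroot_pairing_def sum.distrib algebra_simps)

lemma coroot_pairing_diff: "coroot_pairing ends i (v - w) = coroot_pairing ends i v - coroot_pairing ends i w"
  by (simp add: coroot_pairing_def sum_subtractf algebra_simps)

lemma coroot_pairing_scale: "coroot_pairing ends i (c *s v) = c * coroot_pairing ends i v"
  by (simp add: coroot_pairing_def sum_distrib_left algebra_simps)

lemma coroot_pairing_axis: "coroot_pairing ends i (axis k x) = cartan ends i k * x"
  by (simp add: coroot_pairing_def axis_def if_distrib cong: if_cong)

lemmas coroot_pairing_simps =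
  coroot_pairing_add coroot_pairing_diff coroot_pairing_scale coroot_pairing_axis

lemma simple_reflection_eq: "simple_reflection ends i v = v - axis i (coroot_pairing ends i v)"
  by (simp add: simple_reflection_def coroot_pairing_def)

lemma cartan_diag [simp]: "cartan ends i i = 2"
  by (simp add: cartan_def)

lemma cartan_commute: "cartan ends i j = cartan ends j i"
  by (simp add: cartan_def insert_commute)

lemma axis_nth_eq: "axis i (x :: int) $ j = (if j = i then x else 0)"
  by (simp add: axis_def)

lemma simple_reflection_invol [simp]: "simple_reflection ends i (simple_reflection ends i v) = v"
  by (simp add: simple_reflection_eq coroot_pairing_simps vec_eq_iff axis_nth_eq)

lemma simple_reflection_add:
  "simple_reflection ends i (v + w) = simple_reflection ends i v + simple_reflection ends i w"
  by (simp add: simple_reflection_eq coroot_pairing_simps vec_eq_iff axis_nth_eq)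

lemma simple_reflection_scale:
  "simple_reflection ends i (c *s v) = c *s simple_reflection ends i v"
  by (simp add: simple_reflection_eq coroot_pairing_simps vec_eq_iff axis_nth_eq algebra_simps)

lemma simple_reflection_nth:
  "simple_reflection ends i v $ j = (if j = i then neighbour_sum ends (($) v) i - v $ i else v $ j)"
  by (simp add: simple_reflection_eq coroot_pairing_eq axis_nth_eq)

lemma neg_eq_scale: "- v = (- 1) *s (v :: int ^ 'v)"
  by (simp add: vec_eq_iff)

section \<open>Words in simple reflections and their action on simple roots\<close>

context
  fixes ends :: "'e::finite \<Rightarrow> 'v::finite set"
begin

abbreviation refl_at :: "'v \<Rightarrow> int ^ 'v \<Rightarrow> int ^ 'v" where "refl_at \<equiv> simple_reflection ends"
text \<open>The first letter acts last, so \<open>weyl_word ends S\<close> is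
  \<open>act (rev S)\<close>; this order lets suffixes act first in inductions over lists.\<close>

abbreviation act :: "'v list \<Rightarrow> int ^ 'v \<Rightarrow> int ^ 'v" where "act \<equiv> foldr refl_at"
abbreviation simple_root :: "'v \<Rightarrow> int ^ 'v" where "simple_root i \<equiv> axis i 1"

lemma act_add: "act zs (v + w) = act zs v + act zs w"
  by (induction zs) (simp_all add: simple_reflection_add)

lemma act_scale: "act zs (c *s v) = c *s act zs v"
  by (induction zs) (simp_all add: simple_reflection_scale)

lemma act_neg: "act zs (- v) = - act zs v"
  unfolding neg_eq_scale act_scale ..

lemma act_rev [simp]: "act (rev zs) (act zs v) = v"
  by (induction zs arbitrary: v) simp_all

lemma act_rev' [simp]: "act zs (act (rev zs) v) = v"
  using act_rev[of "rev zs"] by simp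

lemma act_append: "act (xs @ ys) = act xs \<circ> act ys"
  by (auto simp: fun_eq_iff)

lemma refl_simple_root: "refl_at i (simple_root i) = - simple_root i"
  by (simp add: simple_reflection_eq coroot_pairing_simps vec_eq_iff axis_nth_eq)

lemma axis_scale: "axis i (c :: int) = c *s simple_root i"
  by (simp add: vec_eq_iff axis_nth_eq)

lemma axis_zero [simp]: "axis i (0 :: int) = 0"
  by (simp add: vec_eq_iff axis_nth_eq)

lemma refl_pair:
  assumes "i \<noteq> t"
  shows "refl_at t (axis i a + axis t b) = axis i a + axis t (- cartan ends i t * a - b)"
  using assms cartan_commute[of ends i t]
  by (simp add: simple_reflection_eq coroot_pairing_simps vec_eq_iff axis_nth_eq algebra_simps)

lemma refl_comm:
  assumes "cartan ends i t = 0"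
  shows "refl_at i (refl_at t v) = refl_at t (refl_at i v)"
  using assms cartan_commute[of ends i t]
  by (simp add: simple_reflection_eq coroot_pairing_simps vec_eq_iff axis_nth_eq algebra_simps)

lemma refl_braid:
  assumes "cartan ends i t = -1"
  shows "refl_at t (refl_at i (refl_at t v)) = refl_at i (refl_at t (refl_at i v))"
  using assms cartan_commute[of ends i t]
  by (simp add: simple_reflection_eq coroot_pairing_simps vec_eq_iff axis_nth_eq algebra_simps)

text \<open>The letter applied last, \<open>hd u\<close>, always has the dominating coefficient, and
  reflecting in the other letter only enlarges the smaller one. The empty word counts as ending with
  \<open>i\<close> because the starting vector is \<open>simple_root i\<close>.\<close>

lemma alternating_act_simple_root:
  assumes "i \<noteq> t" "cartan ends i t \<le> - 2" "set u \<subseteq> {i, t}"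
    "\<And>x k y. u \<noteq> x @ [k, k] @ y" "\<And>x. u \<noteq> x @ [i]"
  shows "\<exists>a b. 0 \<le> a \<and> 0 \<le> b \<and> act u (simple_root i) = axis i a + axis t b \<and>
    (u = [] \<or> hd u = i \<longrightarrow> b \<le> a) \<and> (u \<noteq> [] \<and> hd u = t \<longrightarrow> a \<le> b)"
  using assms(3-)
proof (induction u)
  case Nil
  show ?case by (intro exI[of _ 1] exI[of _ 0]) (simp add: vec_eq_iff axis_nth_eq)
next
  case (Cons k u)
  have u1: "u \<noteq> x @ [k, k] @ y" for x k y using Cons.prems(2)[of "_ # x"] by auto
  have u2: "u \<noteq> x @ [i]" for x using Cons.prems(3)[of "_ # x"] by auto
  obtain a b where ab: "0 \<le> a" "0 \<le> b" "act u (simple_root i) = axis i a + axis t b"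
    "u = [] \<or> hd u = i \<longrightarrow> b \<le> a" "u \<noteq> [] \<and> hd u = t \<longrightarrow> a \<le> b"
    using Cons.IH[OF _ u1 u2] Cons.prems(1) by auto
  have hd: "u \<noteq> [] \<Longrightarrow> hd u \<noteq> k" using Cons.prems(2)[of "[]" k "tl u"] by (cases u) auto
  have hdin: "u \<noteq> [] \<Longrightarrow> hd u \<in> {i, t}" using Cons.prems(1) by (cases u) auto
  consider "k = t" | "k = i" using Cons.prems(1) by auto
  then show ?case
  proof cases
    case 1
    then have ba: "b \<le> a" using ab(4) hd hdin by (cases "u = []") auto
    \<comment> \<open>The new coefficient is at least \<open>2 * a - b\<close>, hence at least
      \<open>a\<close>, as \<open>b \<le> a\<close>.\<close>
    have "2 * a \<le> - cartan ends i t * a" using assms(2) ab(1) by (intro mult_right_mono) auto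
    then show ?thesis using 1 ab ba assms(1) refl_pair[OF assms(1), of a b]
      by (intro exI[of _ a] exI[of _ "- cartan ends i t * a - b"]) simp
  next
    case 2
    have "u \<noteq> []" using Cons.prems(3)[of "[]"] 2 by auto
    then have ba: "a \<le> b" using ab(5) hd hdin 2 by auto
    have "2 * b \<le> - cartan ends i t * b" using assms(2) ab(2) by (intro mult_right_mono) auto
    moreover have "refl_at i (axis i a + axis t b) = axis i (- cartan ends i t * b - a) + axis t b"
      using refl_pair[of t i b a] assms(1) cartan_commute[of ends i t] by (simp add: add.commute)
    ultimately show ?thesis using 2 ab ba assms(1)
      by (intro exI[of _ "- cartan ends i t * b - a"] exI[of _ b]) simp
  qed
qed

text \<open>Only multiplicity at least two gives an infinite dihedral group; for multiplicity zero or one the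
  commutation and braid relations leave finitely many words \<open>u\<close>.\<close>

lemma dihedral_act_simple_root:
  assumes it: "i \<noteq> t" and u: "set u \<subseteq> {i, t}"
    and red: "\<And>ys. set ys \<subseteq> {i, t} \<Longrightarrow> act ys = act u \<Longrightarrow> length u \<le> length ys"
    and red': "\<And>ys. set ys \<subseteq> {i, t} \<Longrightarrow> act ys = act (u @ [i]) \<Longrightarrow> length u \<le> length ys"
  shows "\<exists>a b. 0 \<le> a \<and> 0 \<le> b \<and> act u (simple_root i) = axis i a + axis t b"
proof -
  have alt: "u \<noteq> x @ [k, k] @ y" for x k y
    using red[of "x @ y"] u by (auto simp: act_append fun_eq_iff)
  have last: "u \<noteq> x @ [i]" for x
    using red'[of x] u by (auto simp: act_append fun_eq_iff)
  have c: "cartan ends i t \<le> 0" using it by (simp add: cartan_def)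
  have one: "act [t] (simple_root i) = axis i 1 + axis t (- cartan ends i t)"
    using refl_pair[OF it, of 1 0] by simp
  have zero: "act [] (simple_root i) = axis i 1 + axis t 0" by (simp add: vec_eq_iff axis_nth_eq)
  have forms: "u = [] \<or> u = [t] \<or> (\<exists>x. u = x @ [i, t])"
  proof (cases u rule: rev_cases)
    case (snoc x k)
    then have "k = t" using last[of x] u by auto
    show ?thesis
    proof (cases x rule: rev_cases)
      case (snoc x' l)
      then have "l = i" using alt[of x' t "[]"] u \<open>u = x @ [k]\<close> \<open>k = t\<close> by auto
      then show ?thesis using snoc \<open>u = x @ [k]\<close> \<open>k = t\<close> by simp
    qed (use \<open>u = x @ [k]\<close> \<open>k = t\<close> in simp)
  qed simp
  consider "cartan ends i t = 0" | "cartan ends i t = -1" | "cartan ends i t \<le> -2" using c by linarith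
  then show ?thesis
  proof cases
    case 1
    have "u \<noteq> x @ [i, t]" for x
    proof
      assume ux: "u = x @ [i, t]"
      \<comment> \<open>Commuting the last letters of \<open>u @ [i]\<close> makes \<open>i\<close>
        meet \<open>i\<close> and cancel, which leaves a word shorter than \<open>u\<close>.\<close>
      have "act (x @ [t]) = act (u @ [i])" by (simp add: ux fun_eq_iff refl_comm[OF 1])
      from red'[OF _ this] show False using u ux by auto
    qed
    then show ?thesis using forms zero one 1 by (metis neg_0_equal_iff_equal order_refl zero_le_one)
  next
    case 2
    have no3: "u \<noteq> x @ [t, i, t]" for x
    proof
      assume ux: "u = x @ [t, i, t]"
      \<comment> \<open>In \<open>u @ [i]\<close> the tail \<open>t i t i\<close> becomes
        \<open>i t i i\<close> by the braid relation, and \<open>i i\<close> cancels.\<close>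
      have "act (x @ [i, t]) = act (u @ [i])" by (simp add: ux fun_eq_iff refl_braid[OF 2])
      from red'[OF _ this] show False using u ux by auto
    qed
    have "x = []" if "u = x @ [i, t]" for x
    proof (cases x rule: rev_cases)
      case (snoc x' l)
      then show ?thesis using no3[of x'] alt[of x' i "[t]"] that u by auto
    qed
    then have "u = [] \<or> u = [t] \<or> u = [i, t]" using forms by blast
    moreover have "act [i, t] (simple_root i) = axis i 0 + axis t 1"
      using it 2 cartan_commute[of ends i t]
      by (simp add: simple_reflection_eq coroot_pairing_simps vec_eq_iff axis_nth_eq)
    ultimately show ?thesis using zero one 2 by (metis minus_minus order_refl zero_le_one)
  next
    case 3
    from alternating_act_simple_root[OF it this u alt last] show ?thesis by blast
  qed
qed

text \<open>Deodhar's argument: \<open>zs\<close> is split as \<open>v @ u\<close> with \<open>u\<close> a word in \<open>i\<close> and the last letter of \<open>zs\<close>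
  and with \<open>v\<close> as short as possible. Then the induction hypothesis applies to \<open>v\<close> and both letters.\<close>

lemma act_simple_root_nonneg:
  assumes "\<And>ys. act ys = act zs \<Longrightarrow> length zs \<le> length ys"
    "\<And>ys. act ys = act (zs @ [i]) \<Longrightarrow> length zs \<le> length ys"
  shows "nonneg_vec (act zs (simple_root i))"
  using assms
proof (induction "length zs" arbitrary: zs i rule: less_induct)
  case less
  note red = less.prems(1) and red' = less.prems(2)
  show ?case
  proof (cases zs rule: rev_cases)
    case Nil
    then show ?thesis by (simp add: axis_nth_eq)
  next
    case (snoc z t)
    have it: "i \<noteq> t" using red'[of z] snoc by (auto simp: fun_eq_iff)
    define C where "C v \<longleftrightarrow> (\<exists>u. set u \<subseteq> {i, t} \<and> act (v @ u) = act zs \<and> length v + length u = length zs)" for v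
    have "C z" unfolding C_def snoc by (intro exI[of _ "[t]"]) simp
    then obtain v where Cv: "C v" and vmin: "\<And>v'. C v' \<Longrightarrow> length v \<le> length v'"
      using ex_has_least_nat[of C z length] by blast
    obtain u where u: "set u \<subseteq> {i, t}" "act (v @ u) = act zs" "length v + length u = length zs"
      using Cv unfolding C_def by blast
    \<comment> \<open>Already stripping the last letter \<open>t\<close> gives a candidate, so the
      induction hypothesis is available for the shortest one.\<close>
    have lt: "length v < length zs" using vmin[OF \<open>C z\<close>] snoc by simp
    have redv: "length v \<le> length ys" if "act ys = act v" for ys
    proof -
      have "act (ys @ u) = act zs" using that u(2) by (simp add: act_append)
      from red[OF this] show ?thesis using u(3) by simp
    qed
    have redv': "length v \<le> length ys" if k: "k \<in> {i, t}" and ys: "act ys = act (v @ [k])" for ys k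
    proof (rule ccontr)
      assume l: "\<not> length v \<le> length ys"
      have *: "act (ys @ k # u) = act zs" using ys u(2) by (auto simp: act_append fun_eq_iff)
      \<comment> \<open>Minimality of \<open>zs\<close> gives one inequality and
        \<open>length ys < length v\<close> the other. So \<open>ys\<close>, with
        \<open>k # u\<close> as its complement, would be a candidate shorter than
        \<open>v\<close>.\<close>
      from red[OF this] have "length ys + length (k # u) = length zs" using u(3) l by simp
      then have "C ys" unfolding C_def using * k u(1) by (intro exI[of _ "k # u"]) simp
      from vmin[OF this] l show False by simp
    qed
    have pos: "nonneg_vec (act v (simple_root i))" "nonneg_vec (act v (simple_root t))"
      using less.hyps[OF lt redv redv'[of i]] less.hyps[OF lt redv redv'[of t]] by blast+
    have "\<exists>a b. 0 \<le> a \<and> 0 \<le> b \<and> act u (simple_root i) = axis i a + axis t b"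
    proof (rule dihedral_act_simple_root[OF it u(1)])
      fix ys
      show "length u \<le> length ys" if "act ys = act u"
      proof -
        have "act (v @ ys) = act zs" using that u(2) by (simp add: act_append)
        from red[OF this] show ?thesis using u(3) by simp
      qed
      show "length u \<le> length ys" if "act ys = act (u @ [i])"
      proof -
        have "act (v @ ys) = act v \<circ> act (u @ [i])" using that by (simp add: act_append)
        also have "\<dots> = act (v @ u) \<circ> act [i]" by (simp add: act_append comp_assoc)
        also have "\<dots> = act (zs @ [i])" unfolding u(2) by (simp add: act_append)
        finally have "act (v @ ys) = act (zs @ [i])" .
        from red'[OF this] show ?thesis using u(3) by simp
      qed
    qed
    then obtain a b where ab: "0 \<le> a" "0 \<le> b" "act u (simple_root i) = axis i a + axis t b" by blast
    have "act zs (simple_root i) = act v (act u (simple_root i))"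
      unfolding u(2)[symmetric] by (simp add: act_append)
    also have "\<dots> = a *s act v (simple_root i) + b *s act v (simple_root t)"
      unfolding ab(3) axis_scale[of i a] axis_scale[of t b] act_add act_scale ..
    finally show ?thesis using pos ab by simp
  qed
qed

section \<open>Sign coherence of real roots\<close>

definition real_root :: "int ^ 'v \<Rightarrow> bool" where
  "real_root v \<longleftrightarrow> (\<exists>zs i. v = act zs (simple_root i))"

lemma minimal_word: "\<exists>r. act r = act zs \<and> (\<forall>ys. act ys = act zs \<longrightarrow> length r \<le> length ys)"
  using ex_has_least_nat[of "\<lambda>ys. act ys = act zs" zs length] by blast

text \<open>Of the elements given by \<open>zs\<close> and \<open>zs @ [i]\<close>, take one with
  the shorter minimal word. Multiplying it by the reflection at \<open>i\<close> does not shorten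
  it, so it sends \<open>simple_root i\<close> to a nonnegative vector. This vector is
  \<open>v\<close> for the first element and \<open>- v\<close> for the second.\<close>

lemma real_root_sign:
  assumes "real_root v"
  shows "nonneg_vec v \<or> nonneg_vec (- v)"
proof -
  obtain zs i where v: "v = act zs (simple_root i)" using assms by (auto simp: real_root_def)
  obtain r where r: "act r = act zs" "\<And>ys. act ys = act zs \<Longrightarrow> length r \<le> length ys"
    using minimal_word by blast
  obtain r' where r': "act r' = act (zs @ [i])" "\<And>ys. act ys = act (zs @ [i]) \<Longrightarrow> length r' \<le> length ys"
    using minimal_word by blast
  have ri: "act (r @ [i]) = act (zs @ [i])" using r(1) by (simp add: act_append)
  have r'i: "act (r' @ [i]) = act zs" using r'(1) by (auto simp: act_append fun_eq_iff)
  show ?thesis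
  proof (cases "length r \<le> length r'")
    case True
    have "nonneg_vec (act r (simple_root i))"
    proof (rule act_simple_root_nonneg)
      fix ys
      show "length r \<le> length ys" if "act ys = act r" using r that by simp
      show "length r \<le> length ys" if "act ys = act (r @ [i])"
        using r'(2)[of ys] that ri True by simp
    qed
    then show ?thesis using v r(1) by simp
  next
    case False
    have "nonneg_vec (act r' (simple_root i))"
    proof (rule act_simple_root_nonneg)
      fix ys
      show "length r' \<le> length ys" if "act ys = act r'" using r' that by simp
      show "length r' \<le> length ys" if "act ys = act (r' @ [i])"
        using r(2)[of ys] that r'i False by simp
    qed
    moreover have "act r' (simple_root i) = - v"
      unfolding r'(1) v by (simp add: refl_simple_root act_neg)
    ultimately show ?thesis by simp
  qed
qed

lemma real_root_refl: "real_root v \<Longrightarrow> real_root (refl_at k v)"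
  unfolding real_root_def by (metis foldr.simps(2) comp_apply)

lemma real_root_act: "real_root v \<Longrightarrow> real_root (act zs v)"
  by (induction zs) (simp_all add: real_root_refl)

lemma real_root_simple: "real_root (simple_root i)"
  unfolding real_root_def by (metis foldr.simps(1) id_apply)

lemma real_root_neg:
  assumes "real_root v"
  shows "real_root (- v)"
proof -
  obtain zs i where "v = act zs (simple_root i)" using assms by (auto simp: real_root_def)
  then have "- v = act (zs @ [i]) (simple_root i)" by (simp add: refl_simple_root act_neg)
  then show ?thesis unfolding real_root_def by blast
qed

lemma act_eq_0: "act zs v = 0 \<Longrightarrow> v = 0"
proof -
  assume "act zs v = 0"
  then have "v = act (rev zs) 0" by (metis act_rev)
  also have "\<dots> = act (rev zs) (0 *s 0)" by simp
  finally show ?thesis unfolding act_scale by simp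
qed

lemma real_root_nonzero: "real_root v \<Longrightarrow> v \<noteq> 0"
  unfolding real_root_def using act_eq_0 by (metis axis_eq_0_iff zero_neq_one)

lemma nonneg_antisym: "nonneg_vec v \<Longrightarrow> nonneg_vec (- v) \<Longrightarrow> v = 0"
  by (simp add: vec_eq_iff order_antisym)

text \<open>A reflection at \<open>k\<close> changes only coordinate \<open>k\<close>. If the sign
  of the whole vector flips, all other coordinates must vanish.\<close>

lemma real_root_flip:
  assumes "real_root v" "nonneg_vec v" "\<not> nonneg_vec (refl_at k v)"
  shows "v = simple_root k"
proof -
  have neg: "nonneg_vec (- refl_at k v)" using real_root_sign[OF real_root_refl[OF assms(1)]] assms(3) by blast
  have "v $ j = 0" if "j \<noteq> k" for j
  proof -
    have "0 \<le> - v $ j" using neg[rule_format, of j] that by (simp add: simple_reflection_nth)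
    then show ?thesis using assms(2)[rule_format, of j] by simp
  qed
  then have v: "v = v $ k *s simple_root k" by (simp add: vec_eq_iff axis_nth_eq)
  \<comment> \<open>The coefficient at \<open>k\<close> divides 1: the inverse word carries
    \<open>v\<close> to a simple root, which has a coordinate equal to 1.\<close>
  obtain zs i where "v = act zs (simple_root i)" using assms(1) by (auto simp: real_root_def)
  then have "simple_root i = act (rev zs) v" by simp
  also have "\<dots> = v $ k *s act (rev zs) (simple_root k)" by (subst v) (rule act_scale)
  finally have "simple_root i $ i = (v $ k *s act (rev zs) (simple_root k)) $ i" by simp
  then have "1 = v $ k * (act (rev zs) (simple_root k) $ i)" by (simp add: axis_nth_eq)
  then have "v $ k = 1" using assms(2)[rule_format, of k] by (metis zmult_eq_1_iff abs_of_nonneg zdvd1_eq dvd_triv_left)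
  then show ?thesis using v by simp
qed

section \<open>Inversions and reduced words\<close>

lemma weyl_word_eq: "weyl_word ends S = act (rev S)"
proof -
  have "fold (\<lambda>x w. refl_at x \<circ> w) S f = act (rev S) \<circ> f" for f
    by (induction S arbitrary: f) (auto simp: fun_eq_iff)
  from this[of id] show ?thesis by (simp only: weyl_word_def comp_id)
qed

definition inversions :: "(int ^ 'v \<Rightarrow> int ^ 'v) \<Rightarrow> (int ^ 'v) set" where
  "inversions w = {v. real_root v \<and> nonneg_vec v \<and> \<not> nonneg_vec (w v)}"

text \<open>An additional letter \<open>x\<close> can turn negative only a root that the earlier
  letters send to \<open>simple_root x\<close>; there is just one such root.\<close>

lemma inversions_upper: "finite (inversions (act (rev zs))) \<and> card (inversions (act (rev zs))) \<le> length zs"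
proof (induction zs rule: rev_induct)
  case Nil
  have "inversions (act (rev [])) = {}" by (auto simp: inversions_def)
  then show ?case by (simp only: finite.emptyI card.empty list.size order_refl simp_thms)
next
  case (snoc x zs)
  have sub: "inversions (act (rev (zs @ [x]))) \<subseteq> insert (act zs (simple_root x)) (inversions (act (rev zs)))"
  proof
    fix v assume "v \<in> inversions (act (rev (zs @ [x])))"
    then have v: "real_root v" "nonneg_vec v" "\<not> nonneg_vec (refl_at x (act (rev zs) v))"
      by (auto simp: inversions_def)
    show "v \<in> insert (act zs (simple_root x)) (inversions (act (rev zs)))"
    proof (cases "nonneg_vec (act (rev zs) v)")
      case True
      have "act (rev zs) v = simple_root x"
        by (rule real_root_flip[OF real_root_act[OF v(1)] True v(3)])
      then have "v = act zs (simple_root x)" by (metis act_rev')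
      then show ?thesis by simp
    next
      case False
      then show ?thesis using v by (simp add: inversions_def)
    qed
  qed
  have fin: "finite (insert (act zs (simple_root x)) (inversions (act (rev zs))))" using snoc by simp
  have "card (inversions (act (rev (zs @ [x])))) \<le> card (insert (act zs (simple_root x)) (inversions (act (rev zs))))"
    by (rule card_mono[OF fin sub])
  also have "\<dots> \<le> Suc (length zs)" using snoc by (simp add: card_insert_if)
  finally show ?case using finite_subset[OF sub fin] by (simp only: length_append_singleton simp_thms)
qed

text \<open>If the root belonging to the new letter is positive, it is a new inversion. No old
  inversion \<open>v\<close> is lost: otherwise its negative image would be minus the simple root at
  \<open>x\<close>, and the root of the new letter would be \<open>- v\<close>.\<close>

lemma inversions_lower:
  assumes "\<And>j. j < length S \<Longrightarrow> nonneg_vec (act (take j S) (simple_root (S ! j)))"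
  shows "length S \<le> card (inversions (act (rev S)))"
  using assms
proof (induction S rule: rev_induct)
  case (snoc x zs)
  let ?b = "act zs (simple_root x)" and ?I = "inversions (act (rev zs))"
  have b: "nonneg_vec ?b" using snoc.prems[of "length zs"] by simp
  have le: "length zs \<le> card ?I"
  proof (rule snoc.IH)
    fix j assume "j < length zs"
    then show "nonneg_vec (act (take j zs) (simple_root (zs ! j)))"
      using snoc.prems[of j] by (simp add: nth_append)
  qed
  have nonneg_root: "nonneg_vec (simple_root x)" by (simp add: axis_nth_eq)
  have bI: "?b \<notin> ?I" using nonneg_root by (simp add: inversions_def)
  have "insert ?b ?I \<subseteq> inversions (act (rev (zs @ [x])))"
  proof
    fix v assume "v \<in> insert ?b ?I"
    then consider "v = ?b" | "v \<in> ?I" by blast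
    then show "v \<in> inversions (act (rev (zs @ [x])))"
    proof cases
      case 1
      have "\<not> nonneg_vec (- simple_root x)"
        using nonneg_antisym[OF nonneg_root] real_root_nonzero[OF real_root_simple[of x]] by blast
      then show ?thesis using 1 b real_root_act[OF real_root_simple, of zs x]
        by (simp add: inversions_def refl_simple_root)
    next
      case 2
      let ?w = "act (rev zs) v"
      have v: "real_root v" "nonneg_vec v" "\<not> nonneg_vec ?w" using 2 by (auto simp: inversions_def)
      have rw: "real_root ?w" by (rule real_root_act[OF v(1)])
      have nw: "nonneg_vec (- ?w)" using real_root_sign[OF rw] v(3) by blast
      have "\<not> nonneg_vec (refl_at x ?w)"
      proof
        assume p: "nonneg_vec (refl_at x ?w)"
        have n: "refl_at x (- ?w) = - refl_at x ?w" using act_neg[of "[x]"] by simp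
        have "refl_at x ?w \<noteq> 0" by (rule real_root_nonzero[OF real_root_refl[OF rw]])
        then have "\<not> nonneg_vec (refl_at x (- ?w))" unfolding n using nonneg_antisym[OF p] by blast
        from real_root_flip[OF real_root_neg[OF rw] nw this] have "- ?w = simple_root x" .
        then have "?b = act zs (- ?w)" by simp
        then have "?b = - v" unfolding act_neg by simp
        then have "nonneg_vec (- v)" using b by simp
        from nonneg_antisym[OF v(2) this] real_root_nonzero[OF v(1)] show False by blast
      qed
      then show ?thesis using v by (simp add: inversions_def)
    qed
  qed
  then have "card (insert ?b ?I) \<le> card (inversions (act (rev (zs @ [x]))))"
    using inversions_upper by (intro card_mono) blast+
  moreover have "card (insert ?b ?I) = Suc (card ?I)" using inversions_upper[of zs] bI by simp
  ultimately have "Suc (length zs) \<le> card (inversions (act (rev (zs @ [x]))))" using le by linarith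
  then show ?case by (simp only: length_append_singleton)
qed simp

text \<open>The set of inversions depends only on the group element, so its size bounds the length
  of every other word for that element from below.\<close>

lemma reduced_wordI:
  assumes "\<And>j. j < length S \<Longrightarrow> nonneg_vec (act (take j S) (simple_root (S ! j)))"
  shows "reduced_word ends S"
proof -
  have "length S \<le> length ys" if "weyl_word ends S = weyl_word ends ys" for ys
    using inversions_lower[OF assms] inversions_upper[of ys] that by (simp add: weyl_word_eq)
  then show ?thesis unfolding reduced_word_def weyl_length_def
    by (intro Least_equality) auto
qed

lemma admissible_roots:
  assumes lo: "loopless ends" and d: "subharmonic ends d" "\<And>v. 0 < d v"
    and "orientation ends \<Lambda>" "plus_admissible \<Lambda> S" "j < length S"
  shows "nonneg_vec (act (take j S) (simple_root (S ! j))) \<and>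
    defect \<Lambda> d (($) (act (take j S) (simple_root (S ! j)))) < 0"
  using assms(4-)
proof (induction S arbitrary: \<Lambda> j)
  case (Cons x S)
  have o: "orientation ends \<Lambda>" and x: "sink \<Lambda> x" and S: "plus_admissible (reverse_at x \<Lambda>) S"
    using Cons.prems by auto
  have unit: "($) (simple_root x) = unit_at x" by (auto simp: unit_at_def axis_nth_eq)
  show ?case
  proof (cases j)
    case 0
    \<comment> \<open>The first root is simple at a sink, and its defect is at most
      \<open>- d x\<close>.\<close>
    have "2 * d x \<le> neighbour_sum ends d x" using d(1) by (simp add: subharmonic_def)
    then show ?thesis using d(2)[of x] defect_unit_sink[OF lo o x, of d] 0
      by (simp add: unit unit_at_def)
  next
    case (Suc k)
    let ?g = "act (take k S) (simple_root (S ! k))"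
    let ?b = "refl_at x ?g"
    have g: "nonneg_vec ?g" "defect (reverse_at x \<Lambda>) d (($) ?g) < 0"
      using Cons.IH[OF orientation_reverse_at[OF o] S, of k] Cons.prems(3) Suc by auto
    have rg: "real_root ?g" by (rule real_root_act[OF real_root_simple])
    have "?g \<noteq> simple_root x"
      using g(2) defect_unit_source[OF lo o x, of d] d(2)[of x] unit by auto
    then have b: "nonneg_vec ?b" using real_root_flip[OF rg g(1)] by blast
    \<comment> \<open>Monotonicity is read backwards: \<open>?g\<close> is the simple reflection of
      \<open>?b\<close> at the sink \<open>x\<close>, so the defect of \<open>?b\<close> is bounded
      above by the negative defect of \<open>?g\<close>.\<close>
    have "($) ?g = (($) ?b)(x := neighbour_sum ends (($) ?b) x - ?b $ x)"
      using simple_reflection_nth[of ends x ?b] by (auto simp: fun_eq_iff)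
    then have "defect \<Lambda> d (($) ?b) \<le> defect (reverse_at x \<Lambda>) d (($) ?g)"
      using defect_reverse_mono[OF lo o x d(1), of "($) ?b"] b by simp
    then show ?thesis using b g(2) Suc by simp
  qed
qed simp

end

section \<open>Linear algebra in the ambient space\<close>

interpretation amb: vector_space "scl :: 'k::field \<Rightarrow> ('e, 'k) ambient \<Rightarrow> _"
  by (rule vector_space_scl)

interpretation amb_pair: vector_space_pair "scl :: 'k::field \<Rightarrow> ('e, 'k) ambient \<Rightarrow> _"
    "scl :: 'k::field \<Rightarrow> ('e, 'k) ambient \<Rightarrow> _"
  by (rule vector_space_pair.intro; rule vector_space_scl)

abbreviation amb_linear :: "(('e, 'k::field) ambient \<Rightarrow> ('e, 'k) ambient) \<Rightarrow> bool" where
  "amb_linear \<equiv> Vector_Spaces.linear scl scl"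

declare plus_fun_apply [simp del] zero_fun_apply [simp del]

text \<open>The ambient space is infinite-dimensional, so a finite spanning set has to be carried
  along before dimensions can be compared.\<close>

definition fin_dim :: "('e, 'k::field) ambient set \<Rightarrow> bool" where
  "fin_dim U \<longleftrightarrow> amb.subspace U \<and> (\<exists>B. finite B \<and> amb.span B = U)"

lemma quiver_rep_iff:
  "quiver_rep \<Lambda> M \<longleftrightarrow> (\<forall>x. fin_dim (vspace M x)) \<and>
     (\<forall>e. linear_between (vspace M (fst (\<Lambda> e))) (vspace M (snd (\<Lambda> e))) (arrow_map M e))"
  by (simp add: quiver_rep_def fin_dim_def)

lemma amb_linearI:
  assumes "\<And>u v. f (u + v) = f u + f v" "\<And>c u. f (scl c u) = scl c (f u)"
  shows "amb_linear f"
  using assms vector_space_scl by (intro Vector_Spaces.linear_iff[THEN iffD2] conjI allI)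

lemma amb_linear_add: "amb_linear f \<Longrightarrow> f (u + v) = f u + f v"
  by (rule amb_pair.linear_add)

lemma amb_linear_scl: "amb_linear f \<Longrightarrow> f (scl c u) = scl c (f u)"
  by (rule amb_pair.linear_scale)

lemma linear_between_linear: "amb_linear f \<Longrightarrow> f ` A \<subseteq> B \<Longrightarrow> linear_between A B f"
  unfolding linear_between_def using amb_linear_add amb_linear_scl by blast

lemma linear_between_0:
  assumes "amb.subspace A" "linear_between A B f"
  shows "f 0 = 0"
proof -
  have "f (0 + 0) = f 0 + f 0" using assms(2) amb.subspace_0[OF assms(1)] unfolding linear_between_def by blast
  then show ?thesis by (metis add.right_neutral add_left_cancel)
qed

lemma fin_dim_subset:
  assumes "amb.subspace U" "U \<subseteq> D" "fin_dim D"
  shows "fin_dim U" "amb.dim U \<le> amb.dim D"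
proof -
  obtain F where F: "finite F" "amb.span F = D" using assms(3) by (auto simp: fin_dim_def)
  obtain B where B: "B \<subseteq> U" "amb.independent B" "U \<subseteq> amb.span B" "card B = amb.dim U"
    by (rule amb.basis_exists)
  obtain C where C: "B \<subseteq> C" "C \<subseteq> D" "amb.independent C" "D \<subseteq> amb.span C"
    using amb.maximal_independent_subset_extend[of B D] B assms(2) by blast
  have "finite C" using amb.independent_span_bound[OF F(1) C(3)] C(2) F(2) by simp
  moreover have "amb.span B = U" using amb.span_subspace[OF B(1,3) assms(1)] .
  ultimately show "fin_dim U" unfolding fin_dim_def using assms(1) C(1) finite_subset by blast
  have "card C = amb.dim D" by (rule amb.basis_card_eq_dim[OF C(2,4,3)])
  then show "amb.dim U \<le> amb.dim D" using card_mono[OF \<open>finite C\<close> C(1)] B(4) by simp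
qed

lemma fin_dim_image: "amb_linear g \<Longrightarrow> fin_dim D \<Longrightarrow> fin_dim (g ` D)"
  unfolding fin_dim_def
  by (metis amb_pair.linear_span_image amb.subspace_span finite_imageI)

text \<open>Finiteness of \<open>D\<close> is a conclusion, drawn from the kernel and the image.
  This allows direct sums to be built up one summand at a time.\<close>

lemma rank_nullity:
  assumes g: "amb_linear g" and D: "amb.subspace D"
    and K: "fin_dim {w \<in> D. g w = 0}" and I: "fin_dim (g ` D)"
  shows "fin_dim D" "amb.dim D = amb.dim {w \<in> D. g w = 0} + amb.dim (g ` D)"
proof -
  let ?K = "{w \<in> D. g w = 0}"
  obtain BK where BK: "BK \<subseteq> ?K" "amb.independent BK" "?K \<subseteq> amb.span BK" "card BK = amb.dim ?K"
    by (rule amb.basis_exists)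
  obtain F where F: "finite F" "amb.span F = ?K" using K by (auto simp: fin_dim_def)
  have finBK: "finite BK" using amb.independent_span_bound[OF F(1) BK(2)] BK(1) F(2) by simp
  have "BK \<subseteq> D" using BK(1) by blast
  obtain B where B: "BK \<subseteq> B" "B \<subseteq> D" "amb.independent B" "D \<subseteq> amb.span B"
    using amb.maximal_independent_subset_extend[OF \<open>BK \<subseteq> D\<close> BK(2)] by blast
  let ?B = "B - BK"
  \<comment> \<open>\<open>\<pi>\<close> kills the kernel basis and fixes the remaining basis
    vectors. Comparing both actions shows that their span meets the kernel only in 0, so
    \<open>g\<close> is injective on it.\<close>
  obtain \<pi> where \<pi>: "amb_linear \<pi>" "\<And>b. b \<in> B \<Longrightarrow> \<pi> b = (if b \<in> BK then 0 else b)"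
    using amb_pair.linear_independent_extend[OF B(3), of "\<lambda>b. if b \<in> BK then 0 else b"] by blast
  have \<pi>0: "\<pi> v = 0" if "v \<in> amb.span BK" for v
  proof (rule amb_pair.linear_eq_0_on_span[OF \<pi>(1) _ that])
    show "\<pi> b = 0" if "b \<in> BK" for b using \<pi>(2)[of b] that B(1) by auto
  qed
  have \<pi>1: "\<pi> v = v" if "v \<in> amb.span ?B" for v
  proof (rule amb_pair.linear_eq_on[OF \<pi>(1) amb.linear_ident that])
    show "\<pi> b = b" if "b \<in> ?B" for b using \<pi>(2)[of b] that by simp
  qed
  have spB: "amb.span ?B \<subseteq> D" by (rule amb.span_minimal) (use B D in auto)
  have zero: "v = 0" if "v \<in> amb.span ?B" "g v = 0" for v
  proof -
    have "v \<in> ?K" using that spB by blast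
    then have "\<pi> v = 0" using \<pi>0 BK(3) by blast
    then show ?thesis using \<pi>1[OF that(1)] by simp
  qed
  have inj: "inj_on g (amb.span ?B)"
    using amb_pair.linear_inj_on_iff_eq_0[OF g amb.subspace_span] zero by blast
  have ind: "amb.independent (g ` ?B)"
    by (rule amb_pair.linear_independent_injective_image[OF g _ inj])
      (rule amb.independent_mono[OF B(3)], blast)
  obtain F' where F': "finite F'" "amb.span F' = g ` D" using I by (auto simp: fin_dim_def)
  have "finite (g ` ?B)"
    using amb.independent_span_bound[OF F'(1) ind] B(2) F'(2) by blast
  moreover have injB: "inj_on g ?B" using inj amb.span_superset inj_on_subset by blast
  ultimately have finB': "finite ?B" using finite_imageD by blast
  then have finB: "finite B" using finBK by simp
  have spanB: "amb.span B = D" by (rule amb.span_subspace[OF B(2,4) D])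
  then show "fin_dim D" using finB D unfolding fin_dim_def by blast
  have "g ` D \<subseteq> amb.span (g ` ?B)"
  proof -
    have "g ` D = amb.span (g ` B)" using amb_pair.linear_span_image[OF g, of B] spanB by simp
    moreover have "g ` B \<subseteq> insert 0 (g ` ?B)" using BK(1) by auto
    then have "amb.span (g ` B) \<subseteq> amb.span (insert 0 (g ` ?B))" by (rule amb.span_mono)
    ultimately show ?thesis by simp
  qed
  then have "card (g ` ?B) = amb.dim (g ` D)"
    using ind B(2) by (intro amb.basis_card_eq_dim) auto
  moreover have "card (g ` ?B) = card ?B" by (rule card_image[OF injB])
  moreover have "card B = card BK + card ?B"
    using finB B(1) card_Diff_subset[OF finBK B(1)] card_mono[OF finB B(1)] by simp
  moreover have "card B = amb.dim D" by (rule amb.basis_card_eq_dim[OF B(2,4,3)])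
  ultimately show "amb.dim D = amb.dim ?K + amb.dim (g ` D)" using BK(4) by simp
qed

text \<open>Arrow maps are constrained only on their source space. A globally linear extension makes
  rank and nullity applicable to them.\<close>

lemma linear_between_extend:
  assumes A: "amb.subspace A" and f: "linear_between A B f"
  shows "\<exists>g. amb_linear g \<and> (\<forall>a\<in>A. g a = f a)"
proof -
  obtain C where C: "C \<subseteq> A" "amb.independent C" "A \<subseteq> amb.span C" "card C = amb.dim A"
    by (rule amb.basis_exists)
  obtain g where g: "amb_linear g" "\<And>b. b \<in> C \<Longrightarrow> g b = f b"
    using amb_pair.linear_independent_extend[OF C(2), of f] by blast
  have "amb.subspace {a. a \<in> A \<and> g a = f a}"
  proof (intro amb.subspaceI; (elim CollectE conjE)?)
    show "0 \<in> {a. a \<in> A \<and> g a = f a}"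
      using amb.subspace_0[OF A] amb_pair.linear_0[OF g(1)] linear_between_0[OF A f] by simp
    fix u v c assume uv: "u \<in> A" "g u = f u"
    show "scl c u \<in> {a. a \<in> A \<and> g a = f a}"
      using uv f amb.subspace_scale[OF A uv(1)] amb_linear_scl[OF g(1)] by (simp add: linear_between_def)
    assume vv: "v \<in> A" "g v = f v"
    have "f (u + v) = f u + f v" using f uv(1) vv(1) unfolding linear_between_def by blast
    then show "u + v \<in> {a. a \<in> A \<and> g a = f a}"
      using uv(2) vv(2) amb.subspace_add[OF A uv(1) vv(1)] amb_linear_add[OF g(1), of u v] by simp
  qed
  then have "amb.span C \<subseteq> {a. a \<in> A \<and> g a = f a}"
    using C(1) g(2) by (intro amb.span_minimal) blast+
  then show ?thesis using g(1) C(3) by blast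
qed

lemma fin_dim_kernel:
  assumes D: "fin_dim D" and V: "fin_dim V" and f: "linear_between D V f"
  shows "fin_dim {w \<in> D. f w = 0}" "amb.dim D \<le> amb.dim {w \<in> D. f w = 0} + amb.dim V"
proof -
  have sD: "amb.subspace D" using D by (simp add: fin_dim_def)
  obtain g where g: "amb_linear g" "\<And>a. a \<in> D \<Longrightarrow> g a = f a"
    using linear_between_extend[OF sD f] by blast
  have K: "{w \<in> D. f w = 0} = {w \<in> D. g w = 0}" using g(2) by auto
  have img: "g ` D \<subseteq> V" using f g(2) by (auto simp: linear_between_def)
  have "amb.subspace {w \<in> D. g w = 0}"
    using amb.subspace_inter[OF sD amb_pair.linear_subspace_kernel[OF g(1)]]
    by (simp add: Int_def)
  then show fK: "fin_dim {w \<in> D. f w = 0}" unfolding K by (rule fin_dim_subset) (use D in auto)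
  have fI: "fin_dim (g ` D)" by (rule fin_dim_image[OF g(1) D])
  have "amb.dim (g ` D) \<le> amb.dim V"
    using fI by (intro fin_dim_subset(2)[OF _ img V]) (simp add: fin_dim_def)
  then show "amb.dim D \<le> amb.dim {w \<in> D. f w = 0} + amb.dim V"
    using rank_nullity(2)[OF g(1) sD fK[unfolded K] fI] K by simp
qed

section \<open>Components of vectors in direct sums\<close>

definition assemble :: "'e set \<Rightarrow> ('e \<Rightarrow> ('e, 'k::field) ambient) \<Rightarrow> ('e, 'k) ambient" where
  "assemble I u = (\<lambda>l. case l of [] \<Rightarrow> 0 | e # l' \<Rightarrow> if e \<in> I then u e l' else 0)"

lemma coord_assemble: "coord e (assemble I u) = (if e \<in> I then u e else 0)"
  by (simp add: coord_def assemble_def fun_eq_iff zero_fun_apply)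

lemma coord_add: "coord e (u + v) = coord e u + coord e v"
  by (simp add: coord_def fun_eq_iff plus_fun_apply zero_fun_apply)

lemma coord_scl: "coord e (scl c u) = scl c (coord e u)"
  by (simp add: coord_def scl_def)

lemma coord_0 [simp]: "coord e 0 = 0"
  by (simp add: coord_def fun_eq_iff plus_fun_apply zero_fun_apply)

lemma coord_linear: "amb_linear (coord e)"
  by (intro amb_linearI coord_add coord_scl)

lemma coord_sum: "coord e (\<Sum>i\<in>A. u i) = (\<Sum>i\<in>A. coord e (u i))"
  by (induction A rule: infinite_finite_induct) (simp_all add: coord_add)

lemma assemble_in: "assemble I u \<in> direct_sum I W \<longleftrightarrow> (\<forall>e\<in>I. u e \<in> W e)"
  unfolding direct_sum_def by (auto simp: coord_assemble) (auto simp: assemble_def)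

lemma assemble_cong: "(\<And>e. e \<in> I \<Longrightarrow> u e = v e) \<Longrightarrow> assemble I u = assemble I v"
  by (auto simp: assemble_def fun_eq_iff split: list.splits)

lemma assemble_add: "assemble I (\<lambda>e. u e + v e) = assemble I u + assemble I v"
  by (auto simp: assemble_def fun_eq_iff plus_fun_apply zero_fun_apply split: list.splits)

lemma assemble_scl: "assemble I (\<lambda>e. scl c (u e)) = scl c (assemble I u)"
  by (auto simp: assemble_def fun_eq_iff plus_fun_apply zero_fun_apply scl_def split: list.splits)

lemma direct_sum_eqI:
  assumes "v \<in> direct_sum I W" "w \<in> direct_sum I W'" "\<And>e. e \<in> I \<Longrightarrow> coord e v = coord e w"
  shows "v = w"
proof
  fix l
  show "v l = w l"
  proof (cases l)
    case Nil
    then show ?thesis using assms by (simp add: direct_sum_def)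
  next
    case (Cons e l')
    have "coord e v = coord e w" using assms by (cases "e \<in> I") (auto simp: direct_sum_def)
    then show ?thesis unfolding Cons coord_def by (rule fun_cong)
  qed
qed

lemma direct_sum_subspace:
  assumes "\<And>e. e \<in> I \<Longrightarrow> amb.subspace (W e)"
  shows "amb.subspace (direct_sum I W)"
  using assms
  by (intro amb.subspaceI)
    (auto simp: direct_sum_def coord_add coord_scl zero_fun_apply amb.subspace_0 amb.subspace_add amb.subspace_scale,
     auto simp: scl_def plus_fun_apply zero_fun_apply)

lemma direct_sum_sum:
  assumes "finite I" "w \<in> direct_sum I W"
  shows "(\<Sum>e\<in>I. assemble {e} (\<lambda>_. coord e w)) = w"
\<comment> \<open>For the left-hand side a direct sum of copies of the whole space is chosen, which
  makes membership in the summands trivial.\<close>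
proof (rule direct_sum_eqI[of _ I "\<lambda>_. UNIV" _ W])
  have "coord f (\<Sum>e\<in>I. assemble {e} (\<lambda>_. coord e w)) = (\<Sum>e\<in>I. if e = f then coord e w else 0)" for f
    unfolding coord_sum coord_assemble by (intro sum.cong) auto
  then have c: "coord f (\<Sum>e\<in>I. assemble {e} (\<lambda>_. coord e w)) = (if f \<in> I then coord f w else 0)" for f
    using assms(1) by simp
  have nil: "(\<Sum>e\<in>J. assemble {e} (\<lambda>_. coord e w)) [] = 0" for J
  proof -
    have "assemble {e} u [] = 0" for e u by (simp add: assemble_def)
    note this [simp] and plus_fun_apply [simp] and zero_fun_apply [simp]
    show ?thesis by (induction J rule: infinite_finite_induct) simp_all
  qed
  show "(\<Sum>e\<in>I. assemble {e} (\<lambda>_. coord e w)) \<in> direct_sum I (\<lambda>_. UNIV)"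
    using c nil by (auto simp: direct_sum_def)
  show "coord f (\<Sum>e\<in>I. assemble {e} (\<lambda>_. coord e w)) = coord f w" if "f \<in> I" for f
    using c that by simp
qed (rule assms(2))

text \<open>The projection \<open>coord e\<close> has image \<open>W e\<close>, and its kernel is
  the direct sum over the remaining edges.\<close>

lemma direct_sum_fin_dim:
  assumes "finite I" "\<And>e. e \<in> I \<Longrightarrow> fin_dim (W e)"
  shows "fin_dim (direct_sum I W) \<and> amb.dim (direct_sum I W) = (\<Sum>e\<in>I. amb.dim (W e))"
  using assms
proof (induction I rule: finite_induct)
  case empty
  have "direct_sum {} W = {0}"
  proof (intro equalityI subsetI)
    fix w assume w: "w \<in> direct_sum {} W"
    have "w = 0" by (rule direct_sum_eqI[OF w, of _ W]) (auto simp: direct_sum_def zero_fun_apply)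
    then show "w \<in> {0}" by simp
  qed (auto simp: direct_sum_def zero_fun_apply)
  moreover have "amb.dim {0} = card {}" by (rule amb.dim_unique) (auto simp: amb.independent_empty)
  moreover have "fin_dim {0}" unfolding fin_dim_def by (auto intro!: exI[of _ "{}"])
  ultimately show ?case by simp
next
  case (insert e I)
  let ?D = "direct_sum (insert e I) W"
  have s: "amb.subspace (W f)" if "f \<in> insert e I" for f using insert.prems that by (simp add: fin_dim_def)
  have K: "{w \<in> ?D. coord e w = 0} = direct_sum I W"
    using amb.subspace_0[OF s[of e]] insert.hyps(2) by (auto simp: direct_sum_def)
  have I: "coord e ` ?D = W e"
  proof (intro equalityI subsetI)
    fix u assume u: "u \<in> W e"
    have "assemble (insert e I) (\<lambda>f. if f = e then u else 0) \<in> ?D"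
      using u amb.subspace_0[OF s] by (auto simp: assemble_in)
    then show "u \<in> coord e ` ?D" by (rule rev_image_eqI) (simp add: coord_assemble)
  qed (auto simp: direct_sum_def)
  have IH: "fin_dim (direct_sum I W)" "amb.dim (direct_sum I W) = (\<Sum>e\<in>I. amb.dim (W e))"
    using insert by auto
  have We: "fin_dim (W e)" using insert.prems by simp
  note rn = rank_nullity[OF coord_linear direct_sum_subspace, of "insert e I" W e, unfolded K I]
  show ?case using rn[OF s IH(1) We] IH(2) insert.hyps by simp
qed

section \<open>Reflections of representations\<close>

abbreviation incoming :: "('v, 'e) orient \<Rightarrow> 'v \<Rightarrow> 'e set" where
  "incoming \<Lambda> x \<equiv> {e. snd (\<Lambda> e) = x}"

lemma vspace_reflect:
  "vspace (reflect \<Lambda> x M) z = (if z = x then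
     {w \<in> direct_sum (incoming \<Lambda> x) (\<lambda>e. vspace M (fst (\<Lambda> e))).
       (\<Sum>e\<in>incoming \<Lambda> x. arrow_map M e (coord e w)) = 0} else vspace M z)"
  by (simp add: reflect_def Let_def)

lemma arrow_map_reflect:
  "arrow_map (reflect \<Lambda> x M) e = (if snd (\<Lambda> e) = x then coord e else arrow_map M e)"
  by (simp add: reflect_def Let_def)

lemma quiver_rep_subspace: "quiver_rep \<Lambda> M \<Longrightarrow> amb.subspace (vspace M x)"
  by (simp add: quiver_rep_def)

lemma quiver_rep_arrow:
  "quiver_rep \<Lambda> M \<Longrightarrow> fst (\<Lambda> e) = a \<Longrightarrow> snd (\<Lambda> e) = b \<Longrightarrow>
    linear_between (vspace M a) (vspace M b) (arrow_map M e)"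
  by (auto simp: quiver_rep_def)

lemma linear_between_in: "linear_between A B f \<Longrightarrow> a \<in> A \<Longrightarrow> f a \<in> B"
  by (auto simp: linear_between_def)

lemma linear_between_add: "linear_between A B f \<Longrightarrow> a \<in> A \<Longrightarrow> b \<in> A \<Longrightarrow> f (a + b) = f a + f b"
  unfolding linear_between_def by blast

lemma linear_between_scl: "linear_between A B f \<Longrightarrow> a \<in> A \<Longrightarrow> f (scl c a) = scl c (f a)"
  unfolding linear_between_def by blast

lemma linear_betweenI:
  assumes "\<And>a. a \<in> A \<Longrightarrow> f a \<in> B" "\<And>a b. a \<in> A \<Longrightarrow> b \<in> A \<Longrightarrow> f (a + b) = f a + f b"
    "\<And>c a. a \<in> A \<Longrightarrow> f (scl c a) = scl c (f a)"
  shows "linear_between A B f"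
  unfolding linear_between_def using assms by blast

lemma linear_between_sum:
  assumes "amb.subspace A" "linear_between A B f" "\<And>i. i \<in> J \<Longrightarrow> u i \<in> A"
  shows "f (\<Sum>i\<in>J. u i) = (\<Sum>i\<in>J. f (u i))"
  using assms(3)
proof (induction J rule: infinite_finite_induct)
  case (insert j J)
  have "(\<Sum>i\<in>J. u i) \<in> A" using insert.prems by (intro amb.subspace_sum[OF assms(1)]) auto
  then have "f (u j + (\<Sum>i\<in>J. u i)) = f (u j) + f (\<Sum>i\<in>J. u i)"
    using insert.prems by (intro linear_between_add[OF assms(2)]) auto
  then show ?case using insert by simp
qed (simp_all add: linear_between_0[OF assms(1,2)])

lemma coord_direct_sum: "w \<in> direct_sum I W \<Longrightarrow> e \<in> I \<Longrightarrow> coord e w \<in> W e"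
  by (simp add: direct_sum_def)

lemma incoming_linear:
  assumes M: "quiver_rep \<Lambda> M"
  shows "linear_between (direct_sum (incoming \<Lambda> x) (\<lambda>e. vspace M (fst (\<Lambda> e)))) (vspace M x)
    (\<lambda>w. \<Sum>e\<in>incoming \<Lambda> x. arrow_map M e (coord e w))"
proof (rule linear_betweenI)
  let ?D = "direct_sum (incoming \<Lambda> x) (\<lambda>e. vspace M (fst (\<Lambda> e)))"
  have lin: "linear_between (vspace M (fst (\<Lambda> e))) (vspace M x) (arrow_map M e)" if "e \<in> incoming \<Lambda> x" for e
    using quiver_rep_arrow[OF M] that by blast
  fix w assume w: "w \<in> ?D"
  note cw = coord_direct_sum[OF w]
  show "(\<Sum>e\<in>incoming \<Lambda> x. arrow_map M e (coord e w)) \<in> vspace M x"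
    by (rule amb.subspace_sum[OF quiver_rep_subspace[OF M]])
      (rule linear_between_in[OF lin cw])
  show "(\<Sum>e\<in>incoming \<Lambda> x. arrow_map M e (coord e (scl c w)))
      = scl c (\<Sum>e\<in>incoming \<Lambda> x. arrow_map M e (coord e w))" for c
    unfolding amb.scale_sum_right
    by (intro sum.cong[OF refl]) (simp add: coord_scl linear_between_scl[OF lin cw])
  fix v assume v: "v \<in> ?D"
  note cv = coord_direct_sum[OF v]
  show "(\<Sum>e\<in>incoming \<Lambda> x. arrow_map M e (coord e (w + v)))
      = (\<Sum>e\<in>incoming \<Lambda> x. arrow_map M e (coord e w)) + (\<Sum>e\<in>incoming \<Lambda> x. arrow_map M e (coord e v))"
    unfolding sum.distrib[symmetric]
    by (intro sum.cong[OF refl]) (simp add: coord_add linear_between_add[OF lin cw cv])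
qed

lemma direct_sum_incoming_fin_dim:
  fixes M :: "('v, 'e::finite, 'k::field) rep"
  assumes "quiver_rep \<Lambda> M"
  shows "fin_dim (direct_sum (incoming \<Lambda> x) (\<lambda>e. vspace M (fst (\<Lambda> e))))"
    "amb.dim (direct_sum (incoming \<Lambda> x) (\<lambda>e. vspace M (fst (\<Lambda> e)))) = (\<Sum>e\<in>incoming \<Lambda> x. amb.dim (vspace M (fst (\<Lambda> e))))"
  using direct_sum_fin_dim[of "incoming \<Lambda> x" "\<lambda>e. vspace M (fst (\<Lambda> e))"] assms
  by (simp_all add: quiver_rep_iff)

section \<open>Dimension vectors and embeddings under reflection\<close>

definition dim_vec :: "('v, 'e, 'k::field) rep \<Rightarrow> 'v \<Rightarrow> int" where
  "dim_vec M x = int (amb.dim (vspace M x))"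

text \<open>A monomorphism of representations; \<open>\<phi> x\<close> is constrained only on the
  space of \<open>N\<close> at \<open>x\<close>.\<close>

definition embeds :: "('v, 'e) orient \<Rightarrow> ('v, 'e, 'k::field) rep \<Rightarrow> ('v, 'e, 'k) rep \<Rightarrow> bool" where
  "embeds \<Lambda> N M \<longleftrightarrow> (\<exists>\<phi>. (\<forall>x. linear_between (vspace N x) (vspace M x) (\<phi> x) \<and> inj_on (\<phi> x) (vspace N x)) \<and>
     (\<forall>e. \<forall>v\<in>vspace N (fst (\<Lambda> e)). \<phi> (snd (\<Lambda> e)) (arrow_map N e v) = arrow_map M e (\<phi> (fst (\<Lambda> e)) v)))"

context
  fixes ends :: "'e::finite \<Rightarrow> 'v::finite set"
  assumes loopless: "loopless ends"
begin

lemma quiver_rep_reflect: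
  fixes M :: "('v, 'e, 'k::field) rep"
  assumes o: "orientation ends \<Lambda>" and x: "sink \<Lambda> x" and M: "quiver_rep \<Lambda> M"
  shows "quiver_rep (reverse_at x \<Lambda>) (reflect \<Lambda> x M)"
  unfolding quiver_rep_iff
proof (intro conjI allI)
  fix z
  have "fin_dim (vspace M z)" "fin_dim (vspace M x)" using M by (simp_all add: quiver_rep_iff)
  then show "fin_dim (vspace (reflect \<Lambda> x M) z)"
    using fin_dim_kernel(1)[OF direct_sum_incoming_fin_dim(1)[OF M] _ incoming_linear[OF M]]
    by (simp add: vspace_reflect)
next
  fix e
  have x': "fst (\<Lambda> e) \<noteq> x" using x by (simp add: sink_def)
  show "linear_between (vspace (reflect \<Lambda> x M) (fst (reverse_at x \<Lambda> e)))
      (vspace (reflect \<Lambda> x M) (snd (reverse_at x \<Lambda> e))) (arrow_map (reflect \<Lambda> x M) e)"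
  proof (cases "snd (\<Lambda> e) = x")
    case True
    then show ?thesis using x'
      by (auto simp: reverse_at_sink[OF loopless o x] vspace_reflect arrow_map_reflect
          intro!: linear_between_linear[OF coord_linear] coord_direct_sum)
  next
    case False
    then show ?thesis using x' quiver_rep_arrow[OF M refl refl, of e]
      by (simp add: reverse_at_sink[OF loopless o x] vspace_reflect arrow_map_reflect)
  qed
qed

text \<open>The map into the space at \<open>x\<close> need not be surjective, so the kernel may be
  larger than the simple reflection predicts. Excess dimension only raises the defect, as
  \<open>d\<close> is nonnegative.\<close>

lemma defect_reflect:
  fixes M :: "('v, 'e, 'k::field) rep"
  assumes o: "orientation ends \<Lambda>" and x: "sink \<Lambda> x" and M: "quiver_rep \<Lambda> M"
    and d: "subharmonic ends d"
  shows "defect \<Lambda> d (dim_vec M) \<le> defect (reverse_at x \<Lambda>) d (dim_vec (reflect \<Lambda> x M))"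
proof -
  let ?n = "dim_vec (reflect \<Lambda> x M) x"
  have eq: "dim_vec (reflect \<Lambda> x M) = (dim_vec M)(x := ?n)"
    by (auto simp: dim_vec_def vspace_reflect)
  have Mx: "fin_dim (vspace M x)" using M by (simp add: quiver_rep_iff)
  have "neighbour_sum ends (dim_vec M) x = (\<Sum>e\<in>incoming \<Lambda> x. dim_vec M (fst (\<Lambda> e)))"
    by (rule neighbour_sum_sink[OF loopless o x, symmetric])
  also have "\<dots> = int (amb.dim (direct_sum (incoming \<Lambda> x) (\<lambda>e. vspace M (fst (\<Lambda> e)))))"
    unfolding direct_sum_incoming_fin_dim(2)[OF M] by (simp add: dim_vec_def)
  also have "\<dots> \<le> ?n + dim_vec M x"
    using fin_dim_kernel(2)[OF direct_sum_incoming_fin_dim(1)[OF M] Mx incoming_linear[OF M]]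
    by (simp add: dim_vec_def vspace_reflect)
  finally have "neighbour_sum ends (dim_vec M) x - dim_vec M x \<le> ?n" by simp
  moreover have "0 \<le> dim_vec M x" by (simp add: dim_vec_def)
  ultimately show ?thesis
    by (subst eq) (intro defect_reverse_mono[OF loopless o x d])
qed

text \<open>Positive defect persists along the sequence, whereas the zero representation has defect
  0.\<close>

lemma not_annihilated_if_defect_pos:
  fixes M :: "('v, 'e, 'k::field) rep"
  assumes d: "subharmonic ends d"
    and "orientation ends \<Lambda>" "plus_admissible \<Lambda> S" "quiver_rep \<Lambda> M" "0 < defect \<Lambda> d (dim_vec M)"
  shows "\<not> annihilates \<Lambda> S M"
  using assms(2-)
proof (induction S arbitrary: \<Lambda> M)
  case Nil
  have "amb.dim {0} = card {}" by (rule amb.dim_unique) (auto simp: amb.independent_empty)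
  then have dim0: "amb.dim {0} = 0" by simp
  show ?case
  proof
    assume "annihilates \<Lambda> [] M"
    then have "dim_vec M = (\<lambda>_. 0)" using dim0 by (auto simp: annihilates_def dim_vec_def)
    then have "defect \<Lambda> d (dim_vec M) = 0" by (simp add: defect_def)
    then show False using Nil by simp
  qed
next
  case (Cons x S)
  have x: "sink \<Lambda> x" and S: "plus_admissible (reverse_at x \<Lambda>) S" using Cons.prems(2) by auto
  have "0 < defect (reverse_at x \<Lambda>) d (dim_vec (reflect \<Lambda> x M))"
    using defect_reflect[OF Cons.prems(1) x Cons.prems(3) d] Cons.prems(4) by simp
  from Cons.IH[OF orientation_reverse_at[OF Cons.prems(1)] S quiver_rep_reflect[OF Cons.prems(1) x Cons.prems(3)] this]
  show ?case by (simp add: annihilates_def)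
qed

text \<open>Left exactness of kernels: applying \<open>\<phi>\<close> to each component maps the one
  kernel into the other, and this is injective because every component is.\<close>

lemma embeds_reflect:
  fixes M :: "('v, 'e, 'k::field) rep"
  assumes o: "orientation ends \<Lambda>" and x: "sink \<Lambda> x" and N: "quiver_rep \<Lambda> N"
    and NM: "embeds \<Lambda> N M"
  shows "embeds (reverse_at x \<Lambda>) (reflect \<Lambda> x N) (reflect \<Lambda> x M)"
proof -
  obtain \<phi> where lin: "\<And>z. linear_between (vspace N z) (vspace M z) (\<phi> z)"
    and inj: "\<And>z. inj_on (\<phi> z) (vspace N z)"
    and comm: "\<And>e v. v \<in> vspace N (fst (\<Lambda> e)) \<Longrightarrow> \<phi> (snd (\<Lambda> e)) (arrow_map N e v) = arrow_map M e (\<phi> (fst (\<Lambda> e)) v)"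
    using NM unfolding embeds_def by blast
  let ?I = "incoming \<Lambda> x"
  let ?f = "\<lambda>w. assemble ?I (\<lambda>e. \<phi> (fst (\<Lambda> e)) (coord e w))"
  define \<psi> where "\<psi> z = (if z = x then ?f else \<phi> z)" for z
  have x': "fst (\<Lambda> e) \<noteq> x" for e using x by (simp add: sink_def)
  let ?K = "vspace (reflect \<Lambda> x N) x"
  have K: "w \<in> direct_sum ?I (\<lambda>e. vspace N (fst (\<Lambda> e)))" "(\<Sum>e\<in>?I. arrow_map N e (coord e w)) = 0"
    if "w \<in> ?K" for w using that by (auto simp: vspace_reflect)
  have cK: "coord e w \<in> vspace N (fst (\<Lambda> e))" if "w \<in> ?K" "e \<in> ?I" for e w
    using coord_direct_sum[OF K(1)[OF that(1)] that(2)] .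
  have fK: "?f w \<in> vspace (reflect \<Lambda> x M) x" if w: "w \<in> ?K" for w
  proof -
    have "(\<Sum>e\<in>?I. arrow_map M e (coord e (?f w))) = (\<Sum>e\<in>?I. \<phi> x (arrow_map N e (coord e w)))"
    proof (rule sum.cong[OF refl])
      fix e assume e: "e \<in> ?I"
      show "arrow_map M e (coord e (?f w)) = \<phi> x (arrow_map N e (coord e w))"
        using comm[OF cK[OF w e]] e by (simp add: coord_assemble)
    qed
    also have "\<dots> = \<phi> x (\<Sum>e\<in>?I. arrow_map N e (coord e w))"
    proof (rule linear_between_sum[OF quiver_rep_subspace[OF N] lin, symmetric])
      fix e assume e: "e \<in> ?I"
      have "linear_between (vspace N (fst (\<Lambda> e))) (vspace N x) (arrow_map N e)"
        using quiver_rep_arrow[OF N refl, of e x] e by blast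
      from linear_between_in[OF this cK[OF w e]] show "arrow_map N e (coord e w) \<in> vspace N x" .
    qed
    also have "\<dots> = 0" unfolding K(2)[OF w] by (rule linear_between_0[OF quiver_rep_subspace[OF N] lin])
    finally have "(\<Sum>e\<in>?I. arrow_map M e (coord e (?f w))) = 0" .
    moreover have "?f w \<in> direct_sum ?I (\<lambda>e. vspace M (fst (\<Lambda> e)))"
      unfolding assemble_in using linear_between_in[OF lin cK[OF w]] by blast
    ultimately show ?thesis by (simp add: vspace_reflect)
  qed
  have fadd: "?f (v + w) = ?f v + ?f w" if v: "v \<in> ?K" and w: "w \<in> ?K" for v w
  proof -
    have "?f (v + w) = assemble ?I (\<lambda>e. \<phi> (fst (\<Lambda> e)) (coord e v) + \<phi> (fst (\<Lambda> e)) (coord e w))"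
      by (rule assemble_cong) (simp add: coord_add linear_between_add[OF lin cK[OF v] cK[OF w]])
    then show ?thesis by (simp only: assemble_add)
  qed
  have fscl: "?f (scl c v) = scl c (?f v)" if v: "v \<in> ?K" for v c
  proof -
    have "?f (scl c v) = assemble ?I (\<lambda>e. scl c (\<phi> (fst (\<Lambda> e)) (coord e v)))"
      by (rule assemble_cong) (simp add: coord_scl linear_between_scl[OF lin cK[OF v]])
    then show ?thesis by (simp only: assemble_scl)
  qed
  have finj: "inj_on ?f ?K"
  proof (rule inj_onI)
    fix v w assume v: "v \<in> ?K" and w: "w \<in> ?K" and eq: "?f v = ?f w"
    show "v = w"
    proof (rule direct_sum_eqI[OF K(1)[OF v] K(1)[OF w]])
      fix e assume e: "e \<in> ?I"
      have "coord e (?f v) = coord e (?f w)" using eq by simp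
      then have "\<phi> (fst (\<Lambda> e)) (coord e v) = \<phi> (fst (\<Lambda> e)) (coord e w)" using e by (simp add: coord_assemble)
      then show "coord e v = coord e w" using inj_onD[OF inj _ cK[OF v e] cK[OF w e]] by blast
    qed
  qed
  show ?thesis unfolding embeds_def
  proof (intro exI[of _ \<psi>] conjI allI ballI)
    fix z
    show "linear_between (vspace (reflect \<Lambda> x N) z) (vspace (reflect \<Lambda> x M) z) (\<psi> z)"
    proof (cases "z = x")
      case True
      have "\<psi> x = ?f" by (simp add: \<psi>_def)
      then show ?thesis unfolding True by (simp only:) (rule linear_betweenI[OF fK fadd fscl])
    next
      case False
      then show ?thesis using lin[of z] by (simp add: \<psi>_def vspace_reflect)
    qed
    show "inj_on (\<psi> z) (vspace (reflect \<Lambda> x N) z)"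
      using finj inj[of z] by (cases "z = x") (simp_all add: \<psi>_def vspace_reflect)
  next
    fix e v assume v: "v \<in> vspace (reflect \<Lambda> x N) (fst (reverse_at x \<Lambda> e))"
    show "\<psi> (snd (reverse_at x \<Lambda> e)) (arrow_map (reflect \<Lambda> x N) e v) =
      arrow_map (reflect \<Lambda> x M) e (\<psi> (fst (reverse_at x \<Lambda> e)) v)"
    proof (cases "snd (\<Lambda> e) = x")
      case True
      then show ?thesis using x'[of e]
        by (simp add: reverse_at_sink[OF loopless o x] arrow_map_reflect \<psi>_def coord_assemble)
    next
      case False
      then show ?thesis using x'[of e] comm[of v e] v
        by (simp add: reverse_at_sink[OF loopless o x] arrow_map_reflect \<psi>_def vspace_reflect)
    qed
  qed
qed

text \<open>Embeddings survive every reflection, and only zero embeds into zero.\<close>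

lemma embeds_annihilates:
  fixes M :: "('v, 'e, 'k::field) rep"
  assumes "orientation ends \<Lambda>" "plus_admissible \<Lambda> S" "quiver_rep \<Lambda> N" "embeds \<Lambda> N M" "annihilates \<Lambda> S M"
  shows "annihilates \<Lambda> S N"
  using assms
proof (induction S arbitrary: \<Lambda> N M)
  case Nil
  obtain \<phi> where lin: "\<And>z. linear_between (vspace N z) (vspace M z) (\<phi> z)"
    and inj: "\<And>z. inj_on (\<phi> z) (vspace N z)"
    using Nil.prems(4) unfolding embeds_def by blast
  have M0: "vspace M z = {0}" for z using Nil.prems(5) by (simp add: annihilates_def)
  have "vspace N z = {0}" for z
  proof -
    have 0: "0 \<in> vspace N z" by (rule amb.subspace_0[OF quiver_rep_subspace[OF Nil.prems(3)]])
    moreover have "v = 0" if "v \<in> vspace N z" for v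
      using inj_onD[OF inj _ that 0] linear_between_in[OF lin that] linear_between_in[OF lin 0] M0 by simp
    ultimately show ?thesis by blast
  qed
  then show ?case by (simp add: annihilates_def)
next
  case (Cons x S)
  have x: "sink \<Lambda> x" and S: "plus_admissible (reverse_at x \<Lambda>) S" using Cons.prems(2) by auto
  have "annihilates (reverse_at x \<Lambda>) S (reflect \<Lambda> x M)" using Cons.prems(5) by (simp add: annihilates_def)
  from Cons.IH[OF orientation_reverse_at[OF Cons.prems(1)] S quiver_rep_reflect[OF Cons.prems(1) x Cons.prems(3)]
      embeds_reflect[OF Cons.prems(1) x Cons.prems(3,4)] this]
  show ?case by (simp add: annihilates_def)
qed

end

section \<open>Preimages under a reflection; commuting reflections\<close>

lemma reverse_at_commute: "reverse_at x (reverse_at y \<Lambda>) = reverse_at y (reverse_at x \<Lambda>)"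
  by (auto simp: reverse_at_def fun_eq_iff)

lemma sinks_not_adj:
  assumes "orientation ends \<Lambda>" "sink \<Lambda> x" "sink \<Lambda> y"
  shows "\<not> adj ends x y"
proof
  assume "adj ends x y"
  then obtain e where "ends e = {x, y}" by (auto simp: adj_def)
  then have "{fst (\<Lambda> e), snd (\<Lambda> e)} = {x, y}" using assms(1) by (simp add: orientation_def)
  then have "fst (\<Lambda> e) = x \<or> fst (\<Lambda> e) = y" by blast
  then show False using assms(2,3) by (auto simp: sink_def)
qed

text \<open>A substitute for the quotient by \<open>U\<close> that stays inside the ambient space:
  subtract a linear projection onto \<open>U\<close>.\<close>

lemma projection_with_kernel:
  assumes "amb.subspace U"
  shows "\<exists>p. amb_linear p \<and> (\<forall>v. p v = 0 \<longleftrightarrow> v \<in> U)"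
proof -
  have "inj_on (\<lambda>v. v) U" by simp
  from amb_pair.linear_exists_left_inverse_on[OF amb.linear_ident assms this]
  obtain g where g: "g ` UNIV \<subseteq> U" "amb_linear g" "\<And>v. v \<in> U \<Longrightarrow> g v = v" by blast
  have "amb_linear (\<lambda>v. v - g v)"
    by (rule amb_linearI) (simp_all add: amb_linear_add[OF g(2)] amb_linear_scl[OF g(2)] amb.scale_right_diff_distrib)
  moreover have "v - g v = 0 \<longleftrightarrow> v \<in> U" for v
    using g(1,3) by (metis eq_iff_diff_eq_0 rangeI subsetD)
  ultimately show ?thesis by blast
qed

context
  fixes ends :: "'e::finite \<Rightarrow> 'v::finite set"
  assumes loopless: "loopless ends"
begin

text \<open>The hypothesis \<open>inj\<close> says that the combined outgoing map \<open>j\<close>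
  from \<open>x\<close> is injective. Placing its cokernel at the sink makes the image of
  \<open>j\<close>, a copy of the space of \<open>N\<close> at \<open>x\<close>, the kernel computed
  by the reflection.\<close>

lemma reflect_preimage:
  fixes N :: "('v, 'e, 'k::field) rep"
  assumes o: "orientation ends \<Lambda>" and x: "sink \<Lambda> x" and N: "quiver_rep (reverse_at x \<Lambda>) N"
    and inj: "\<And>v. v \<in> vspace N x \<Longrightarrow> (\<And>e. snd (\<Lambda> e) = x \<Longrightarrow> arrow_map N e v = 0) \<Longrightarrow> v = 0"
  shows "\<exists>M :: ('v, 'e, 'k) rep. quiver_rep \<Lambda> M \<and> vspace M x \<noteq> {0} \<and>
    embeds (reverse_at x \<Lambda>) N (reflect \<Lambda> x M) \<and> embeds (reverse_at x \<Lambda>) (reflect \<Lambda> x M) N"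
proof -
  note rev = reverse_at_sink[OF loopless o x]
  have x': "fst (\<Lambda> e) \<noteq> x" for e using x by (simp add: sink_def)
  let ?I = "incoming \<Lambda> x"
  let ?D = "direct_sum ?I (\<lambda>e. vspace N (fst (\<Lambda> e)))"
  define j where "j v = assemble ?I (\<lambda>e. arrow_map N e v)" for v
  note sub = quiver_rep_subspace[OF N]
  have out: "linear_between (vspace N x) (vspace N (fst (\<Lambda> e))) (arrow_map N e)" if "e \<in> ?I" for e
    using quiver_rep_arrow[OF N, of e x "fst (\<Lambda> e)"] that by (simp add: rev)
  have rest: "linear_between (vspace N (fst (\<Lambda> e))) (vspace N (snd (\<Lambda> e))) (arrow_map N e)" if "e \<notin> ?I" for e
    using quiver_rep_arrow[OF N, of e "fst (\<Lambda> e)" "snd (\<Lambda> e)"] that by (simp add: rev)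
  have fdN: "fin_dim (vspace N z)" for z using N by (simp add: quiver_rep_iff)
  have D: "fin_dim ?D" using direct_sum_fin_dim[of ?I "\<lambda>e. vspace N (fst (\<Lambda> e))"] fdN by simp
  have jlin: "linear_between (vspace N x) ?D j"
  proof (rule linear_betweenI)
    fix a assume a: "a \<in> vspace N x"
    show "j a \<in> ?D" unfolding j_def assemble_in using linear_between_in[OF out a] by blast
    show "j (scl c a) = scl c (j a)" for c
      unfolding j_def assemble_scl[symmetric]
      by (rule assemble_cong) (rule linear_between_scl[OF out a])
    fix b assume b: "b \<in> vspace N x"
    show "j (a + b) = j a + j b"
      unfolding j_def assemble_add[symmetric]
      by (rule assemble_cong) (rule linear_between_add[OF out a b])
  qed
  have coord_j: "coord e (j v) = arrow_map N e v" if "e \<in> ?I" for e v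
    using that by (simp add: j_def coord_assemble)
  have jinj: "inj_on j (vspace N x)"
  proof (rule inj_onI)
    fix a b assume a: "a \<in> vspace N x" and b: "b \<in> vspace N x" and eq: "j a = j b"
    have nb: "scl (-1) b \<in> vspace N x" by (rule amb.subspace_scale[OF sub b])
    have "a + scl (-1) b = 0"
    proof (rule inj[OF amb.subspace_add[OF sub a nb]])
      fix e assume "snd (\<Lambda> e) = x"
      then have e: "e \<in> ?I" by simp
      have "arrow_map N e a = arrow_map N e b" using coord_j[OF e] eq by metis
      then show "arrow_map N e (a + scl (-1) b) = 0"
        unfolding linear_between_add[OF out[OF e] a nb] linear_between_scl[OF out[OF e] b] by simp
    qed
    then show "a = b" by simp
  qed
  let ?U = "j ` vspace N x"
  have jU: "j a \<in> ?D" if "a \<in> vspace N x" for a using linear_between_in[OF jlin that] .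
  have U: "amb.subspace ?U"
  proof (rule amb.subspaceI)
    show "0 \<in> ?U" using linear_between_0[OF sub jlin] amb.subspace_0[OF sub] by (metis image_eqI)
    fix u assume "u \<in> ?U"
    then obtain a where a: "a \<in> vspace N x" "u = j a" by blast
    show "scl c u \<in> ?U" for c
      using linear_between_scl[OF jlin a(1)] amb.subspace_scale[OF sub a(1)] a(2) by (metis image_eqI)
    fix w assume "w \<in> ?U"
    then obtain b where b: "b \<in> vspace N x" "w = j b" by blast
    show "u + w \<in> ?U"
      using linear_between_add[OF jlin a(1) b(1)] amb.subspace_add[OF sub a(1) b(1)] a(2) b(2)
      by (metis image_eqI)
  qed
  obtain p where p: "amb_linear p" "\<And>v. p v = 0 \<longleftrightarrow> v \<in> ?U" using projection_with_kernel[OF U] by blast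
  obtain F where F: "finite F" "amb.span F = p ` ?D"
    using fin_dim_image[OF p(1) D] by (auto simp: fin_dim_def)
  (* Enlarging the space at x by w0 keeps it nonzero even if p vanishes on the direct sum. *)
  define w0 :: "('e, 'k) ambient" where "w0 = (\<lambda>_. 1)"
  have "w0 \<noteq> 0" by (simp add: w0_def fun_eq_iff zero_fun_apply)
  define X where "X = amb.span (insert w0 F)"
  have fdX: "fin_dim X" unfolding fin_dim_def X_def using F(1) by blast
  have pX: "p ` ?D \<subseteq> X" unfolding F(2)[symmetric] X_def by (rule amb.span_mono) blast
  have "w0 \<in> X" unfolding X_def by (rule amb.span_base) simp
  \<comment> \<open>Along an arrow \<open>e\<close> into \<open>x\<close>, a vector is placed in
    component \<open>e\<close> of the direct sum and then sent to the cokernel by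
    \<open>p\<close>.\<close>
  define M :: "('v, 'e, 'k) rep" where
    "M = \<lparr>vspace = (vspace N)(x := X),
      arrow_map = (\<lambda>e. if snd (\<Lambda> e) = x then (\<lambda>v. p (assemble {e} (\<lambda>_. v))) else arrow_map N e)\<rparr>"
  have vM: "vspace M z = (if z = x then X else vspace N z)" for z by (simp add: M_def)
  have aM: "arrow_map M e = (if snd (\<Lambda> e) = x then (\<lambda>v. p (assemble {e} (\<lambda>_. v))) else arrow_map N e)" for e
    by (simp add: M_def)
  have repM: "quiver_rep \<Lambda> M"
    unfolding quiver_rep_iff
  proof (intro conjI allI)
    show "fin_dim (vspace M z)" for z using fdX fdN by (simp add: vM)
    fix e
    show "linear_between (vspace M (fst (\<Lambda> e))) (vspace M (snd (\<Lambda> e))) (arrow_map M e)"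
    proof (cases "snd (\<Lambda> e) = x")
      case True
      have "assemble {e} (\<lambda>_. v) \<in> ?D" if "v \<in> vspace N (fst (\<Lambda> e))" for v
        using that True amb.subspace_0[OF sub]
        by (auto simp: direct_sum_def coord_assemble) (simp add: assemble_def)
      then have "p (assemble {e} (\<lambda>_. v)) \<in> X" if "v \<in> vspace N (fst (\<Lambda> e))" for v
        using that pX by blast
      moreover have "amb_linear (\<lambda>v. p (assemble {e} (\<lambda>_. v)))"
        by (rule amb_linearI) (simp_all add: assemble_add assemble_scl amb_linear_add[OF p(1)] amb_linear_scl[OF p(1)])
      ultimately have "linear_between (vspace N (fst (\<Lambda> e))) X (\<lambda>v. p (assemble {e} (\<lambda>_. v)))"
        by (intro linear_between_linear) auto
      then show ?thesis using True x'[of e] by (simp add: vM aM)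
    next
      case False
      then show ?thesis using rest[of e] x'[of e] by (simp add: vM aM)
    qed
  qed
  have VU: "vspace (reflect \<Lambda> x M) x = ?U"
  proof -
    have "direct_sum ?I (\<lambda>e. vspace M (fst (\<Lambda> e))) = ?D" by (simp add: vM x')
    moreover have "(\<Sum>e\<in>?I. arrow_map M e (coord e w)) = p w" if "w \<in> ?D" for w
    proof -
      have "(\<Sum>e\<in>?I. arrow_map M e (coord e w)) = (\<Sum>e\<in>?I. p (assemble {e} (\<lambda>_. coord e w)))"
        by (intro sum.cong) (simp_all add: aM)
      also have "\<dots> = p (\<Sum>e\<in>?I. assemble {e} (\<lambda>_. coord e w))"
        by (rule amb_pair.linear_sum[OF p(1), symmetric])
      also have "(\<Sum>e\<in>?I. assemble {e} (\<lambda>_. coord e w)) = w" by (rule direct_sum_sum[OF _ that]) simp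
      finally show ?thesis .
    qed
    ultimately have "vspace (reflect \<Lambda> x M) x = {w \<in> ?D. p w = 0}"
      by (auto simp: vspace_reflect)
    also have "\<dots> = ?U" using p(2) jU by blast
    finally show ?thesis .
  qed
  have Vz: "vspace (reflect \<Lambda> x M) z = vspace N z" if "z \<noteq> x" for z
    using that by (simp add: vspace_reflect vM)
  have Ae: "arrow_map (reflect \<Lambda> x M) e = (if snd (\<Lambda> e) = x then coord e else arrow_map N e)" for e
    by (simp add: arrow_map_reflect aM)
  have id_lin: "linear_between A A (\<lambda>v. v)" for A :: "('e, 'k) ambient set"
    by (simp add: linear_between_def)
  have 1: "embeds (reverse_at x \<Lambda>) N (reflect \<Lambda> x M)"
    unfolding embeds_def
  proof (intro exI[of _ "\<lambda>z. if z = x then j else (\<lambda>v. v)"] conjI allI ballI)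
    fix z
    have "linear_between (vspace N x) ?U j"
      using jlin by (simp add: linear_between_def)
    then show "linear_between (vspace N z) (vspace (reflect \<Lambda> x M) z) (if z = x then j else (\<lambda>v. v))"
      using VU Vz[of z] id_lin by (cases "z = x") simp_all
    show "inj_on (if z = x then j else (\<lambda>v. v)) (vspace N z)" using jinj by simp
  next
    fix e v assume v: "v \<in> vspace N (fst (reverse_at x \<Lambda> e))"
    show "(if snd (reverse_at x \<Lambda> e) = x then j else (\<lambda>v. v)) (arrow_map N e v) =
      arrow_map (reflect \<Lambda> x M) e ((if fst (reverse_at x \<Lambda> e) = x then j else (\<lambda>v. v)) v)"
      using x'[of e] coord_j[of e v] by (simp add: rev Ae)
  qed
  define k where "k = inv_into (vspace N x) j"
  have kj: "k (j a) = a" if "a \<in> vspace N x" for a unfolding k_def by (rule inv_into_f_f[OF jinj that])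
  have klin: "linear_between ?U (vspace N x) k"
  proof (rule linear_betweenI)
    fix u assume "u \<in> ?U"
    then obtain a where a: "a \<in> vspace N x" "u = j a" by blast
    show "k u \<in> vspace N x" using a kj by simp
    show "k (scl c u) = scl c (k u)" for c
      using kj[OF amb.subspace_scale[OF sub a(1)], of c] linear_between_scl[OF jlin a(1), of c] kj[OF a(1)] a(2) by simp
    fix w assume "w \<in> ?U"
    then obtain b where b: "b \<in> vspace N x" "w = j b" by blast
    show "k (u + w) = k u + k w"
      using kj[OF amb.subspace_add[OF sub a(1) b(1)]] linear_between_add[OF jlin a(1) b(1)] kj[OF a(1)] kj[OF b(1)]
        a(2) b(2) by simp
  qed
  have kinj: "inj_on k ?U" using kj by (auto intro!: inj_onI)
  have 2: "embeds (reverse_at x \<Lambda>) (reflect \<Lambda> x M) N"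
    unfolding embeds_def
  proof (intro exI[of _ "\<lambda>z. if z = x then k else (\<lambda>v. v)"] conjI allI ballI)
    fix z
    show "linear_between (vspace (reflect \<Lambda> x M) z) (vspace N z) (if z = x then k else (\<lambda>v. v))"
      using klin VU Vz[of z] id_lin by (cases "z = x") simp_all
    show "inj_on (if z = x then k else (\<lambda>v. v)) (vspace (reflect \<Lambda> x M) z)" using kinj VU by simp
  next
    fix e v assume v: "v \<in> vspace (reflect \<Lambda> x M) (fst (reverse_at x \<Lambda> e))"
    show "(if snd (reverse_at x \<Lambda> e) = x then k else (\<lambda>v. v)) (arrow_map (reflect \<Lambda> x M) e v) =
      arrow_map N e ((if fst (reverse_at x \<Lambda> e) = x then k else (\<lambda>v. v)) v)"
    proof (cases "snd (\<Lambda> e) = x")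
      case True
      then obtain a where a: "a \<in> vspace N x" "v = j a" using v VU by (auto simp: rev)
      have "coord e v = arrow_map N e (k v)" using coord_j[of e a] True a kj[OF a(1)] by simp
      then show ?thesis using True x'[of e] by (simp add: rev Ae)
    next
      case False
      then show ?thesis using x'[of e] by (simp add: rev Ae)
    qed
  qed
  have "vspace M x \<noteq> {0}" using \<open>w0 \<in> X\<close> \<open>w0 \<noteq> 0\<close> by (auto simp: vM)
  then show ?thesis using repM 1 2 by blast
qed

text \<open>A nonzero \<open>v\<close> killed by all outgoing arrows would span a copy of the simple
  representation at the source. Its positive defect prevents \<open>S\<close> from annihilating it,
  although \<open>S\<close> annihilates \<open>N\<close>.\<close>

lemma source_kernel_trivial:
  fixes N :: "('v, 'e, 'k::field) rep"
  assumes d: "subharmonic ends d" "0 < d x"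
    and o: "orientation ends \<Lambda>" and x: "sink \<Lambda> x" and N: "quiver_rep (reverse_at x \<Lambda>) N"
    and S: "plus_admissible (reverse_at x \<Lambda>) S" "annihilates (reverse_at x \<Lambda>) S N"
    and v: "v \<in> vspace N x" "\<And>e. snd (\<Lambda> e) = x \<Longrightarrow> arrow_map N e v = 0"
  shows "v = 0"
proof (rule ccontr)
  assume "v \<noteq> 0"
  note rev = reverse_at_sink[OF loopless o x]
  have x': "fst (\<Lambda> e) \<noteq> x" for e using x by (simp add: sink_def)
  note sub = quiver_rep_subspace[OF N]
  have out: "linear_between (vspace N x) (vspace N (fst (\<Lambda> e))) (arrow_map N e)" if "snd (\<Lambda> e) = x" for e
    using quiver_rep_arrow[OF N, of e x "fst (\<Lambda> e)"] that by (simp add: rev)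
  define L :: "('v, 'e, 'k) rep" where
    "L = \<lparr>vspace = (\<lambda>z. if z = x then amb.span {v} else {0}), arrow_map = (\<lambda>_ _. 0)\<rparr>"
  have fd0: "fin_dim {0 :: ('e, 'k) ambient}" unfolding fin_dim_def by (auto intro!: exI[of _ "{}"])
  have fdv: "fin_dim (amb.span {v})" unfolding fin_dim_def by blast
  have L: "quiver_rep (reverse_at x \<Lambda>) L"
    unfolding quiver_rep_iff
  proof (intro conjI allI)
    show "fin_dim (vspace L z)" for z using fd0 fdv by (simp add: L_def)
    show "linear_between (vspace L (fst (reverse_at x \<Lambda> e))) (vspace L (snd (reverse_at x \<Lambda> e))) (arrow_map L e)" for e
      by (rule linear_betweenI) (simp_all add: L_def amb.span_zero)
  qed
  have spanv: "amb.span {v} \<subseteq> vspace N x" by (rule amb.span_minimal) (use v(1) sub in simp_all)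
  have LN: "embeds (reverse_at x \<Lambda>) L N"
    unfolding embeds_def
  proof (intro exI[of _ "\<lambda>(_ :: 'v) (u :: ('e, 'k) ambient). u"] conjI allI ballI)
    fix z
    have "vspace L z \<subseteq> vspace N z" using spanv amb.subspace_0[OF sub] by (simp add: L_def)
    then show "linear_between (vspace L z) (vspace N z) (\<lambda>v. v)" by (simp add: linear_between_def)
    show "inj_on (\<lambda>v. v) (vspace L z)" by simp
  next
    fix e u assume u: "u \<in> vspace L (fst (reverse_at x \<Lambda> e))"
    show "arrow_map L e u = arrow_map N e u"
    proof (cases "snd (\<Lambda> e) = x")
      case True
      then have "u \<in> amb.span {v}" using u by (simp add: rev L_def)
      then obtain c where c: "u = scl c v" unfolding amb.span_singleton by blast
      have "arrow_map N e u = scl c (arrow_map N e v)" unfolding c by (rule linear_between_scl[OF out[OF True] v(1)])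
      then show ?thesis using v(2)[OF True] by (simp add: L_def)
    next
      case False
      then have "u = 0" using u x'[of e] by (simp add: rev L_def)
      then show ?thesis
        using linear_between_0[OF sub quiver_rep_arrow[OF N refl refl]] by (simp add: L_def)
    qed
  qed
  have "amb.independent {v}" using \<open>v \<noteq> 0\<close> by simp
  then have "amb.dim (amb.span {v}) = 1" by (simp add: amb.dim_span_eq_card_independent del: amb.dim_span)
  moreover have "amb.dim {0} = card {}" by (rule amb.dim_unique) (auto simp: amb.independent_empty)
  ultimately have "dim_vec L = unit_at x" by (auto simp: dim_vec_def unit_at_def L_def)
  then have "0 < defect (reverse_at x \<Lambda>) d (dim_vec L)"
    using defect_unit_source[OF loopless o x, of d] d(2) by simp
  from not_annihilated_if_defect_pos[OF loopless d(1) orientation_reverse_at[OF o] S(1) L this]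
    embeds_annihilates[OF loopless orientation_reverse_at[OF o] S(1) L LN S(2)]
  show False by blast
qed

lemma sink_reverse_at:
  assumes "orientation ends \<Lambda>" "sink \<Lambda> x" "sink \<Lambda> y" "x \<noteq> y"
  shows "sink (reverse_at y \<Lambda>) x"
  using assms(2-4) unfolding sink_def
  by (auto simp: reverse_at_sink[OF loopless assms(1,3)])

text \<open>The reflections use disjoint sets of arrows and change different spaces. As direct sums
  are indexed by edges, the results are literally equal, not merely isomorphic.\<close>

lemma reflect_commute:
  assumes o: "orientation ends \<Lambda>" and x: "sink \<Lambda> x" and y: "sink \<Lambda> y" and "x \<noteq> y"
  shows "reflect (reverse_at y \<Lambda>) x (reflect \<Lambda> y M) = reflect (reverse_at x \<Lambda>) y (reflect \<Lambda> x M)"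
proof -
  have inc: "incoming (reverse_at b \<Lambda>) a = incoming \<Lambda> a"
    "e \<in> incoming \<Lambda> a \<Longrightarrow> reverse_at b \<Lambda> e = \<Lambda> e"
    if "sink \<Lambda> a" "sink \<Lambda> b" "a \<noteq> b" for a b e
    using that by (auto simp: reverse_at_sink[OF loopless o that(2)] sink_def)
  have vs: "vspace (reflect (reverse_at b \<Lambda>) a (reflect \<Lambda> b M)) z =
      (if z = a then vspace (reflect \<Lambda> a M) a else if z = b then vspace (reflect \<Lambda> b M) b else vspace M z)"
    if ab: "sink \<Lambda> a" "sink \<Lambda> b" "a \<noteq> b" for a b z
  proof -
    have b: "fst (\<Lambda> e) \<noteq> b" for e using ab(2) by (simp add: sink_def)
    have "direct_sum (incoming \<Lambda> a) (\<lambda>e. vspace (reflect \<Lambda> b M) (fst (reverse_at b \<Lambda> e))) =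
        direct_sum (incoming \<Lambda> a) (\<lambda>e. vspace M (fst (\<Lambda> e)))"
      unfolding direct_sum_def using inc(2)[OF ab] b by (auto simp: vspace_reflect)
    moreover have "(\<Sum>e\<in>incoming \<Lambda> a. arrow_map (reflect \<Lambda> b M) e (coord e w)) =
        (\<Sum>e\<in>incoming \<Lambda> a. arrow_map M e (coord e w))" for w
      using ab(3) by (intro sum.cong) (auto simp: arrow_map_reflect)
    ultimately show ?thesis using ab(3) unfolding vspace_reflect[of _ a] inc(1)[OF ab]
      by (simp add: vspace_reflect[of \<Lambda> b])
  qed
  have am: "arrow_map (reflect (reverse_at b \<Lambda>) a (reflect \<Lambda> b M)) e =
      (if e \<in> incoming \<Lambda> a \<union> incoming \<Lambda> b then coord e else arrow_map M e)"
    if ab: "sink \<Lambda> a" "sink \<Lambda> b" "a \<noteq> b" for a b e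
    using inc(1)[OF ab] by (auto simp: arrow_map_reflect set_eq_iff)
  have "vspace (reflect (reverse_at y \<Lambda>) x (reflect \<Lambda> y M)) = vspace (reflect (reverse_at x \<Lambda>) y (reflect \<Lambda> x M))"
    using vs[OF x y \<open>x \<noteq> y\<close>] vs[OF y x] \<open>x \<noteq> y\<close> by (auto simp: fun_eq_iff)
  moreover have "arrow_map (reflect (reverse_at y \<Lambda>) x (reflect \<Lambda> y M)) =
      arrow_map (reflect (reverse_at x \<Lambda>) y (reflect \<Lambda> x M))"
    using am[OF x y \<open>x \<noteq> y\<close>] am[OF y x] \<open>x \<noteq> y\<close> by (simp add: fun_eq_iff Un_commute)
  ultimately show ?thesis by simp
qed

end

section \<open>Admissible sequences\<close>

lemma equivclp_map:
  assumes "equivclp R a b" "\<And>a b. R a b \<Longrightarrow> R' (f a) (f b)"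
  shows "equivclp R' (f a) (f b)"
  using assms(1)
proof (induction rule: equivclp_induct)
  case base
  show ?case by (rule equivclp_refl)
next
  case (step y z)
  have "equivclp R' (f y) (f z)"
    using step.hyps(2)
  proof
    assume "R y z"
    then show ?thesis by (intro r_into_equivclp assms(2))
  next
    assume "R z y"
    then have "equivclp R' (f z) (f y)" by (intro r_into_equivclp assms(2))
    then show ?thesis by (rule equivclp_sym)
  qed
  with step.IH show ?case by (rule equivclp_trans)
qed

lemma interchange_Cons:
  assumes "sink \<Lambda> x" "interchange ends (reverse_at x \<Lambda>) S T"
  shows "interchange ends \<Lambda> (x # S) (x # T)"
  using assms(2)
proof cases
  case (1 a b A B)
  then show ?thesis using interchange.intros[of ends a b \<Lambda> "x # A" B] assms(1) by simp
qed

lemma seq_equiv_refl: "plus_admissible \<Lambda> S \<Longrightarrow> seq_equiv ends \<Lambda> S S"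
  by (simp add: seq_equiv_def)

lemma seq_equiv_sym: "seq_equiv ends \<Lambda> S T \<Longrightarrow> seq_equiv ends \<Lambda> T S"
  unfolding seq_equiv_def using equivclp_sym[of _ S T] by blast

lemma seq_equiv_trans: "seq_equiv ends \<Lambda> S T \<Longrightarrow> seq_equiv ends \<Lambda> T U \<Longrightarrow> seq_equiv ends \<Lambda> S U"
  unfolding seq_equiv_def using equivclp_trans[of _ S T U] by blast

lemma seq_equiv_Cons:
  assumes "sink \<Lambda> x" "seq_equiv ends (reverse_at x \<Lambda>) S T"
  shows "seq_equiv ends \<Lambda> (x # S) (x # T)"
  unfolding seq_equiv_def
proof (intro conjI)
  show "equivclp (interchange ends \<Lambda>) (x # S) (x # T)"
  proof (rule equivclp_map[where f = "(#) x"])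
    show "equivclp (interchange ends (reverse_at x \<Lambda>)) S T" using assms(2) by (simp add: seq_equiv_def)
    show "interchange ends \<Lambda> (x # U) (x # V)" if "interchange ends (reverse_at x \<Lambda>) U V" for U V
      by (rule interchange_Cons[OF assms(1) that])
  qed
qed (use assms in \<open>simp_all add: seq_equiv_def\<close>)

lemma seq_equiv_length:
  assumes "seq_equiv ends \<Lambda> S T"
  shows "length S = length T"
proof -
  have "equivclp (interchange ends \<Lambda>) S T" using assms by (simp add: seq_equiv_def)
  then show ?thesis
    by (induction rule: equivclp_induct) (auto elim!: interchange.cases)
qed

lemma vspace_reflect_along_notin:
  "x \<notin> set S \<Longrightarrow> vspace (reflect_along \<Lambda> S M) x = vspace M x"
  by (induction S arbitrary: \<Lambda> M) (auto simp: vspace_reflect)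

context
  fixes ends :: "'e::finite \<Rightarrow> 'v::finite set"
  assumes loopless: "loopless ends"
begin

text \<open>A sink \<open>x\<close> remains a sink until it is reflected itself. Up to its first
  occurrence it is therefore a sink alongside each earlier letter and can be interchanged with
  it.\<close>

lemma sink_to_front:
  assumes "orientation ends \<Lambda>" "sink \<Lambda> x" "plus_admissible \<Lambda> (A @ x # B)" "x \<notin> set A"
  shows "seq_equiv ends \<Lambda> (A @ x # B) (x # A @ B) \<and>
    reflect_along \<Lambda> (A @ x # B) M = reflect_along \<Lambda> (x # A @ B) M"
  using assms
proof (induction A arbitrary: \<Lambda> M)
  case Nil
  then show ?case by (simp add: seq_equiv_refl)
next
  case (Cons y A)
  have o: "orientation ends \<Lambda>" and x: "sink \<Lambda> x" and y: "sink \<Lambda> y" and xy: "x \<noteq> y"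
    and adm: "plus_admissible (reverse_at y \<Lambda>) (A @ x # B)" and xA: "x \<notin> set A"
    using Cons.prems by auto
  have sx: "sink (reverse_at y \<Lambda>) x" by (rule sink_reverse_at[OF loopless o x y xy])
  have sy: "sink (reverse_at x \<Lambda>) y" by (rule sink_reverse_at[OF loopless o y x xy[symmetric]])
  note IH = Cons.IH[OF orientation_reverse_at[OF o] sx adm xA]
  have comm: "reverse_at x (reverse_at y \<Lambda>) = reverse_at y (reverse_at x \<Lambda>)" by (rule reverse_at_commute)
  have "plus_admissible (reverse_at y \<Lambda>) (x # A @ B)" using IH by (simp add: seq_equiv_def)
  then have 1: "plus_admissible \<Lambda> (y # x # A @ B)" using y by simp
  then have 2: "plus_admissible \<Lambda> (x # y # A @ B)" using x sy comm by simp
  have "interchange ends \<Lambda> (y # x # A @ B) (x # y # A @ B)"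
    using interchange.intros[of ends y x \<Lambda> "[]" "A @ B"] sinks_not_adj[OF o y x] 1 2 by simp
  then have "seq_equiv ends \<Lambda> (y # x # A @ B) (x # y # A @ B)" using 1 2 by (auto simp: seq_equiv_def)
  moreover have "seq_equiv ends \<Lambda> (y # A @ x # B) (y # x # A @ B)"
    by (rule seq_equiv_Cons[OF y]) (use IH in blast)
  ultimately have "seq_equiv ends \<Lambda> ((y # A) @ x # B) (x # (y # A) @ B)"
    using seq_equiv_trans[of ends \<Lambda> "y # A @ x # B" "y # x # A @ B" "x # y # A @ B"] by simp
  moreover have "reflect_along \<Lambda> ((y # A) @ x # B) M = reflect_along \<Lambda> (x # (y # A) @ B) M"
    using IH[of "reflect \<Lambda> y M"] reflect_commute[OF loopless o x y xy, of M] comm by simp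
  ultimately show ?case by blast
qed

text \<open>Leastness of \<open>S\<close> is what the induction can use: cancelling \<open>x\<close>
  from an arbitrary annihilating \<open>T\<close> gives a sequence annihilating \<open>N\<close>, to
  which the hypothesis for the tail of \<open>S\<close> applies.\<close>

lemma annihilated_with_minimum:
  assumes d: "subharmonic ends d" "\<And>v. 0 < d v"
    and "orientation ends \<Lambda>" "plus_admissible \<Lambda> S"
  shows "\<exists>M :: ('v, 'e, 'k::field) rep. quiver_rep \<Lambda> M \<and> annihilates \<Lambda> S M \<and>
    (\<forall>T. plus_admissible \<Lambda> T \<and> annihilates \<Lambda> T M \<longrightarrow> subsequence ends \<Lambda> S T)"
  using assms(3-)
proof (induction S arbitrary: \<Lambda>)
  case Nil
  have fd0: "fin_dim {0 :: ('e, 'k) ambient}" unfolding fin_dim_def by (auto intro!: exI[of _ "{}"])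
  define M :: "('v, 'e, 'k) rep" where "M = \<lparr>vspace = (\<lambda>_. {0}), arrow_map = (\<lambda>_ _. 0)\<rparr>"
  have "quiver_rep \<Lambda> M" unfolding quiver_rep_iff M_def using fd0 by (simp add: linear_between_def)
  moreover have "annihilates \<Lambda> [] M" by (simp add: annihilates_def M_def)
  moreover have "subsequence ends \<Lambda> [] T" if "plus_admissible \<Lambda> T" for T
    using that by (auto simp: subsequence_def reverse_along_def seq_equiv_refl intro!: exI[of _ T])
  ultimately show ?case by blast
next
  case (Cons x S)
  let ?L = "reverse_at x \<Lambda>"
  have o: "orientation ends \<Lambda>" and x: "sink \<Lambda> x" and S: "plus_admissible ?L S"
    using Cons.prems by auto
  note o' = orientation_reverse_at[OF o, of x]
  obtain N :: "('v, 'e, 'k) rep" where N: "quiver_rep ?L N" "annihilates ?L S N"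
    "\<And>T. plus_admissible ?L T \<Longrightarrow> annihilates ?L T N \<Longrightarrow> subsequence ends ?L S T"
    using Cons.IH[OF o' S] by blast
  have "\<exists>M :: ('v, 'e, 'k) rep. quiver_rep \<Lambda> M \<and> vspace M x \<noteq> {0} \<and>
      embeds ?L N (reflect \<Lambda> x M) \<and> embeds ?L (reflect \<Lambda> x M) N"
    by (rule reflect_preimage[OF loopless o x N(1)])
      (rule source_kernel_trivial[OF loopless d(1) d(2) o x N(1) S N(2)])
  then obtain M :: "('v, 'e, 'k) rep" where M: "quiver_rep \<Lambda> M" "vspace M x \<noteq> {0}"
    "embeds ?L N (reflect \<Lambda> x M)" "embeds ?L (reflect \<Lambda> x M) N" by blast
  have "annihilates ?L S (reflect \<Lambda> x M)"
    by (rule embeds_annihilates[OF loopless o' S quiver_rep_reflect[OF loopless o x M(1)] M(4) N(2)])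
  then have ann: "annihilates \<Lambda> (x # S) M" by (simp add: annihilates_def)
  have "subsequence ends \<Lambda> (x # S) T" if T: "plus_admissible \<Lambda> T" "annihilates \<Lambda> T M" for T
  proof -
    \<comment> \<open>Reflections at other vertices would leave the nonzero space at
      \<open>x\<close> unchanged.\<close>
    have "x \<in> set T" using T(2) M(2) vspace_reflect_along_notin[of x T \<Lambda> M] by (auto simp: annihilates_def)
    then obtain A B where AB: "T = A @ x # B" "x \<notin> set A" by (metis split_list_first)
    have front: "seq_equiv ends \<Lambda> T (x # A @ B)" "reflect_along \<Lambda> T M = reflect_along \<Lambda> (x # A @ B) M"
      using sink_to_front[OF o x, of A B] T(1) AB by blast+
    have admAB: "plus_admissible ?L (A @ B)" using front(1) by (simp add: seq_equiv_def)
    have "annihilates ?L (A @ B) (reflect \<Lambda> x M)" using T(2) front(2) by (simp add: annihilates_def)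
    \<comment> \<open>The embedding of \<open>N\<close> into the reflection of \<open>M\<close> is
      used here; the opposite one showed that \<open>S\<close> annihilates that reflection.\<close>
    from embeds_annihilates[OF loopless o' admAB N(1) M(3) this]
    have "subsequence ends ?L S (A @ B)" by (rule N(3)[OF admAB])
    then obtain U where U: "plus_admissible (reverse_along S ?L) U" "seq_equiv ends ?L (A @ B) (S @ U)"
      by (auto simp: subsequence_def)
    have "seq_equiv ends \<Lambda> T (x # S @ U)"
      by (rule seq_equiv_trans[OF front(1) seq_equiv_Cons[OF x U(2)]])
    then show ?thesis unfolding subsequence_def using T(1) Cons.prems(2) U(1)
      by (auto simp: reverse_along_def)
  qed
  then show ?case using M(1) ann by blast
qed

end

text \<open>Interchanges preserve length, so neither side can have a nonempty complement.\<close>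

lemma subsequence_antisym:
  assumes "subsequence ends \<Lambda> S T" "subsequence ends \<Lambda> T S"
  shows "seq_equiv ends \<Lambda> S T"
proof -
  obtain U where U: "seq_equiv ends \<Lambda> T (S @ U)" using assms(1) by (auto simp: subsequence_def)
  obtain V where V: "seq_equiv ends \<Lambda> S (T @ V)" using assms(2) by (auto simp: subsequence_def)
  have "U = []" using seq_equiv_length[OF U] seq_equiv_length[OF V] by simp
  then show ?thesis using seq_equiv_sym[OF U] by simp
qed

text \<open>As the least annihilating sequence, \<open>S\<close> qualifies as shortest. The chosen
  representative has \<open>S\<close> as a subsequence and cannot have it as a proper one, so the
  two are equivalent.\<close>

lemma seq_equiv_shortest_seq:
  assumes "plus_admissible \<Lambda> S" "annihilates \<Lambda> S M"
    and min: "\<And>T. plus_admissible \<Lambda> T \<Longrightarrow> annihilates \<Lambda> T M \<Longrightarrow> subsequence ends \<Lambda> S T"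
  shows "seq_equiv ends \<Lambda> S (shortest_seq ends \<Lambda> M)"
proof -
  have "is_shortest_annihilating ends \<Lambda> M S"
    unfolding is_shortest_annihilating_def
  proof (intro conjI allI impI)
    fix S' assume S': "subsequence ends \<Lambda> S' S \<and> \<not> seq_equiv ends \<Lambda> S' S"
    show "\<not> annihilates \<Lambda> S' M"
    proof
      assume "annihilates \<Lambda> S' M"
      moreover have "plus_admissible \<Lambda> S'" using S' by (simp add: subsequence_def)
      ultimately show False using subsequence_antisym[of ends \<Lambda> S' S] min[of S'] S' by blast
    qed
  qed (rule assms)+
  then have *: "is_shortest_annihilating ends \<Lambda> M (shortest_seq ends \<Lambda> M)"
    unfolding shortest_seq_def by (rule someI)
  then have "subsequence ends \<Lambda> S (shortest_seq ends \<Lambda> M)"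
    unfolding is_shortest_annihilating_def using min by blast
  then show ?thesis using * assms(2) unfolding is_shortest_annihilating_def by blast
qed

theorem corollary4p7:
  fixes ends :: "'e::finite \<Rightarrow> 'v::finite set"
    and \<Lambda> :: "('v, 'e) orient"
    and S :: "'v list"
  assumes "loopless ends"
    and "connected_graph ends"
    and "CARD('v) > 1"
    and "orientation ends \<Lambda>"
    and "no_oriented_cycles \<Lambda>"
    and "\<not> dynkin_ADE ends"
    and "plus_admissible \<Lambda> S"
  shows "reduced_word ends S \<and>
    (\<exists>M :: ('v, 'e, 'k::field) rep.
       quiver_rep \<Lambda> M \<and> preprojective \<Lambda> M \<and> seq_equiv ends \<Lambda> S (shortest_seq ends \<Lambda> M))"
proof
  obtain d where d: "subharmonic ends d" "\<And>v. 0 < d v"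
    using subharmonic_if_not_dynkin[OF assms(1,2,6)] by blast
  show "reduced_word ends S"
    using admissible_roots[OF assms(1) d assms(4,7)] by (intro reduced_wordI) blast
  obtain M :: "('v, 'e, 'k) rep" where M: "quiver_rep \<Lambda> M" "annihilates \<Lambda> S M"
    "\<And>T. plus_admissible \<Lambda> T \<Longrightarrow> annihilates \<Lambda> T M \<Longrightarrow> subsequence ends \<Lambda> S T"
    using annihilated_with_minimum[OF assms(1) d assms(4,7)] by blast
  have "preprojective \<Lambda> M" using assms(7) M(2) by (auto simp: preprojective_def)
  then show "\<exists>M :: ('v, 'e, 'k) rep.
      quiver_rep \<Lambda> M \<and> preprojective \<Lambda> M \<and> seq_equiv ends \<Lambda> S (shortest_seq ends \<Lambda> M)"
    using M(1) seq_equiv_shortest_seq[OF assms(7) M(2,3)] by blast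
qed

end
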